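(* Let $\mathcal E,\mathcal G$ be Hilbert spaces and let $F:[B(\mathcal H)^n]_1\to B(\mathcal H)\bar\otimes_{min}B(\mathcal E,\mathcal G)$ be a bounded free holomorphic function with $\|F\|_\infty\le 1$, with model boundary function $\widetilde F$. For each operator $A=I_{\mathcal H}\otimes A_0$ with $A_0\in B(\mathcal E,\mathcal G)$ and $\|A_0\|<1$, define the map $\Psi_A[F]:[B(\mathcal H)^n]_1\to B(\mathcal H)\bar\otimes_{min}B(\mathcal E,\mathcal G)$ by $$\Psi_A[F]:=A-D_{A^*}(I-FA^* )^{-1}FD_A .$$ Then: (i) $\Psi_A[F]$ is a bounded free holomorphic function with $\|\Psi_A[F]\|_\infty\le 1$, and its boundary function satisfies $\widetilde{\Psi_A[F]}=\Psi_A(\widetilde F)$ and $$I-\widetilde{\Psi_A[F]}\,\widetilde{\Psi_A[F]}^*=D_{A^*}(I-\widetilde FA^* )^{-1}(I-\widetilde F\widetilde F^* )(I-A\widetilde F^* )^{-1}D_{A^*},$$ $$I-\widetilde{\Psi_A[F]}^*\,\widetilde{\Psi_A[F]}=D_{A}(I-\widetilde F^*A)^{-1}(I-\widetilde F^*\widetilde F)(I-A^*\widetilde F)^{-1}D_{A};$$ (ii) for any $X\in[B(\mathcal H)^n]_1$, $$\Psi_A[F](X)=(P_X\otimes I)\{\Psi_A(\widetilde F)\}=A-D_{A^*}[I-F(X)A^*]^{-1}F(X)D_A=\Psi_A[F(X)],$$ where $P_X$ is the noncommutative Poisson transform at $X$; (iii) $\Psi_A[0]=A$, $\Psi_A[A]=0$,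 and $\Psi_A[\Psi_A[F]]=F$; (iv) $\Psi_A:\mathcal S_{\bf ball}(B(\mathcal E,\mathcal G))\to\mathcal S_{\bf ball}(B(\mathcal E,\mathcal G))$ is a homeomorphism; (v) $\widetilde F$ is inner if and only if $\widetilde{\Psi_A[F]}$ is inner; (vi) $\widetilde F\in\mathcal A_n\bar\otimes_{min}B(\mathcal E,\mathcal G)$ if and only if $\widetilde{\Psi_A[F]}\in\mathcal A_n\bar\otimes_{min}B(\mathcal E,\mathcal G)$.
   Context: $\mathcal H$ is a separable infinite dimensional Hilbert space and $n\in\{1,2,\dots\}\cup\{\infty\}$. A tuple $X=(X_1,\dots,X_n)\in B(\mathcal H)^n$ is identified with the row operator $[X_1\,\cdots\,X_n]:\mathcal H^{(n)}\to\mathcal H$; $\|X\|=\|\sum_iX_iX_i^*\|^{1/2}$, and $[B(\mathcal H)^n]_1=\{X:\|X\|<1\}$. $\mathbb F_n^+$ is the unital free semigroup on $g_1,\dots,g_n$; for $\alpha=g_{i_1}\cdots g_{i_k}$ put $|\alpha|=k$, $X_\alpha=X_{i_1}\cdots X_{i_k}$ (and $X_{g_0}=I$, $|g_0|=0$, for the neutral element $g_0$). A free holomorphic function on $[B(\mathcal H)^n]_1$ with coefficients in $B(\mathcal E,\mathcal G)$ is a map $F(X)=\sum_{k=0}^\infty\sum_{|\alpha|=k}X_\alpha\otimes A_{(\alpha)}$ with $A_{(\alpha)}\in B(\mathcal E,\mathcal G)$, the series in $k$ converging in operator norm for all $X\in[B(\mathcal H)^n]_1$; here $B(\mathcal H)\bar\otimes_{min}B(\mathcal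 E,\mathcal G)$ is the spatial (minimal) tensor product. The same series evaluates $F$ at strict row contractions on any Hilbert space. $\|F\|_\infty=\sup_{\|X\|<1}\|F(X)\|$, and $F$ is bounded if this is finite. $F^2(H_n)=\mathbb C1\oplus\bigoplus_{k\ge1}H_n^{\otimes k}$ is the full Fock space of an $n$-dimensional Hilbert space $H_n$ with orthonormal basis $e_1,\dots,e_n$; $S_i\varphi=e_i\otimes\varphi$ are the left creation operators; $e_\alpha=e_{i_1}\otimes\cdots\otimes e_{i_k}$, $e_{g_0}=1$. $\mathcal A_n$ (noncommutative disc algebra) is the norm closed algebra generated by $S_1,\dots,S_n,I$; $F_n^\infty$ is its weak closure. The model boundary function of a bounded $F$ is $\widetilde F=\text{SOT-}\lim_{r\to1}F(rS_1,\dots,rS_n)\in F_n^\infty\bar\otimes B(\mathcal E,\mathcal G)$ (weakly closed spatial tensor product). $F$ (or $\widetilde F$) is called inner if $\widetilde F$ is an isometry. For $X\in[B(\mathcal H)^n]_1$ let $\Delta_X=(I-\sum_iX_iX_i^* )^{1/2}$ and $K_X:\mathcal H\to\mathcal H\otimes F^2(H_n)$, $K_Xh=\sum_\alpha\Delta_XX_\alpha^*h\otimes e_\alpha$. The noncommutative Poisson transform at $X$ is $P_X[f]=K_X^*(I_{\mathcal H}\otimes f)K_X$, $f\in F_n^\infty$, and $P_X\otimes I$ is its natural extension to $F_n^\infty\bar\otimes B(\mathcal E,\mathcal G)$, given by the same formula with $K_X$ amplified. For contractions $A,B\in B(\mathcal X,\mathcal Y)$ between Hilbert spaces with $\|A\|<1$: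 $D_A=(I-A^*A)^{1/2}$, $D_{A^*}=(I-AA^* )^{1/2}$, $\Psi_A(B)=A-D_{A^*}(I-BA^* )^{-1}BD_A$ (also written $\Psi_A[B]$). The operator $A=I\otimes A_0$ is used with the identity on whichever space is relevant ($\mathcal H$ or $F^2(H_n)$), and is also viewed as the constant free holomorphic function. $\mathcal S_{\bf ball}(B(\mathcal E,\mathcal G))$ is the set of free holomorphic functions $G$ on $[B(\mathcal H)^n]_1$ with coefficients in $B(\mathcal E,\mathcal G)$ and $\|G\|_\infty\le1$, with the topology of the norm $\|\cdot\|_\infty$. *)

theory Defs
  imports "HOL-Analysis.Analysis"
begin

section \<open>Complex Hilbert spaces\<close>

text \<open>The inner product is linear in its first argument.  The real inner product space
  underlying a complex Hilbert space carries the same norm.\<close>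

class chilbert_space = real_inner + banach +
  fixes scaleC :: "complex \<Rightarrow> 'a \<Rightarrow> 'a" (infixr \<open>*\<^sub>C\<close> 75)
    and cinner :: "'a \<Rightarrow> 'a \<Rightarrow> complex"
  assumes scaleC_add_right: "a *\<^sub>C (x + y) = a *\<^sub>C x + a *\<^sub>C y"
    and scaleC_add_left: "(a + b) *\<^sub>C x = a *\<^sub>C x + b *\<^sub>C x"
    and scaleC_scaleC: "a *\<^sub>C b *\<^sub>C x = (a * b) *\<^sub>C x"
    and scaleR_scaleC: "r *\<^sub>R x = of_real r *\<^sub>C x"
    and cinner_commute: "cinner x y = cnj (cinner y x)"
    and cinner_add_left: "cinner (x + y) z = cinner x z + cinner y z"
    and cinner_scaleC_left: "cinner (a *\<^sub>C x) y = a * cinner x y"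
    and inner_eq_Re_cinner: "inner x y = Re (cinner x y)"

lemma cinner_add_right:
  fixes x y z :: "'a::chilbert_space"
  shows "cinner x (y + z) = cinner x y + cinner x z"
  by (metis cinner_add_left cinner_commute complex_cnj_add)

lemma cinner_scaleC_right:
  fixes x y :: "'a::chilbert_space"
  shows "cinner x (a *\<^sub>C y) = cnj a * cinner x y"
  by (metis cinner_scaleC_left cinner_commute complex_cnj_mult)

lemma cinner_zero_left [simp]:
  fixes x :: "'a::chilbert_space"
  shows "cinner 0 x = 0"
  using cinner_add_left[of 0 0 x] by simp

lemma cinner_zero_right [simp]:
  fixes x :: "'a::chilbert_space"
  shows "cinner x 0 = 0"
  using cinner_add_right[of x 0 0] by simp

lemma scaleC_zero_right [simp]:
  shows "a *\<^sub>C (0 :: 'a::chilbert_space) = 0"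
  using scaleC_add_right[of a 0 0] by simp

lemma scaleC_zero_left [simp]:
  fixes x :: "'a::chilbert_space"
  shows "0 *\<^sub>C x = 0"
  using scaleC_add_left[of 0 0 x] by simp

lemma scaleC_one [simp]:
  fixes x :: "'a::chilbert_space"
  shows "1 *\<^sub>C x = x"
  using scaleR_scaleC[of 1 x] by simp

lemma scaleC_minus_right:
  fixes x :: "'a::chilbert_space"
  shows "a *\<^sub>C (- x) = - (a *\<^sub>C x)"
  using scaleC_add_right[of a x "- x"] by (simp add: eq_neg_iff_add_eq_0 add.commute)

lemma scaleC_diff_right:
  fixes x y :: "'a::chilbert_space"
  shows "a *\<^sub>C (x - y) = a *\<^sub>C x - a *\<^sub>C y"
  using scaleC_add_right[of a x "- y"] by (simp add: scaleC_minus_right)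

lemma cinner_minus_left:
  fixes x y :: "'a::chilbert_space"
  shows "cinner (- x) y = - cinner x y"
  using cinner_add_left[of x "- x" y] by (simp add: eq_neg_iff_add_eq_0 add.commute)

lemma cinner_diff_left:
  fixes x y z :: "'a::chilbert_space"
  shows "cinner (x - y) z = cinner x z - cinner y z"
  using cinner_add_left[of x "- y" z] by (simp add: cinner_minus_left)

lemma cinner_sum_left:
  fixes y :: "'a::chilbert_space"
  shows "cinner (\<Sum>i\<in>I. f i) y = (\<Sum>i\<in>I. cinner (f i) y)"
  by (induction I rule: infinite_finite_induct) (auto simp: cinner_add_left)

lemma cinner_self:
  fixes x :: "'a::chilbert_space"
  shows "cinner x x = of_real ((norm x)\<^sup>2)"
proof -
  have "Im (cinner x x) = 0"
    using arg_cong[OF cinner_commute[of x x], of Im] by simp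
  thus ?thesis
    by (simp add: complex_eq_iff power2_norm_eq_inner inner_eq_Re_cinner)
qed

lemma norm_scaleC [simp]:
  fixes x :: "'a::chilbert_space"
  shows "norm (a *\<^sub>C x) = cmod a * norm x"
proof -
  have "cinner (a *\<^sub>C x) (a *\<^sub>C x) = (a * cnj a) * cinner x x"
    by (simp add: cinner_scaleC_left cinner_scaleC_right mult.assoc)
  also have "\<dots> = of_real ((cmod a * norm x)\<^sup>2)"
    by (simp add: cinner_self complex_norm_square[symmetric] power_mult_distrib)
  finally have "(norm (a *\<^sub>C x))\<^sup>2 = (cmod a * norm x)\<^sup>2"
    by (simp only: cinner_self of_real_eq_iff)
  thus ?thesis by (simp add: power2_eq_iff_nonneg)
qed

lemma cinner_Cauchy_Schwarz:
  fixes x y :: "'a::chilbert_space"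
  shows "cmod (cinner x y) \<le> norm x * norm y"
proof (cases "cinner x y = 0")
  case False
  define c where "c = cnj (cinner x y) / cmod (cinner x y)"
  have nc: "cmod c = 1" using False by (simp add: c_def norm_divide)
  have "c * cinner x y = of_real (cmod (cinner x y))"
    using False by (simp add: c_def complex_norm_square[symmetric] mult.commute power2_eq_square)
  hence "cmod (cinner x y) = Re (cinner (c *\<^sub>C x) y)"
    by (simp add: cinner_scaleC_left)
  also have "\<dots> = inner (c *\<^sub>C x) y" by (simp add: inner_eq_Re_cinner)
  also have "\<dots> \<le> norm (c *\<^sub>C x) * norm y" by (rule norm_cauchy_schwarz)
  finally show ?thesis by (simp add: nc)
qed simp

instantiation complex :: chilbert_space
begin
definition scaleC_complex_def [simp]: "scaleC (a::complex) (x::complex) = a * x"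
definition cinner_complex_def: "cinner (x::complex) y = x * cnj y"
instance
  by standard (auto simp: cinner_complex_def algebra_simps scaleR_conv_of_real inner_complex_def)
end


section \<open>Hilbert space direct sums\<close>

text \<open>The direct sum of copies of \<open>'a\<close> indexed by \<open>'i\<close>.\<close>

typedef (overloaded) ('i, 'a::chilbert_space) ell2 =
  "{f :: 'i \<Rightarrow> 'a. (\<lambda>i. (norm (f i))\<^sup>2) summable_on UNIV}"
  by (rule exI[of _ "\<lambda>_. 0"]) simp

setup_lifting type_definition_ell2

lemma ell2_add_aux:
  fixes f g :: "'i \<Rightarrow> 'a::chilbert_space"
  assumes "(\<lambda>i. (norm (f i))\<^sup>2) summable_on UNIV" "(\<lambda>i. (norm (g i))\<^sup>2) summable_on UNIV"
  shows "(\<lambda>i. (norm (f i + g i))\<^sup>2) summable_on UNIV"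
proof (rule summable_on_comparison_test)
  show "(\<lambda>i. 2 * (norm (f i))\<^sup>2 + 2 * (norm (g i))\<^sup>2) summable_on UNIV"
    using assms by (intro summable_on_add summable_on_cmult_right)
  show "(norm (f i + g i))\<^sup>2 \<le> 2 * (norm (f i))\<^sup>2 + 2 * (norm (g i))\<^sup>2" for i
  proof -
    have "(norm (f i + g i))\<^sup>2 \<le> (norm (f i) + norm (g i))\<^sup>2"
      by (intro power_mono norm_triangle_ineq norm_ge_zero)
    also have "\<dots> \<le> 2 * (norm (f i))\<^sup>2 + 2 * (norm (g i))\<^sup>2"
      using zero_le_power2[of "norm (f i) - norm (g i)"] unfolding power2_sum power2_diff by linarith
    finally show ?thesis .
  qed
qed auto

lemma ell2_cinner_summable:
  fixes f g :: "'i \<Rightarrow> 'a::chilbert_space"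
  assumes "(\<lambda>i. (norm (f i))\<^sup>2) summable_on UNIV" "(\<lambda>i. (norm (g i))\<^sup>2) summable_on UNIV"
  shows "(\<lambda>i. cinner (f i) (g i)) summable_on UNIV"
proof (rule abs_summable_summable, rule summable_on_comparison_test)
  show "(\<lambda>i. (norm (f i))\<^sup>2 + (norm (g i))\<^sup>2) summable_on UNIV"
    using assms by (intro summable_on_add)
  show "cmod (cinner (f i) (g i)) \<le> (norm (f i))\<^sup>2 + (norm (g i))\<^sup>2" for i
  proof -
    have "cmod (cinner (f i) (g i)) \<le> norm (f i) * norm (g i)"
      by (rule cinner_Cauchy_Schwarz)
    also have "\<dots> \<le> (norm (f i))\<^sup>2 + (norm (g i))\<^sup>2"
      using sum_squares_bound[of "norm (f i)" "norm (g i)"]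
        mult_nonneg_nonneg[OF norm_ge_zero norm_ge_zero, of "f i" "g i"] by linarith
    finally show ?thesis .
  qed
qed auto

instantiation ell2 :: (type, chilbert_space) real_inner
begin
lift_definition zero_ell2 :: "('a, 'b) ell2" is "\<lambda>_. 0" by simp
lift_definition plus_ell2 :: "('a, 'b) ell2 \<Rightarrow> ('a, 'b) ell2 \<Rightarrow> ('a, 'b) ell2"
  is "\<lambda>f g i. f i + g i" by (rule ell2_add_aux)
lift_definition uminus_ell2 :: "('a, 'b) ell2 \<Rightarrow> ('a, 'b) ell2" is "\<lambda>f i. - f i" by simp
lift_definition minus_ell2 :: "('a, 'b) ell2 \<Rightarrow> ('a, 'b) ell2 \<Rightarrow> ('a, 'b) ell2"
  is "\<lambda>f g i. f i - g i"
  subgoal for f g using ell2_add_aux[of f "\<lambda>i. - g i"] by simp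
  done
lift_definition scaleR_ell2 :: "real \<Rightarrow> ('a, 'b) ell2 \<Rightarrow> ('a, 'b) ell2"
  is "\<lambda>r f i. r *\<^sub>R f i" by (simp add: power_mult_distrib summable_on_cmult_right)
definition inner_ell2 :: "('a, 'b) ell2 \<Rightarrow> ('a, 'b) ell2 \<Rightarrow> real"
  where "inner_ell2 f g = Re (\<Sum>\<^sub>\<infinity>i. cinner (Rep_ell2 f i) (Rep_ell2 g i))"
definition norm_ell2 :: "('a, 'b) ell2 \<Rightarrow> real" where "norm_ell2 f = sqrt (inner f f)"
definition dist_ell2 :: "('a, 'b) ell2 \<Rightarrow> ('a, 'b) ell2 \<Rightarrow> real"
  where "dist_ell2 f g = norm (f - g)"
definition sgn_ell2 :: "('a, 'b) ell2 \<Rightarrow> ('a, 'b) ell2"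
  where "sgn_ell2 f = scaleR (inverse (norm f)) f"
definition uniformity_ell2 :: "(('a, 'b) ell2 \<times> ('a, 'b) ell2) filter"
  where "uniformity_ell2 = (INF e\<in>{0<..}. principal {(x, y). dist x y < e})"
definition open_ell2 :: "('a, 'b) ell2 set \<Rightarrow> bool"
  where "open_ell2 U = (\<forall>x\<in>U. \<forall>\<^sub>F (x', y) in uniformity. x' = x \<longrightarrow> y \<in> U)"

lemma Rep_ell2_summable: "(\<lambda>i. (norm (Rep_ell2 f i))\<^sup>2) summable_on UNIV"
  using Rep_ell2[of f] by simp

lemma ell2_has_sum:
  "((\<lambda>i. cinner (Rep_ell2 f i) (Rep_ell2 g i)) has_sum
     (\<Sum>\<^sub>\<infinity>i. cinner (Rep_ell2 f i) (Rep_ell2 g i))) UNIV"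
  by (intro has_sum_infsum ell2_cinner_summable Rep_ell2_summable)

lemma inner_self_ell2: "inner f f = (\<Sum>\<^sub>\<infinity>i. (norm (Rep_ell2 f i))\<^sup>2)"
proof -
  have "((\<lambda>i. complex_of_real ((norm (Rep_ell2 f i))\<^sup>2)) has_sum
      (\<Sum>\<^sub>\<infinity>i. cinner (Rep_ell2 f i) (Rep_ell2 f i))) UNIV"
    using ell2_has_sum[of f f] by (simp only: cinner_self)
  from has_sum_Re[OF this] show ?thesis
    by (simp add: inner_ell2_def infsumI)
qed

instance
proof
  fix x y z :: "('a, 'b) ell2" and a b :: real
  show "x + y + z = x + (y + z)" "x + y = y + x" "0 + x = x" "- x + x = 0" "x - y = x + - y"
    "a *\<^sub>R (x + y) = a *\<^sub>R x + a *\<^sub>R y" "(a + b) *\<^sub>R x = a *\<^sub>R x + b *\<^sub>R x"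
    "a *\<^sub>R b *\<^sub>R x = (a * b) *\<^sub>R x" "1 *\<^sub>R x = x"
    by (transfer; auto simp: algebra_simps)+
  show "dist x y = norm (x - y)" "sgn x = inverse (norm x) *\<^sub>R x"
    "norm x = sqrt (inner x x)"
    by (simp_all add: dist_ell2_def sgn_ell2_def norm_ell2_def)
  show "uniformity = (INF e\<in>{0 <..}. principal {(x, y :: ('a, 'b) ell2). dist x y < e})"
    by (simp add: uniformity_ell2_def)
  show "open U = (\<forall>x\<in>U. \<forall>\<^sub>F (x', y) in uniformity. x' = x \<longrightarrow> y \<in> U)"
    for U :: "('a, 'b) ell2 set"
    by (simp add: open_ell2_def)
  show "inner x y = inner y x"
  proof -
    have "(\<Sum>\<^sub>\<infinity>i. cinner (Rep_ell2 x i) (Rep_ell2 y i))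
        = (\<Sum>\<^sub>\<infinity>i. cnj (cinner (Rep_ell2 y i) (Rep_ell2 x i)))"
      by (rule infsum_cong) (rule cinner_commute)
    thus ?thesis by (simp add: inner_ell2_def)
  qed
  show "inner (x + y) z = inner x z + inner y z"
  proof -
    have "((\<lambda>i. cinner (Rep_ell2 (x + y) i) (Rep_ell2 z i)) has_sum
        ((\<Sum>\<^sub>\<infinity>i. cinner (Rep_ell2 x i) (Rep_ell2 z i))
          + (\<Sum>\<^sub>\<infinity>i. cinner (Rep_ell2 y i) (Rep_ell2 z i)))) UNIV"
      using has_sum_add[OF ell2_has_sum[of x z] ell2_has_sum[of y z]]
      by (simp add: plus_ell2.rep_eq cinner_add_left)
    thus ?thesis by (simp add: inner_ell2_def infsumI)
  qed
  show "inner (a *\<^sub>R x) y = a * inner x y"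
  proof -
    have "((\<lambda>i. cinner (Rep_ell2 (a *\<^sub>R x) i) (Rep_ell2 y i)) has_sum
        (of_real a * (\<Sum>\<^sub>\<infinity>i. cinner (Rep_ell2 x i) (Rep_ell2 y i)))) UNIV"
      using has_sum_cmult_right[OF ell2_has_sum[of x y], of "of_real a"]
      by (simp add: scaleR_ell2.rep_eq scaleR_scaleC cinner_scaleC_left)
    thus ?thesis by (simp add: inner_ell2_def infsumI)
  qed
  show "0 \<le> inner x x"
    by (simp add: inner_self_ell2 infsum_nonneg)
  show "inner x x = 0 \<longleftrightarrow> x = 0"
  proof
    assume "inner x x = 0"
    hence "(norm (Rep_ell2 x i))\<^sup>2 = 0" for i
      by (intro nonneg_infsum_le_0D[of "\<lambda>i. (norm (Rep_ell2 x i))\<^sup>2" UNIV])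
         (auto simp: inner_self_ell2 Rep_ell2_summable)
    thus "x = 0" by (intro Rep_ell2_inject[THEN iffD1]) (auto simp: zero_ell2.rep_eq)
  next
    assume "x = 0"
    thus "inner x x = 0" by (simp add: inner_ell2_def zero_ell2.rep_eq)
  qed
qed
end

lemma norm_ell2_power2: "(norm f)\<^sup>2 = (\<Sum>\<^sub>\<infinity>i. (norm (Rep_ell2 f i))\<^sup>2)"
  by (simp add: power2_norm_eq_inner inner_self_ell2)

lemma ell2_sum_le: "finite S \<Longrightarrow> (\<Sum>i\<in>S. (norm (Rep_ell2 f i))\<^sup>2) \<le> (norm f)\<^sup>2"
  unfolding norm_ell2_power2 by (rule finite_sum_le_infsum) (auto simp: Rep_ell2_summable)

lemma ell2_coord_le: "norm (Rep_ell2 f i) \<le> norm f"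
  using ell2_sum_le[of "{i}" f] by (simp add: power2_le_iff_abs_le)

lemma ell2_norm_le:
  assumes "\<And>S. finite S \<Longrightarrow> (\<Sum>i\<in>S. (norm (Rep_ell2 f i))\<^sup>2) \<le> c\<^sup>2" "c \<ge> 0"
  shows "norm f \<le> c"
proof (rule power2_le_imp_le)
  show "(norm f)\<^sup>2 \<le> c\<^sup>2"
    unfolding norm_ell2_power2
    by (rule infsum_le_finite_sums) (auto simp: Rep_ell2_summable assms)
qed (rule assms)

instantiation ell2 :: (type, chilbert_space) chilbert_space
begin
lift_definition scaleC_ell2 :: "complex \<Rightarrow> ('a, 'b) ell2 \<Rightarrow> ('a, 'b) ell2"
  is "\<lambda>c f i. c *\<^sub>C f i" by (simp add: power_mult_distrib summable_on_cmult_right)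
definition cinner_ell2 :: "('a, 'b) ell2 \<Rightarrow> ('a, 'b) ell2 \<Rightarrow> complex"
  where "cinner_ell2 f g = (\<Sum>\<^sub>\<infinity>i. cinner (Rep_ell2 f i) (Rep_ell2 g i))"

instance
proof
  fix x y z :: "('a, 'b) ell2" and a b :: complex and r :: real
  show "a *\<^sub>C (x + y) = a *\<^sub>C x + a *\<^sub>C y"
    by transfer (simp add: scaleC_add_right)
  show "(a + b) *\<^sub>C x = a *\<^sub>C x + b *\<^sub>C x"
    by transfer (simp add: scaleC_add_left)
  show "a *\<^sub>C b *\<^sub>C x = (a * b) *\<^sub>C x"
    by transfer (simp add: scaleC_scaleC)
  show "r *\<^sub>R x = of_real r *\<^sub>C x"
    by transfer (simp add: scaleR_scaleC)
  show "inner x y = Re (cinner x y)"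
    by (simp add: inner_ell2_def cinner_ell2_def)
  show "cinner x y = cnj (cinner y x)"
  proof -
    have "(\<Sum>\<^sub>\<infinity>i. cinner (Rep_ell2 x i) (Rep_ell2 y i))
        = (\<Sum>\<^sub>\<infinity>i. cnj (cinner (Rep_ell2 y i) (Rep_ell2 x i)))"
      by (rule infsum_cong) (rule cinner_commute)
    thus ?thesis by (simp add: cinner_ell2_def)
  qed
  show "cinner (x + y) z = cinner x z + cinner y z"
    using has_sum_add[OF ell2_has_sum[of x z] ell2_has_sum[of y z]]
    by (simp add: cinner_ell2_def plus_ell2.rep_eq cinner_add_left infsumI)
  show "cinner (a *\<^sub>C x) y = a * cinner x y"
    using has_sum_cmult_right[OF ell2_has_sum[of x y], of a]
    by (simp add: cinner_ell2_def scaleC_ell2.rep_eq cinner_scaleC_left infsumI)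
next
  fix X :: "nat \<Rightarrow> ('a, 'b) ell2"
  assume X: "Cauchy X"
  have coord: "norm (Rep_ell2 (X m) i - Rep_ell2 (X n) i) \<le> norm (X m - X n)" for m n i
    using ell2_coord_le[of "X m - X n" i] by (simp add: minus_ell2.rep_eq)
  have "Cauchy (\<lambda>n. Rep_ell2 (X n) i)" for i
    using X coord unfolding Cauchy_def dist_norm by (meson le_less_trans)
  hence "\<forall>i. \<exists>l. (\<lambda>n. Rep_ell2 (X n) i) \<longlonglongrightarrow> l"
    using Cauchy_convergent_iff convergent_def by blast
  then obtain g where g: "\<And>i. (\<lambda>n. Rep_ell2 (X n) i) \<longlonglongrightarrow> g i" by metis
  have bound: "(\<Sum>i\<in>S. (norm (Rep_ell2 (X m) i - g i))\<^sup>2) \<le> e\<^sup>2"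
    if e: "\<And>m n. m \<ge> N \<Longrightarrow> n \<ge> N \<Longrightarrow> norm (X m - X n) \<le> e" and "m \<ge> N" "finite S" for N m e S
  proof (rule tendsto_upperbound)
    show "(\<lambda>n. \<Sum>i\<in>S. (norm (Rep_ell2 (X m) i - Rep_ell2 (X n) i))\<^sup>2)
        \<longlonglongrightarrow> (\<Sum>i\<in>S. (norm (Rep_ell2 (X m) i - g i))\<^sup>2)"
      by (intro tendsto_intros g)
    show "\<forall>\<^sub>F n in sequentially. (\<Sum>i\<in>S. (norm (Rep_ell2 (X m) i - Rep_ell2 (X n) i))\<^sup>2) \<le> e\<^sup>2"
    proof (rule eventually_sequentiallyI[of N])
      fix n assume "n \<ge> N"
      have "(\<Sum>i\<in>S. (norm (Rep_ell2 (X m) i - Rep_ell2 (X n) i))\<^sup>2) \<le> (norm (X m - X n))\<^sup>2"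
        using ell2_sum_le[OF \<open>finite S\<close>, of "X m - X n"] by (simp add: minus_ell2.rep_eq)
      also have "\<dots> \<le> e\<^sup>2"
        using e[OF \<open>m \<ge> N\<close> \<open>n \<ge> N\<close>] by (intro power_mono) auto
      finally show "(\<Sum>i\<in>S. (norm (Rep_ell2 (X m) i - Rep_ell2 (X n) i))\<^sup>2) \<le> e\<^sup>2" .
    qed
  qed auto
  have Cau: "\<exists>N. \<forall>m\<ge>N. \<forall>n\<ge>N. norm (X m - X n) \<le> e" if "e > 0" for e
    using X that unfolding Cauchy_def dist_norm by (meson less_imp_le)
  from Cau[of 1] obtain N where N: "\<And>m n. m \<ge> N \<Longrightarrow> n \<ge> N \<Longrightarrow> norm (X m - X n) \<le> 1" by auto
  have "(\<lambda>i. (norm (Rep_ell2 (X N) i - g i))\<^sup>2) summable_on UNIV"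
    by (rule nonneg_bdd_above_summable_on) (use bound[OF N] in \<open>auto intro!: bdd_aboveI2\<close>)
  hence "(\<lambda>i. (norm (g i - Rep_ell2 (X N) i))\<^sup>2) summable_on UNIV"
    by (simp add: norm_minus_commute)
  hence "(\<lambda>i. (norm (g i - Rep_ell2 (X N) i + Rep_ell2 (X N) i))\<^sup>2) summable_on UNIV"
    by (rule ell2_add_aux) (rule Rep_ell2_summable)
  hence gs: "(\<lambda>i. (norm (g i))\<^sup>2) summable_on UNIV" by simp
  define G where "G = Abs_ell2 g"
  have G: "Rep_ell2 G = g" using gs by (simp add: G_def Abs_ell2_inverse)
  have "X \<longlonglongrightarrow> G"
  proof (rule LIMSEQ_I)
    fix e :: real assume "e > 0"
    with Cau[of "e/2"] obtain M where M: "\<And>m n. m \<ge> M \<Longrightarrow> n \<ge> M \<Longrightarrow> norm (X m - X n) \<le> e/2"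
      by auto
    have "norm (X m - G) \<le> e/2" if "m \<ge> M" for m
      by (rule ell2_norm_le)
         (use bound[OF M that] \<open>e > 0\<close> in \<open>auto simp: minus_ell2.rep_eq G\<close>)
    thus "\<exists>no. \<forall>n\<ge>no. norm (X n - G) < e" using \<open>e > 0\<close> by force
  qed
  thus "convergent X" by (auto simp: convergent_def)
qed
end

lift_definition ell2_single :: "'i \<Rightarrow> 'a::chilbert_space \<Rightarrow> ('i, 'a) ell2"
  is "\<lambda>i x j. if j = i then x else 0"
  subgoal for i x
    by (rule finite_nonzero_values_imp_summable_on, rule finite_subset[of _ "{i}"]) auto
  done



section \<open>Orthonormal bases\<close>

definition orthonormal :: "'a::chilbert_space set \<Rightarrow> bool" where
  "orthonormal B \<longleftrightarrow> (\<forall>x\<in>B. norm x = 1) \<and> (\<forall>x\<in>B. \<forall>y\<in>B. x \<noteq> y \<longrightarrow> cinner x y = 0)"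

definition is_onb :: "'a::chilbert_space set \<Rightarrow> bool" where
  "is_onb B \<longleftrightarrow> orthonormal B \<and> (\<forall>x. (\<forall>b\<in>B. cinner x b = 0) \<longrightarrow> x = 0)"

lemma is_onb_exists: "\<exists>B :: 'a::chilbert_space set. is_onb B"
proof -
  have "\<exists>M\<in>{B :: 'a set. orthonormal B}. \<forall>X\<in>{B. orthonormal B}. M \<subseteq> X \<longrightarrow> X = M"
  proof (rule subset_Zorn')
    fix C :: "'a set set" assume "subset.chain {B. orthonormal B} C"
    hence C: "\<And>B. B \<in> C \<Longrightarrow> orthonormal B" "\<And>A B. A \<in> C \<Longrightarrow> B \<in> C \<Longrightarrow> A \<subseteq> B \<or> B \<subseteq> A"
      by (auto simp: subset_chain_def)
    show "\<Union>C \<in> {B. orthonormal B}"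
      unfolding mem_Collect_eq orthonormal_def
    proof (intro conjI ballI impI)
      fix x assume "x \<in> \<Union>C" thus "norm x = 1" using C(1) by (auto simp: orthonormal_def)
    next
      fix x y assume "x \<in> \<Union>C" "y \<in> \<Union>C" "x \<noteq> y"
      then obtain A B where "x \<in> A" "y \<in> B" "A \<in> C" "B \<in> C" by auto
      with C(2)[of A B] C(1)[of A] C(1)[of B] \<open>x \<noteq> y\<close> show "cinner x y = 0"
        unfolding orthonormal_def by blast
    qed
  qed
  then obtain M :: "'a set" where M: "orthonormal M" "\<And>X. orthonormal X \<Longrightarrow> M \<subseteq> X \<Longrightarrow> X = M"
    by auto
  have "x = 0" if x: "\<forall>b\<in>M. cinner x b = 0" for x
  proof (rule ccontr)
    assume "x \<noteq> 0"
    define u where "u = of_real (inverse (norm x)) *\<^sub>C x"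
    have u: "norm u = 1" "\<forall>b\<in>M. cinner u b = 0" "\<forall>b\<in>M. cinner b u = 0"
      using \<open>x \<noteq> 0\<close> x cinner_commute[of _ x]
      by (auto simp: u_def cinner_scaleC_left cinner_scaleC_right norm_inverse)
    hence "orthonormal (insert u M)" using M(1) by (auto simp: orthonormal_def)
    hence "u \<in> M" using M(2)[of "insert u M"] by auto
    hence "cinner u u = 0" using u by auto
    thus False using u by (simp add: cinner_self)
  qed
  thus ?thesis using M by (auto simp: is_onb_def)
qed

lemma orthonormal_residual:
  assumes "orthonormal B" "finite F" "F \<subseteq> B"
  shows "(norm (x - (\<Sum>b\<in>F. cinner x b *\<^sub>C b)))\<^sup>2 = (norm x)\<^sup>2 - (\<Sum>b\<in>F. (cmod (cinner x b))\<^sup>2)"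
  using assms(2,3)
proof (induction F)
  case (insert a F)
  define r where "r = x - (\<Sum>b\<in>F. cinner x b *\<^sub>C b)"
  have "cinner (\<Sum>b\<in>F. cinner x b *\<^sub>C b) a = 0"
    unfolding cinner_sum_left
    by (rule sum.neutral) (use insert assms(1) in \<open>auto simp: cinner_scaleC_left orthonormal_def\<close>)
  hence ra: "cinner r a = cinner x a" by (simp add: r_def cinner_diff_left)
  have na: "norm a = 1" using insert assms(1) by (auto simp: orthonormal_def)
  define t where "t = cinner x a *\<^sub>C a"
  have "inner r t = (cmod (cinner x a))\<^sup>2"
    by (simp add: t_def inner_eq_Re_cinner cinner_scaleC_right ra mult.commute
        complex_norm_square[symmetric] flip: of_real_power)
  hence "(norm (r - t))\<^sup>2 = (norm r)\<^sup>2 - (cmod (cinner x a))\<^sup>2"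
    by (simp add: power2_norm_eq_inner inner_diff inner_commute)
       (simp add: power2_norm_eq_inner[symmetric] t_def na)
  moreover have eq: "x - (\<Sum>b\<in>insert a F. cinner x b *\<^sub>C b) = r - t"
    using insert by (simp add: r_def t_def)
  moreover have "(norm r)\<^sup>2 = (norm x)\<^sup>2 - (\<Sum>b\<in>F. (cmod (cinner x b))\<^sup>2)"
    using insert by (simp add: r_def)
  moreover have "(\<Sum>b\<in>insert a F. (cmod (cinner x b))\<^sup>2)
      = (cmod (cinner x a))\<^sup>2 + (\<Sum>b\<in>F. (cmod (cinner x b))\<^sup>2)"
    using insert by simp
  ultimately show ?case unfolding eq by linarith
qed auto

lemma orthonormal_sum_norm:
  assumes "orthonormal B" "finite F" "F \<subseteq> B"
  shows "(norm (\<Sum>b\<in>F. c b *\<^sub>C b))\<^sup>2 = (\<Sum>b\<in>F. (cmod (c b))\<^sup>2)"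
  using assms(2,3)
proof (induction F)
  case (insert a F)
  define s where "s = (\<Sum>b\<in>F. c b *\<^sub>C b)"
  have "cinner s a = 0"
    unfolding cinner_sum_left s_def
    by (rule sum.neutral) (use insert assms(1) in \<open>auto simp: cinner_scaleC_left orthonormal_def\<close>)
  hence "inner s (c a *\<^sub>C a) = 0"
    by (simp add: inner_eq_Re_cinner cinner_scaleC_right)
  moreover have "norm a = 1" using insert assms(1) by (auto simp: orthonormal_def)
  ultimately have "(norm (c a *\<^sub>C a + s))\<^sup>2 = (cmod (c a))\<^sup>2 + (norm s)\<^sup>2"
    by (simp add: power2_norm_eq_inner inner_add inner_commute)
       (simp add: power2_norm_eq_inner[symmetric])
  thus ?case using insert by (simp add: s_def)
qed auto

lemma has_sum_metric:
  "(f has_sum x) A \<longleftrightarrow> (\<forall>e>0. \<exists>X. finite X \<and> X \<subseteq> A \<and>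
     (\<forall>Y. finite Y \<and> X \<subseteq> Y \<and> Y \<subseteq> A \<longrightarrow> dist (sum f Y) x < e))"
  unfolding has_sum_def tendsto_iff eventually_finite_subsets_at_top by blast

lemma onb_expansion:
  assumes "is_onb B"
  shows "((\<lambda>b. cinner x b *\<^sub>C b) has_sum x) B"
proof -
  have B: "orthonormal B" and max: "\<And>x. \<forall>b\<in>B. cinner x b = 0 \<Longrightarrow> x = 0"
    using assms by (auto simp: is_onb_def)
  define q where "q S = (\<Sum>b\<in>S. (cmod (cinner x b))\<^sup>2)" for S
  define P where "P S = (\<Sum>b\<in>S. cinner x b *\<^sub>C b)" for S
  define FS where "FS = {S. finite S \<and> S \<subseteq> B}"
  have res: "(norm (x - P S))\<^sup>2 = (norm x)\<^sup>2 - q S" if "S \<in> FS" for S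
    using orthonormal_residual[OF B] that by (auto simp: P_def q_def FS_def)
  have bdd: "bdd_above (q ` FS)"
  proof (rule bdd_aboveI2)
    fix S assume "S \<in> FS" thus "q S \<le> (norm x)\<^sup>2" using res[of S] by (smt (verit) zero_le_power2)
  qed
  have ne: "FS \<noteq> {}" by (auto simp: FS_def)
  define s where "s = (SUP S\<in>FS. q S)"
  have "\<exists>S\<in>FS. s - 1 / Suc n < q S" for n
    using less_cSUP_iff[OF ne bdd, of "s - 1 / Suc n"] by (simp add: s_def)
  then obtain S where S: "\<And>n. S n \<in> FS" "\<And>n. s - 1 / Suc n < q (S n)" by metis
  have tail: "q T < 1 / Suc n" if "T \<in> FS" "T \<inter> S n = {}" for T n
  proof -
    have "q (T \<union> S n) \<le> s"
      unfolding s_def using that S(1)[of n] by (intro cSUP_upper bdd) (auto simp: FS_def)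
    moreover have "q (T \<union> S n) = q T + q (S n)"
      using that S(1)[of n] unfolding q_def FS_def by (intro sum.union_disjoint) auto
    ultimately show ?thesis using S(2)[of n] by linarith
  qed
  have FSd: "A - A' \<in> FS" if "A \<in> FS" for A A' using that by (auto simp: FS_def)
  have nP: "(norm (P T))\<^sup>2 = q T" if "T \<in> FS" for T
    using orthonormal_sum_norm[OF B] that by (auto simp: P_def q_def FS_def)
  have nP': "norm (P (S m - S n)) \<le> e" if "e > 0" "1 / Suc n < e\<^sup>2" for m n e
  proof (rule power2_le_imp_le)
    show "(norm (P (S m - S n)))\<^sup>2 \<le> e\<^sup>2"
      using nP[OF FSd[OF S(1)], of m "S n"] tail[OF FSd[OF S(1)], of m "S n" n] that
      by (auto simp: Int_commute)
  qed (use that in auto)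
  have split: "P (S m) - P (S n) = P (S m - S n) - P (S n - S m)" for m n
  proof -
    have fin: "finite (S m)" "finite (S n)" using S(1) by (auto simp: FS_def)
    have "P (S m) = P (S m - S n) + P (S m \<inter> S n)"
      unfolding P_def using fin by (subst sum.union_disjoint[symmetric]) (auto intro: sum.cong)
    moreover have "P (S n) = P (S n - S m) + P (S m \<inter> S n)"
      unfolding P_def using fin by (subst sum.union_disjoint[symmetric]) (auto intro: sum.cong)
    ultimately show ?thesis by simp
  qed
  have small: "\<exists>N. \<forall>n\<ge>N. 1 / Suc n < e" if e: "e > 0" for e :: real
  proof -
    obtain N where N: "1 / Suc N < e" using nat_approx_posE[OF e] by auto
    have "1 / Suc n < e" if "n \<ge> N" for n
      by (rule le_less_trans[OF _ N]) (use that in \<open>simp add: field_simps\<close>)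
    thus ?thesis by blast
  qed
  have "Cauchy (\<lambda>n. P (S n))"
    unfolding Cauchy_def dist_norm
  proof (intro allI impI)
    fix e :: real assume "e > 0"
    from small[of "(e/3)\<^sup>2"] \<open>e > 0\<close> obtain N where N: "\<And>n. n \<ge> N \<Longrightarrow> 1 / Suc n < (e/3)\<^sup>2" by auto
    have "norm (P (S m) - P (S n)) < e" if "m \<ge> N" "n \<ge> N" for m n
    proof -
      have "norm (P (S m) - P (S n)) \<le> norm (P (S m - S n)) + norm (P (S n - S m))"
        unfolding split by (rule norm_triangle_ineq4)
      also have "\<dots> \<le> e/3 + e/3"
        using \<open>e > 0\<close> N[OF that(1)] N[OF that(2)] by (intro add_mono nP') auto
      finally show ?thesis using \<open>e > 0\<close> by simp
    qed
    thus "\<exists>M. \<forall>m\<ge>M. \<forall>n\<ge>M. norm (P (S m) - P (S n)) < e" by blast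
  qed
  then obtain l where l: "(\<lambda>n. P (S n)) \<longlonglongrightarrow> l"
    using Cauchy_convergent_iff convergent_def by blast
  have "cinner (x - l) b = 0" if "b \<in> B" for b
  proof -
    have "cmod (cinner (x - P (S n)) b) \<le> e" if "e > 0" "1 / Suc n < e\<^sup>2" for n e
    proof -
      have nb: "norm b = 1" using B \<open>b \<in> B\<close> by (auto simp: orthonormal_def)
      have "cinner (P (S n)) b = (\<Sum>a\<in>S n. if a = b then cinner x b else 0)"
        unfolding P_def cinner_sum_left
        by (rule sum.cong) (use B S(1)[of n] \<open>b \<in> B\<close> nb in
            \<open>auto simp: cinner_scaleC_left orthonormal_def FS_def cinner_self\<close>)
      also have "\<dots> = (if b \<in> S n then cinner x b else 0)"
        using S(1)[of n] by (auto simp: FS_def)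
      finally have eq: "cinner (x - P (S n)) b = (if b \<in> S n then 0 else cinner x b)"
        by (simp add: cinner_diff_left)
      have "(cmod (cinner x b))\<^sup>2 \<le> e\<^sup>2" if "b \<notin> S n"
        using tail[of "{b}" n] \<open>b \<in> B\<close> that \<open>1 / Suc n < e\<^sup>2\<close> by (auto simp: FS_def q_def)
      thus ?thesis using \<open>e > 0\<close> eq by (auto intro: power2_le_imp_le)
    qed
    hence "(\<lambda>n. cinner (x - P (S n)) b) \<longlonglongrightarrow> 0"
    proof (intro LIMSEQ_I)
      fix e :: real assume *: "e > 0" and
        **: "\<And>e n. e > 0 \<Longrightarrow> 1 / Suc n < e\<^sup>2 \<Longrightarrow> cmod (cinner (x - P (S n)) b) \<le> e"
      from small[of "(e/2)\<^sup>2"] * obtain N where N: "\<And>n. n \<ge> N \<Longrightarrow> 1 / Suc n < (e/2)\<^sup>2" by auto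
      have "cmod (cinner (x - P (S n)) b - 0) < e" if "n \<ge> N" for n
        using **[of "e/2" n] N[OF that] * by auto
      thus "\<exists>N. \<forall>n\<ge>N. cmod (cinner (x - P (S n)) b - 0) < e" by blast
    qed
    moreover have "(\<lambda>n. cinner (x - P (S n)) b) \<longlonglongrightarrow> cinner (x - l) b"
    proof (rule Lim_null[THEN iffD2], rule Lim_null_comparison)
      show "\<forall>\<^sub>F n in sequentially. cmod (cinner (x - P (S n)) b - cinner (x - l) b) \<le> norm (P (S n) - l) * norm b"
        using cinner_Cauchy_Schwarz[of "l - P (S _)" b]
        by (intro always_eventually allI) (simp add: cinner_diff_left norm_minus_commute)
      have "(\<lambda>n. P (S n) - l) \<longlonglongrightarrow> 0" using l by (simp add: LIM_zero)
      thus "(\<lambda>n. norm (P (S n) - l) * norm b) \<longlonglongrightarrow> 0"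
        by (intro tendsto_mult_left_zero tendsto_norm_zero)
    qed
    ultimately show ?thesis by (rule LIMSEQ_unique[symmetric])
  qed
  hence "x - l = 0" by (intro max) auto
  hence l: "(\<lambda>n. P (S n)) \<longlonglongrightarrow> x" using l by simp
  show ?thesis
    unfolding has_sum_metric
  proof (intro allI impI)
    fix e :: real assume "e > 0"
    with l obtain n where n: "norm (x - P (S n)) < e"
      by (metis LIMSEQ_D norm_minus_commute order_refl)
    have "dist (P Y) x < e" if Y: "finite Y \<and> S n \<subseteq> Y \<and> Y \<subseteq> B" for Y
    proof -
      have "q (S n) \<le> q Y" unfolding q_def using Y by (intro sum_mono2) auto
      hence "(norm (x - P Y))\<^sup>2 \<le> (norm (x - P (S n)))\<^sup>2"
        using res[of Y] res[OF S(1), of n] Y by (auto simp: FS_def)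
      hence "norm (x - P Y) \<le> norm (x - P (S n))" by (rule power2_le_imp_le) simp
      thus ?thesis using n by (simp add: dist_norm norm_minus_commute)
    qed
    thus "\<exists>X. finite X \<and> X \<subseteq> B \<and> (\<forall>Y. finite Y \<and> X \<subseteq> Y \<and> Y \<subseteq> B \<longrightarrow>
        dist (\<Sum>b\<in>Y. cinner x b *\<^sub>C b) x < e)"
      using S(1)[of n] unfolding P_def FS_def by (intro exI[of _ "S n"]) auto
  qed
qed

lemma bounded_linear_cinner_left: "bounded_linear (\<lambda>x. cinner x y)"
  by (rule bounded_linear_intro[where K = "norm y"])
     (auto simp: cinner_add_left scaleR_scaleC cinner_scaleC_left scaleR_conv_of_real
       intro: cinner_Cauchy_Schwarz)

lemma onb_Parseval:
  assumes "is_onb B"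
  shows "((\<lambda>b. cinner x b * cinner b y) has_sum cinner x y) B"
  using has_sum_bounded_linear[OF bounded_linear_cinner_left onb_expansion[OF assms], of x y]
  by (simp add: cinner_scaleC_left)



section \<open>Hilbert space tensor products\<close>

text \<open>With a fixed orthonormal basis \<open>onb\<close> of \<open>'b\<close>, the tensor product of \<open>'a\<close> and \<open>'b\<close> is
  realised as the direct sum of copies of \<open>'a\<close> indexed by \<open>onb\<close>.  The lemmas
  \<open>cinner_tensor\<close>, \<open>tensor_add_left\<close>, \dots, \<open>closure_span_tensor\<close> below show that it is the Hilbert
  space tensor product, which is determined by these properties up to a unitary.\<close>

definition onb :: "'a::chilbert_space set" where
  "onb = (SOME B. is_onb B)"

lemma is_onb_onb: "is_onb onb"
  unfolding onb_def using is_onb_exists by (rule someI_ex)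

typedef (overloaded) ('a::chilbert_space, 'b::chilbert_space) htensor =
  "{f :: ('b, 'a) ell2. \<forall>y. y \<notin> onb \<longrightarrow> Rep_ell2 f y = 0}"
  by (rule exI[of _ 0]) (simp add: zero_ell2.rep_eq)

setup_lifting type_definition_htensor

instantiation htensor :: (chilbert_space, chilbert_space) real_inner
begin
lift_definition zero_htensor :: "('a, 'b) htensor" is 0 by (simp add: zero_ell2.rep_eq)
lift_definition plus_htensor :: "('a, 'b) htensor \<Rightarrow> ('a, 'b) htensor \<Rightarrow> ('a, 'b) htensor"
  is "(+)" by (simp add: plus_ell2.rep_eq)
lift_definition uminus_htensor :: "('a, 'b) htensor \<Rightarrow> ('a, 'b) htensor"
  is uminus by (simp add: uminus_ell2.rep_eq)
lift_definition minus_htensor :: "('a, 'b) htensor \<Rightarrow> ('a, 'b) htensor \<Rightarrow> ('a, 'b) htensor"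
  is "(-)" by (simp add: minus_ell2.rep_eq)
lift_definition scaleR_htensor :: "real \<Rightarrow> ('a, 'b) htensor \<Rightarrow> ('a, 'b) htensor"
  is scaleR by (simp add: scaleR_ell2.rep_eq)
lift_definition inner_htensor :: "('a, 'b) htensor \<Rightarrow> ('a, 'b) htensor \<Rightarrow> real" is inner .
lift_definition norm_htensor :: "('a, 'b) htensor \<Rightarrow> real" is norm .
lift_definition dist_htensor :: "('a, 'b) htensor \<Rightarrow> ('a, 'b) htensor \<Rightarrow> real" is dist .
lift_definition sgn_htensor :: "('a, 'b) htensor \<Rightarrow> ('a, 'b) htensor" is sgn
  by (simp add: sgn_ell2_def scaleR_ell2.rep_eq)
definition uniformity_htensor :: "(('a, 'b) htensor \<times> ('a, 'b) htensor) filter"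
  where "uniformity_htensor = (INF e\<in>{0<..}. principal {(x, y). dist x y < e})"
definition open_htensor :: "('a, 'b) htensor set \<Rightarrow> bool"
  where "open_htensor U = (\<forall>x\<in>U. \<forall>\<^sub>F (x', y) in uniformity. x' = x \<longrightarrow> y \<in> U)"

instance
proof
  fix x y z :: "('a, 'b) htensor" and a b :: real
  show "x + y + z = x + (y + z)" "x + y = y + x" "0 + x = x" "- x + x = 0" "x - y = x + - y"
    "a *\<^sub>R (x + y) = a *\<^sub>R x + a *\<^sub>R y" "(a + b) *\<^sub>R x = a *\<^sub>R x + b *\<^sub>R x"
    "a *\<^sub>R b *\<^sub>R x = (a * b) *\<^sub>R x" "1 *\<^sub>R x = x"
    "dist x y = norm (x - y)" "sgn x = inverse (norm x) *\<^sub>R x" "norm x = sqrt (inner x x)"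
    "inner x y = inner y x" "inner (x + y) z = inner x z + inner y z"
    "inner (a *\<^sub>R x) y = a * inner x y" "0 \<le> inner x x" "inner x x = 0 \<longleftrightarrow> x = 0"
    by (transfer; simp add: algebra_simps dist_norm sgn_ell2_def norm_eq_sqrt_inner inner_commute)+
  show "uniformity = (INF e\<in>{0 <..}. principal {(x, y :: ('a, 'b) htensor). dist x y < e})"
    by (simp add: uniformity_htensor_def)
  show "open U = (\<forall>x\<in>U. \<forall>\<^sub>F (x', y) in uniformity. x' = x \<longrightarrow> y \<in> U)"
    for U :: "('a, 'b) htensor set"
    by (simp add: open_htensor_def)
qed
end

instantiation htensor :: (chilbert_space, chilbert_space) chilbert_space
begin
lift_definition scaleC_htensor :: "complex \<Rightarrow> ('a, 'b) htensor \<Rightarrow> ('a, 'b) htensor"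
  is scaleC by (simp add: scaleC_ell2.rep_eq)
lift_definition cinner_htensor :: "('a, 'b) htensor \<Rightarrow> ('a, 'b) htensor \<Rightarrow> complex" is cinner .

instance
proof
  fix x y z :: "('a, 'b) htensor" and a b :: complex and r :: real
  show "a *\<^sub>C (x + y) = a *\<^sub>C x + a *\<^sub>C y" "(a + b) *\<^sub>C x = a *\<^sub>C x + b *\<^sub>C x"
    "a *\<^sub>C b *\<^sub>C x = (a * b) *\<^sub>C x" "r *\<^sub>R x = of_real r *\<^sub>C x"
    "cinner (x + y) z = cinner x z + cinner y z"
    "cinner (a *\<^sub>C x) y = a * cinner x y" "inner x y = Re (cinner x y)"
    by (transfer; simp add: scaleC_add_right scaleC_add_left scaleC_scaleC scaleR_scaleC
        cinner_add_left cinner_scaleC_left inner_eq_Re_cinner)+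
  show "cinner x y = cnj (cinner y x)"
    by transfer (rule cinner_commute)
next
  fix X :: "nat \<Rightarrow> ('a, 'b) htensor"
  assume "Cauchy X"
  hence "Cauchy (\<lambda>n. Rep_htensor (X n))"
    by (simp add: Cauchy_def dist_htensor.rep_eq)
  then obtain L where L: "(\<lambda>n. Rep_htensor (X n)) \<longlonglongrightarrow> L"
    using Cauchy_convergent_iff convergent_def by blast
  have "Rep_ell2 L y = 0" if "y \<notin> onb" for y
  proof -
    have "norm (Rep_ell2 L y) \<le> norm (L - Rep_htensor (X n))" for n
      using ell2_coord_le[of "L - Rep_htensor (X n)" y] Rep_htensor[of "X n"] that
      by (simp add: minus_ell2.rep_eq)
    moreover have "(\<lambda>n. norm (L - Rep_htensor (X n))) \<longlonglongrightarrow> norm (L - L)"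
      by (intro tendsto_intros L)
    ultimately have "norm (Rep_ell2 L y) \<le> norm (L - L)"
      by (intro LIMSEQ_le_const[where X = "\<lambda>n. norm (L - Rep_htensor (X n))"]) auto
    thus ?thesis by simp
  qed
  hence "Rep_htensor (Abs_htensor L) = L" by (intro Abs_htensor_inverse) simp
  hence "X \<longlonglongrightarrow> Abs_htensor L"
    using L by (simp add: lim_sequentially dist_htensor.rep_eq)
  thus "convergent X" by (auto simp: convergent_def)
qed
end

lemma tensor_summable_aux:
  fixes x :: "'a::chilbert_space" and y :: "'b::chilbert_space"
  shows "(\<lambda>b. (norm (if b \<in> onb then cinner y b *\<^sub>C x else 0))\<^sup>2) summable_on UNIV"
proof -
  have "((\<lambda>b. Re (cinner y b * cinner b y)) has_sum Re (cinner y y)) onb"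
    by (intro has_sum_Re onb_Parseval is_onb_onb)
  moreover have "Re (cinner y b * cinner b y) = (cmod (cinner y b))\<^sup>2" for b
    by (subst cinner_commute[of b y]) (simp add: complex_norm_square[symmetric] flip: of_real_power)
  ultimately have "(\<lambda>b. (cmod (cinner y b))\<^sup>2) summable_on onb"
    by (auto simp: summable_on_def)
  hence "(\<lambda>b. (cmod (cinner y b))\<^sup>2 * (norm x)\<^sup>2) summable_on onb"
    by (rule summable_on_cmult_left)
  thus ?thesis
    by (rule summable_on_cong_neutral[THEN iffD1, rotated -1]) (auto simp: power_mult_distrib)
qed

lemma Rep_tensor_aux:
  fixes x :: "'a::chilbert_space" and y :: "'b::chilbert_space"
  shows "Rep_ell2 (Abs_ell2 (\<lambda>b. if b \<in> onb then cinner y b *\<^sub>C x else 0))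
    = (\<lambda>b. if b \<in> onb then cinner y b *\<^sub>C x else 0)"
  by (rule Abs_ell2_inverse, rule CollectI, rule tensor_summable_aux)

lift_definition tensor :: "'a::chilbert_space \<Rightarrow> 'b::chilbert_space \<Rightarrow> ('a, 'b) htensor"
    (infixr \<open>\<otimes>\<^sub>h\<close> 70)
  is "\<lambda>x y. Abs_ell2 (\<lambda>b. if b \<in> onb then cinner y b *\<^sub>C x else 0)"
  by (simp add: Rep_tensor_aux)

lemma Rep_tensor:
  "Rep_ell2 (Rep_htensor (x \<otimes>\<^sub>h y)) = (\<lambda>b. if b \<in> onb then cinner y b *\<^sub>C x else 0)"
  by (simp only: tensor.rep_eq Rep_tensor_aux)

lemma htensor_eqI: "(\<And>b. Rep_ell2 (Rep_htensor u) b = Rep_ell2 (Rep_htensor v) b) \<Longrightarrow> u = v"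
  by (metis Rep_ell2_inject Rep_htensor_inject ext)

lemma cinner_tensor: "cinner (x \<otimes>\<^sub>h y) (x' \<otimes>\<^sub>h y') = cinner x x' * cinner y y'"
proof -
  have "((\<lambda>b. cinner x x' * (cinner y b * cinner b y')) has_sum (cinner x x' * cinner y y')) onb"
    by (intro has_sum_cmult_right onb_Parseval is_onb_onb)
  hence "((\<lambda>b. cinner (Rep_ell2 (Rep_htensor (x \<otimes>\<^sub>h y)) b) (Rep_ell2 (Rep_htensor (x' \<otimes>\<^sub>h y')) b))
      has_sum (cinner x x' * cinner y y')) UNIV"
    by (rule has_sum_cong_neutral[THEN iffD1, rotated -1])
       (auto simp: Rep_tensor cinner_scaleC_left cinner_scaleC_right cinner_commute[of _ y'])
  thus ?thesis by (simp add: cinner_htensor.rep_eq cinner_ell2_def infsumI)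
qed

lemma tensor_add_left: "(x + x') \<otimes>\<^sub>h y = x \<otimes>\<^sub>h y + x' \<otimes>\<^sub>h y"
  by (rule htensor_eqI) (simp add: Rep_tensor plus_htensor.rep_eq plus_ell2.rep_eq scaleC_add_right)

lemma tensor_add_right: "x \<otimes>\<^sub>h (y + y') = x \<otimes>\<^sub>h y + x \<otimes>\<^sub>h y'"
  by (rule htensor_eqI)
     (simp add: Rep_tensor plus_htensor.rep_eq plus_ell2.rep_eq cinner_add_left scaleC_add_left)

lemma tensor_scaleC_left: "(c *\<^sub>C x) \<otimes>\<^sub>h y = c *\<^sub>C (x \<otimes>\<^sub>h y)"
  by (rule htensor_eqI)
     (simp add: Rep_tensor scaleC_htensor.rep_eq scaleC_ell2.rep_eq scaleC_scaleC mult.commute)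

lemma tensor_scaleC_right: "x \<otimes>\<^sub>h (c *\<^sub>C y) = c *\<^sub>C (x \<otimes>\<^sub>h y)"
  by (rule htensor_eqI)
     (simp add: Rep_tensor scaleC_htensor.rep_eq scaleC_ell2.rep_eq cinner_scaleC_left scaleC_scaleC)

lemma closure_span_tensor:
  "closure (span {x \<otimes>\<^sub>h y | x y. True}) = (UNIV :: ('a::chilbert_space, 'b::chilbert_space) htensor set)"
proof (intro set_eqI iffI UNIV_I)
  fix u :: "('a, 'b) htensor"
  define f where "f = Rep_ell2 (Rep_htensor u)"
  have f0: "f b = 0" if "b \<notin> onb" for b using Rep_htensor[of u] that by (auto simp: f_def)
  have fs: "((\<lambda>b. (norm (f b))\<^sup>2) has_sum (norm u)\<^sup>2) UNIV"
    by (simp add: norm_htensor.rep_eq norm_ell2_power2 f_def Rep_ell2_summable)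
  show "u \<in> closure (span {x \<otimes>\<^sub>h y | x y. True})"
    unfolding closure_approachable
  proof (intro allI impI)
    fix e :: real assume "e > 0"
    with fs[unfolded has_sum_metric, rule_format, of "e\<^sup>2"] obtain S where
      S: "finite S" "dist (\<Sum>b\<in>S. (norm (f b))\<^sup>2) ((norm u)\<^sup>2) < e\<^sup>2" by auto
    define v where "v = (\<Sum>b\<in>S \<inter> onb. f b \<otimes>\<^sub>h b)"
    have fin: "finite (S \<inter> onb)" using S by simp
    have Rv: "Rep_ell2 (Rep_htensor (\<Sum>b\<in>T. f b \<otimes>\<^sub>h b)) c = (if c \<in> T then f c else 0)"
      if "finite T" "T \<subseteq> onb" for T c
      using that
    proof (induction T)
      case empty thus ?case by (simp add: zero_htensor.rep_eq zero_ell2.rep_eq)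
    next
      case (insert a T)
      have *: "orthonormal (onb :: 'b set)" using is_onb_onb by (auto simp: is_onb_def)
      have "cinner a c = (if c = a then 1 else 0)" if "c \<in> onb"
        using * insert that by (auto simp: orthonormal_def cinner_self)
      thus ?case using insert by (auto simp: plus_htensor.rep_eq plus_ell2.rep_eq Rep_tensor)
    qed
    have uv: "Rep_ell2 (Rep_htensor (u - v)) c = (if c \<in> S then 0 else f c)" for c
      using Rv[OF fin, of c] f0[of c]
      by (auto simp: v_def minus_htensor.rep_eq minus_ell2.rep_eq f_def)
    have "(norm (u - v))\<^sup>2 = (\<Sum>\<^sub>\<infinity>c. (norm (if c \<in> S then 0 else f c))\<^sup>2)"
      by (simp add: norm_htensor.rep_eq norm_ell2_power2 uv)
    also have "\<dots> = (\<Sum>\<^sub>\<infinity>c\<in>UNIV - S. (norm (f c))\<^sup>2)"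
      by (rule infsum_cong_neutral) auto
    also have "\<dots> = (norm u)\<^sup>2 - (\<Sum>b\<in>S. (norm (f b))\<^sup>2)"
      using infsum_Diff[of "\<lambda>c. (norm (f c))\<^sup>2" UNIV S] fs S(1)
      by (simp add: has_sum_iff)
    also have "\<dots> < e\<^sup>2" using S(2) by (simp add: dist_real_def)
    finally have "norm (u - v) < e" using \<open>e > 0\<close> by (simp add: power2_less_imp_less)
    moreover have "v \<in> span {x \<otimes>\<^sub>h y | x y. True}"
      unfolding v_def by (intro span_sum span_base) auto
    ultimately show "\<exists>y\<in>span {x \<otimes>\<^sub>h y | x y. True}. dist y u < e"
      by (intro bexI[of _ v]) (auto simp: dist_norm norm_minus_commute)
  qed
qed


section \<open>Bounded operators\<close>

text \<open>The library type \<open>'a \<Rightarrow>\<^sub>L 'b\<close> consists of the bounded real-linear maps with the operator norm;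
  \<open>cbop\<close> is the space of bounded complex-linear operators.  The library's infix for composition binds weaker than
  subtraction.\<close>

notation blinfun_compose (infixl \<open>\<circ>\<^sub>L\<close> 75)

definition cbop :: "('a::chilbert_space \<Rightarrow>\<^sub>L 'b::chilbert_space) set" where
  "cbop = {T. \<forall>c x. blinfun_apply T (c *\<^sub>C x) = c *\<^sub>C blinfun_apply T x}"

definition adj :: "('a::chilbert_space \<Rightarrow>\<^sub>L 'b::chilbert_space) \<Rightarrow> ('b \<Rightarrow>\<^sub>L 'a)" where
  "adj T = (THE S. \<forall>x y. cinner (blinfun_apply T x) y = cinner x (blinfun_apply S y))"

definition op_inv :: "('a::chilbert_space \<Rightarrow>\<^sub>L 'a) \<Rightarrow> ('a \<Rightarrow>\<^sub>L 'a)" where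
  "op_inv T = (THE S. S \<circ>\<^sub>L T = id_blinfun \<and> T \<circ>\<^sub>L S = id_blinfun)"

definition positive_op :: "('a::chilbert_space \<Rightarrow>\<^sub>L 'a) \<Rightarrow> bool" where
  "positive_op P \<longleftrightarrow> P \<in> cbop \<and>
     (\<forall>x. Im (cinner (blinfun_apply P x) x) = 0 \<and> 0 \<le> Re (cinner (blinfun_apply P x) x))"

definition op_sqrt :: "('a::chilbert_space \<Rightarrow>\<^sub>L 'a) \<Rightarrow> ('a \<Rightarrow>\<^sub>L 'a)" where
  "op_sqrt P = (THE Q. positive_op Q \<and> Q \<circ>\<^sub>L Q = P)"

definition isometry_op :: "('a::chilbert_space \<Rightarrow>\<^sub>L 'b::chilbert_space) \<Rightarrow> bool" where
  "isometry_op T \<longleftrightarrow> (\<forall>x. norm (blinfun_apply T x) = norm x)"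

text \<open>\<open>defect A\<close> is \<open>D\<^sub>A\<close>; accordingly \<open>D\<close> of the adjoint is \<open>defect (adj A)\<close>.\<close>

definition defect :: "('a::chilbert_space \<Rightarrow>\<^sub>L 'b::chilbert_space) \<Rightarrow> ('a \<Rightarrow>\<^sub>L 'a)" where
  "defect A = op_sqrt (id_blinfun - adj A \<circ>\<^sub>L A)"

definition mobius ::
  "('a::chilbert_space \<Rightarrow>\<^sub>L 'b::chilbert_space) \<Rightarrow> ('a \<Rightarrow>\<^sub>L 'b) \<Rightarrow> ('a \<Rightarrow>\<^sub>L 'b)" where
  "mobius A B = A - defect (adj A) \<circ>\<^sub>L op_inv (id_blinfun - B \<circ>\<^sub>L adj A) \<circ>\<^sub>L B \<circ>\<^sub>L defect A"

text \<open>Unconditional convergence in the strong operator topology.\<close>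

definition sot_has_sum ::
  "('i \<Rightarrow> 'a::chilbert_space \<Rightarrow>\<^sub>L 'b::chilbert_space) \<Rightarrow> ('a \<Rightarrow>\<^sub>L 'b) \<Rightarrow> 'i set \<Rightarrow> bool" where
  "sot_has_sum f T I \<longleftrightarrow>
     (\<forall>x. ((\<lambda>i. blinfun_apply (f i) x) has_sum blinfun_apply T x) I)"

definition op_tensor ::
  "('a::chilbert_space \<Rightarrow>\<^sub>L 'c::chilbert_space) \<Rightarrow> ('b::chilbert_space \<Rightarrow>\<^sub>L 'd::chilbert_space)
    \<Rightarrow> (('a, 'b) htensor \<Rightarrow>\<^sub>L ('c, 'd) htensor)" (infixr \<open>\<otimes>\<^sub>o\<close> 70) where
  "S \<otimes>\<^sub>o T = (THE R. R \<in> cbop \<and>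
     (\<forall>x y. blinfun_apply R (x \<otimes>\<^sub>h y) = blinfun_apply S x \<otimes>\<^sub>h blinfun_apply T y))"

definition tensor_assoc ::
  "(('a::chilbert_space, 'b::chilbert_space) htensor, 'c::chilbert_space) htensor
     \<Rightarrow>\<^sub>L ('a, ('b, 'c) htensor) htensor" where
  "tensor_assoc = (THE R. R \<in> cbop \<and>
     (\<forall>x y z. blinfun_apply R ((x \<otimes>\<^sub>h y) \<otimes>\<^sub>h z) = x \<otimes>\<^sub>h (y \<otimes>\<^sub>h z)))"

text \<open>The spatial tensor product of operator spaces \<open>M\<close> and \<open>N\<close>.  For \<open>M\<close> closed under complex
  scalar multiples (as in all uses) the real span of the elementary tensors is their complex span.\<close>

definition min_tensor ::
  "('a::chilbert_space \<Rightarrow>\<^sub>L 'c::chilbert_space) set \<Rightarrow> ('b::chilbert_space \<Rightarrow>\<^sub>L 'd::chilbert_space) set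
    \<Rightarrow> (('a, 'b) htensor \<Rightarrow>\<^sub>L ('c, 'd) htensor) set" where
  "min_tensor M N = closure (span {S \<otimes>\<^sub>o T | S T. S \<in> M \<and> T \<in> N})"


section \<open>Row contractions and the full Fock space\<close>

text \<open>The number \<open>n\<close> of generators is the cardinality of a countable type \<open>'n\<close>, so that every value
  in \<open>{1, 2, \<dots>} \<union> {\<infinity>}\<close> occurs; the free semigroup on \<open>n\<close> generators is \<open>'n list\<close>.
  A tuple is in the unit ball iff its row operator, defined on the direct sum of \<open>n\<close> copies of the
  space, is a strict contraction.\<close>

definition row_ball :: "('n::countable \<Rightarrow> 'h::chilbert_space \<Rightarrow>\<^sub>L 'h) set" where
  "row_ball = {X. (\<forall>i. X i \<in> cbop) \<and>
     (\<exists>R :: ('n, 'h) ell2 \<Rightarrow>\<^sub>L 'h. R \<in> cbop \<and>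
        (\<forall>i h. blinfun_apply R (ell2_single i h) = blinfun_apply (X i) h) \<and> norm R < 1)}"

definition word_op :: "('n \<Rightarrow> 'h::chilbert_space \<Rightarrow>\<^sub>L 'h) \<Rightarrow> 'n list \<Rightarrow> ('h \<Rightarrow>\<^sub>L 'h)" where
  "word_op X \<alpha> = foldr (\<lambda>i T. X i \<circ>\<^sub>L T) \<alpha> id_blinfun"

text \<open>The full Fock space, with \<open>e\<^sub>\<alpha>\<close> identified with the basis vector at the word \<open>\<alpha>\<close>.\<close>

type_synonym 'n fock = "('n list, complex) ell2"

definition fock_basis :: "'n list \<Rightarrow> 'n fock" where
  "fock_basis \<alpha> = ell2_single \<alpha> 1"

definition creation :: "'n \<Rightarrow> ('n fock \<Rightarrow>\<^sub>L 'n fock)" where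
  "creation i = (THE S. S \<in> cbop \<and>
     (\<forall>\<alpha>. blinfun_apply S (fock_basis \<alpha>) = fock_basis (i # \<alpha>)))"

definition closed_subalgebra :: "('a::chilbert_space \<Rightarrow>\<^sub>L 'a) set \<Rightarrow> bool" where
  "closed_subalgebra M \<longleftrightarrow> closed M \<and>
     (\<forall>S\<in>M. \<forall>T\<in>M. S + T \<in> M \<and> S \<circ>\<^sub>L T \<in> M) \<and>
     (\<forall>S\<in>M. \<forall>c. Blinfun (\<lambda>x. c *\<^sub>C blinfun_apply S x) \<in> M)"

definition disc_algebra :: "('n fock \<Rightarrow>\<^sub>L 'n fock) set" where
  "disc_algebra = closed_subalgebra hull (insert id_blinfun (range creation))"

definition row_defect :: "('n::countable \<Rightarrow> 'h::chilbert_space \<Rightarrow>\<^sub>L 'h) \<Rightarrow> ('h \<Rightarrow>\<^sub>L 'h)" where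
  "row_defect X = op_sqrt (id_blinfun - (THE T. sot_has_sum (\<lambda>i. X i \<circ>\<^sub>L adj (X i)) T UNIV))"

definition poisson_kernel ::
  "('n::countable \<Rightarrow> 'h::chilbert_space \<Rightarrow>\<^sub>L 'h) \<Rightarrow> ('h \<Rightarrow>\<^sub>L ('h, 'n fock) htensor)" where
  "poisson_kernel X = Blinfun (\<lambda>h. \<Sum>\<^sub>\<infinity>\<alpha>.
     blinfun_apply (row_defect X) (blinfun_apply (adj (word_op X \<alpha>)) h) \<otimes>\<^sub>h fock_basis \<alpha>)"

text \<open>The Poisson transform at \<open>X\<close> tensored with the identity: \<open>T\<close> acts between \<open>F\<^sup>2 \<otimes> E\<close> and
  \<open>F\<^sup>2 \<otimes> G\<close>, and \<open>id_blinfun \<otimes>\<^sub>o T\<close> between \<open>H \<otimes> (F\<^sup>2 \<otimes> E)\<close> and \<open>H \<otimes> (F\<^sup>2 \<otimes> G)\<close>.\<close>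

definition poisson_transform ::
  "('n::countable \<Rightarrow> 'h::chilbert_space \<Rightarrow>\<^sub>L 'h)
    \<Rightarrow> (('n fock, 'e::chilbert_space) htensor \<Rightarrow>\<^sub>L ('n fock, 'g::chilbert_space) htensor)
    \<Rightarrow> (('h, 'e) htensor \<Rightarrow>\<^sub>L ('h, 'g) htensor)" where
  "poisson_transform X T =
     adj (tensor_assoc \<circ>\<^sub>L (poisson_kernel X \<otimes>\<^sub>o id_blinfun)) \<circ>\<^sub>L (id_blinfun \<otimes>\<^sub>o T)
       \<circ>\<^sub>L (tensor_assoc \<circ>\<^sub>L (poisson_kernel X \<otimes>\<^sub>o id_blinfun))"


section \<open>Free holomorphic functions\<close>

text \<open>\<open>fh_has_value A X V\<close>: the series with coefficients \<open>A\<close> converges at \<open>X\<close> to \<open>V\<close>.  The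
  homogeneous parts (infinite sums if \<open>n = \<infinity>\<close>) are taken in the strong operator topology, the
  series of homogeneous parts in the operator norm.\<close>

definition fh_has_value ::
  "('n list \<Rightarrow> 'e::chilbert_space \<Rightarrow>\<^sub>L 'g::chilbert_space) \<Rightarrow> ('n \<Rightarrow> 'h::chilbert_space \<Rightarrow>\<^sub>L 'h)
    \<Rightarrow> (('h, 'e) htensor \<Rightarrow>\<^sub>L ('h, 'g) htensor) \<Rightarrow> bool" where
  "fh_has_value A X V \<longleftrightarrow>
     (\<exists>P. (\<forall>k. sot_has_sum (\<lambda>\<alpha>. word_op X \<alpha> \<otimes>\<^sub>o A \<alpha>) (P k) {\<alpha>. length \<alpha> = k}) \<and> P sums V)"

text \<open>A free holomorphic function is an extensional function on \<^const>\<open>row_ball\<close> with values in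
  the spatial tensor product (which is automatic for finite \<open>n\<close>).\<close>

type_synonym ('n, 'h, 'e, 'g) ball_fun =
  "('n \<Rightarrow> 'h \<Rightarrow>\<^sub>L 'h) \<Rightarrow> (('h, 'e) htensor \<Rightarrow>\<^sub>L ('h, 'g) htensor)"

definition fh_coeffs ::
  "('n::countable, 'h::chilbert_space, 'e::chilbert_space, 'g::chilbert_space) ball_fun
    \<Rightarrow> ('n list \<Rightarrow> 'e \<Rightarrow>\<^sub>L 'g) \<Rightarrow> bool" where
  "fh_coeffs F A \<longleftrightarrow> (\<forall>\<alpha>. A \<alpha> \<in> cbop) \<and> (\<forall>X\<in>row_ball. fh_has_value A X (F X))"

definition free_holomorphic ::
  "('n::countable, 'h::chilbert_space, 'e::chilbert_space, 'g::chilbert_space) ball_fun \<Rightarrow> bool" where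
  "free_holomorphic F \<longleftrightarrow> F \<in> row_ball \<rightarrow>\<^sub>E min_tensor cbop cbop \<and> (\<exists>A. fh_coeffs F A)"

definition fh_norm ::
  "('n::countable, 'h::chilbert_space, 'e::chilbert_space, 'g::chilbert_space) ball_fun \<Rightarrow> ennreal" where
  "fh_norm F = (SUP X\<in>row_ball. ennreal (norm (F X)))"

definition fh_const ::
  "('e::chilbert_space \<Rightarrow>\<^sub>L 'g::chilbert_space)
    \<Rightarrow> ('n::countable, 'h::chilbert_space, 'e, 'g) ball_fun" where
  "fh_const A\<^sub>0 = restrict (\<lambda>X. id_blinfun \<otimes>\<^sub>o A\<^sub>0) row_ball"

text \<open>Evaluation of the series of \<open>F\<close> at a tuple on another Hilbert space.\<close>

definition fh_eval ::
  "('n::countable, 'h::chilbert_space, 'e::chilbert_space, 'g::chilbert_space) ball_fun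
    \<Rightarrow> ('n, 'k::chilbert_space, 'e, 'g) ball_fun" where
  "fh_eval F Y = (THE V. \<exists>A. fh_coeffs F A \<and> fh_has_value A Y V)"

text \<open>The model boundary function, a limit in the strong operator topology.\<close>

definition boundary_fun ::
  "('n::countable, 'h::chilbert_space, 'e::chilbert_space, 'g::chilbert_space) ball_fun
    \<Rightarrow> (('n fock, 'e) htensor \<Rightarrow>\<^sub>L ('n fock, 'g) htensor)" where
  "boundary_fun F = (THE T. \<forall>v.
     ((\<lambda>r. blinfun_apply (fh_eval F (\<lambda>i. r *\<^sub>R creation i)) v) \<longlongrightarrow> blinfun_apply T v) (at_left 1))"

definition fh_mobius ::
  "('e::chilbert_space \<Rightarrow>\<^sub>L 'g::chilbert_space)
    \<Rightarrow> ('n::countable, 'h::chilbert_space, 'e, 'g) ball_fun \<Rightarrow> ('n, 'h, 'e, 'g) ball_fun" where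
  "fh_mobius A\<^sub>0 F = restrict (\<lambda>X. mobius (id_blinfun \<otimes>\<^sub>o A\<^sub>0) (F X)) row_ball"

definition schur_ball ::
  "('n::countable, 'h::chilbert_space, 'e::chilbert_space, 'g::chilbert_space) ball_fun set" where
  "schur_ball = {F. free_holomorphic F \<and> fh_norm F \<le> 1}"

definition schur_topology ::
  "('n::countable, 'h::chilbert_space, 'e::chilbert_space, 'g::chilbert_space) ball_fun topology" where
  "schur_topology =
     Metric_space.mtopology schur_ball (\<lambda>F G. enn2real (fh_norm (\<lambda>X. F X - G X)))"

end

theory Submission
  imports Defs
begin

text \<open>
  For contractions \<open>A\<close>, \<open>B\<close> with \<open>\<parallel>A\<parallel> < 1\<close> the transform \<open>\<Psi>\<^sub>A(B)\<close> is a feedback loop: the operator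
  \<open>(x, b) \<mapsto> (A x - D\<^bsub>A*\<^esub> b, D\<^sub>A x + A* b)\<close> is unitary (\<open>julia_unitary\<close>), and \<open>\<Psi>\<^sub>A(B)\<close> is its first
  component once the second output \<open>u\<close> is returned as \<open>b = B u\<close>.  Unitarity gives the two defect identities,
  contractivity and the statement on isometries; reading the loop backwards gives
  \<open>\<Psi>\<^sub>A(\<Psi>\<^sub>A(B)) = B\<close> (\<open>mobius_involution\<close>), and a resolvent identity gives a Lipschitz estimate in \<open>B\<close>.

  The remaining work is to pass between functions and operators.  A bounded free holomorphic function is the
  same thing as a multi-analytic operator, that is, an operator between \<open>F\<^sup>2 \<otimes> E\<close> and \<open>F\<^sup>2 \<otimes> G\<close> commuting with
  the right shifts.  In one direction, an infinite dimensional \<open>H\<close> contains a copy of the Fock space, so the norm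
  bound on the ball over \<open>H\<close> controls the operators \<open>F(r S)\<close>; these are multi-analytic and converge strongly, as
  \<open>r\<close> tends to 1, to a multi-analytic contraction with the same coefficients as \<open>F\<close> (\<open>boundary_function\<close>).  In the
  other direction, the adjoint of the Poisson kernel at \<open>X\<close> intertwines \<open>I \<otimes> T\<close> with the value at \<open>X\<close> of the
  series with the Fock coefficients of \<open>T\<close> (\<open>poisson_calculus\<close>): a row of words of length \<open>k\<close> in \<open>X\<close> has norm at most
  \<open>\<parallel>X\<parallel>\<^sup>k\<close> and a column of Fock coefficients has norm at most \<open>\<parallel>T\<parallel>\<close>, so the series converges.

  Commutants are closed under products and inverses, so \<open>\<Psi>\<^sub>A(F')\<close> is again multi-analytic, and no power series
  has to be multiplied or inverted.  An intertwining relation with an isometry passes to products and inverses as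
  well, so the function with the coefficients of \<open>\<Psi>\<^sub>A(F')\<close> takes the value \<open>\<Psi>\<^sub>A(F(X))\<close> at \<open>X\<close>
  (\<open>poisson_transform_mobius\<close>).  This proves the analytic part of the theorem.  Membership in spatial tensor
  products is preserved because these are norm closed and closed under composition (\<open>min_tensor_mobius\<close>); the
  algebra of all operators gives the values of \<open>\<Psi>\<^sub>A[F]\<close>, and the noncommutative disc algebra gives the last
  equivalence.
\<close>

section \<open>Square-summable families and bounded operators\<close>

lemma convergent_along_filter:
  fixes f :: "'i \<Rightarrow> 'a::banach"
  assumes "\<And>e. e > 0 \<Longrightarrow> \<exists>P. eventually P F \<and> (\<forall>x y. P x \<and> P y \<longrightarrow> dist (f x) (f y) < e)"
  shows "\<exists>l. (f \<longlongrightarrow> l) F"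
proof (cases "F = bot")
  case False
  have "cauchy_filter (filtermap f F)"
    using assms by (simp add: cauchy_filter_metric_filtermap)
  moreover have "complete (UNIV :: 'a set)"
    by (meson Cauchy_convergent UNIV_I complete_def convergent_def)
  ultimately show ?thesis
    using complete_uniform[where S = UNIV] False by (force simp: filterlim_def filtermap_bot_iff)
qed simp

text \<open>The tails of \<open>g\<close> dominate those of \<open>w\<close>, so this is the Cauchy criterion.  It is the source of all
  unconditional sums below that fail to be absolutely convergent: orthogonal families, and rows of operators
  applied to square-summable families.\<close>

lemma summable_on_square_bound:
  fixes w :: "'i \<Rightarrow> 'a::banach" and g :: "'i \<Rightarrow> real"
  assumes g: "g summable_on A" "\<And>i. i \<in> A \<Longrightarrow> g i \<ge> 0"
    and le: "\<And>S. finite S \<Longrightarrow> S \<subseteq> A \<Longrightarrow> (norm (sum w S))\<^sup>2 \<le> C * sum g S"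
  shows "w summable_on A"
    and "(norm (infsum w A))\<^sup>2 \<le> C * infsum g A"
proof -
  obtain L where L: "(g has_sum L) A" using g(1) by (auto simp: summable_on_def)
  have cauchy: "\<exists>P. eventually P (finite_subsets_at_top A) \<and>
              (\<forall>F F'. P F \<and> P F' \<longrightarrow> dist (sum w F) (sum w F') < e)" if "e > 0" for e
  proof -
    define d where "d = (e/4)\<^sup>2 / (\<bar>C\<bar> + 1)"
    have "d > 0" using that by (simp add: d_def)
    obtain X where X: "finite X" "X \<subseteq> A"
      "\<And>Y. finite Y \<Longrightarrow> X \<subseteq> Y \<Longrightarrow> Y \<subseteq> A \<Longrightarrow> dist (sum g Y) L < d / 2"
      using L[unfolded has_sum_metric, rule_format, of "d/2"] \<open>d > 0\<close> by auto
    have small: "norm (sum w F - sum w X) < e/2" if F: "finite F" "X \<subseteq> F" "F \<subseteq> A" for F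
    proof -
      have fin: "finite (F - X)" "F - X \<subseteq> A" using F by auto
      have "sum g (F - X) = sum g F - sum g X"
        using F by (intro sum_diff)
      also have "\<dots> < d" using X(3)[OF F] X(3)[OF X(1) order_refl X(2)]
        unfolding dist_real_def by linarith
      finally have gs: "sum g (F - X) < d" .
      have g0: "0 \<le> sum g (F - X)" using fin g(2) by (intro sum_nonneg) auto
      have "(norm (sum w (F - X)))\<^sup>2 \<le> C * sum g (F - X)" by (rule le[OF fin])
      also have "\<dots> \<le> (\<bar>C\<bar> + 1) * sum g (F - X)" by (intro mult_right_mono g0) auto
      also have "\<dots> \<le> (\<bar>C\<bar> + 1) * d" using gs by (intro mult_left_mono) auto
      also have "\<dots> = (e/4)\<^sup>2" by (simp add: d_def)
      finally have "norm (sum w (F - X)) \<le> e/4"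
        by (rule power2_le_imp_le) (use \<open>e > 0\<close> in simp)
      moreover have "sum w (F - X) = sum w F - sum w X"
        using F by (intro sum_diff)
      ultimately show ?thesis using \<open>e > 0\<close> by simp
    qed
    have "dist (sum w F) (sum w F') < e"
      if "finite F \<and> X \<subseteq> F \<and> F \<subseteq> A" "finite F' \<and> X \<subseteq> F' \<and> F' \<subseteq> A" for F F'
    proof -
      have "sum w F - sum w F' = (sum w F - sum w X) - (sum w F' - sum w X)" by simp
      also have "norm \<dots> \<le> norm (sum w F - sum w X) + norm (sum w F' - sum w X)"
        by (rule norm_triangle_ineq4)
      also have "\<dots> < e" using small[of F] small[of F'] that by linarith
      finally show ?thesis by (simp add: dist_norm)
    qed
    thus ?thesis
      using X(1,2) by (intro exI[of _ "\<lambda>F. finite F \<and> X \<subseteq> F \<and> F \<subseteq> A"])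
        (auto simp: eventually_finite_subsets_at_top)
  qed
  then obtain L' where "(sum w \<longlongrightarrow> L') (finite_subsets_at_top A)"
    using convergent_along_filter[of "finite_subsets_at_top A" "sum w"] by blast
  hence hs: "(w has_sum L') A" by (simp add: has_sum_def)
  thus "w summable_on A" by (auto simp: summable_on_def)
  have "(norm L')\<^sup>2 \<le> C * L"
  proof (rule tendsto_le)
    show "((\<lambda>F. C * sum g F) \<longlongrightarrow> C * L) (finite_subsets_at_top A)"
      using L by (intro tendsto_intros) (simp add: has_sum_def)
    show "((\<lambda>F. (norm (sum w F))\<^sup>2) \<longlongrightarrow> (norm L')\<^sup>2) (finite_subsets_at_top A)"
      using hs by (intro tendsto_intros) (simp add: has_sum_def)
    show "\<forall>\<^sub>F F in finite_subsets_at_top A. (norm (sum w F))\<^sup>2 \<le> C * sum g F"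
      by (rule eventually_finite_subsets_at_top_weakI) (rule le)
  qed auto
  thus "(norm (infsum w A))\<^sup>2 \<le> C * infsum g A"
    using hs L by (simp add: infsumI)
qed

lemma cinner_sum_right:
  fixes y :: "'a::chilbert_space"
  shows "cinner y (\<Sum>i\<in>I. f i) = (\<Sum>i\<in>I. cinner y (f i))"
  by (induction I rule: infinite_finite_induct) (auto simp: cinner_add_right)

lemma cinner_minus_right:
  fixes x :: "'a::chilbert_space"
  shows "cinner x (- y) = - cinner x y"
  using cinner_add_right[of x y "- y"] by (simp add: eq_neg_iff_add_eq_0 add.commute)

lemma cinner_diff_right:
  fixes x :: "'a::chilbert_space"
  shows "cinner x (y - z) = cinner x y - cinner x z"
  using cinner_add_right[of x y "- z"] by (simp add: cinner_minus_right)

lemma norm_eq_cinner: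
  fixes x :: "'a::chilbert_space"
  shows "norm x = norm (y :: 'b::chilbert_space) \<longleftrightarrow> cinner x x = cinner y y"
proof -
  have "norm x = norm y \<longleftrightarrow> (norm x)\<^sup>2 = (norm y)\<^sup>2" by (simp add: power2_eq_iff_nonneg)
  thus ?thesis by (simp only: cinner_self of_real_eq_iff)
qed

lemma cinner_eqI:
  fixes x y :: "'a::chilbert_space"
  assumes "\<And>z. cinner x z = cinner y z"
  shows "x = y"
proof -
  have "cinner (x - y) (x - y) = 0" by (simp add: cinner_diff_left assms)
  thus ?thesis by (simp add: cinner_self)
qed

lemma cinner_eqI2:
  fixes x y :: "'a::chilbert_space"
  assumes "\<And>z. cinner z x = cinner z y"
  shows "x = y"
  by (rule cinner_eqI) (subst (1 2) cinner_commute, simp add: assms)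

lemma bounded_bilinear_cinner: "bounded_bilinear (cinner :: 'a::chilbert_space \<Rightarrow> _)"
proof (rule bounded_bilinear.intro)
  show "\<exists>K. \<forall>a b. cmod (cinner a b) \<le> norm (a::'a) * norm b * K"
    using cinner_Cauchy_Schwarz by (intro exI[of _ 1]) auto
qed (auto simp: cinner_add_left cinner_add_right cinner_scaleC_left cinner_scaleC_right
        scaleR_scaleC)

lemmas bounded_linear_cinner_right = bounded_bilinear.bounded_linear_right[OF bounded_bilinear_cinner]

lemma norm_sum_orthogonal:
  fixes w :: "'i \<Rightarrow> 'a::chilbert_space"
  assumes "finite S" "\<And>i j. i \<in> S \<Longrightarrow> j \<in> S \<Longrightarrow> i \<noteq> j \<Longrightarrow> cinner (w i) (w j) = 0"
  shows "(norm (sum w S))\<^sup>2 = (\<Sum>i\<in>S. (norm (w i))\<^sup>2)"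
proof -
  have "complex_of_real ((norm (sum w S))\<^sup>2) = (\<Sum>i\<in>S. \<Sum>j\<in>S. cinner (w i) (w j))"
    by (simp only: cinner_self[symmetric] cinner_sum_left) (simp add: cinner_sum_right)
  also have "\<dots> = (\<Sum>i\<in>S. \<Sum>j\<in>S. if j = i then of_real ((norm (w i))\<^sup>2) else 0)"
    using assms by (intro sum.cong) (auto simp: cinner_self)
  also have "\<dots> = of_real (\<Sum>i\<in>S. (norm (w i))\<^sup>2)"
    using assms(1) by simp
  finally show ?thesis by (simp only: of_real_eq_iff)
qed

lemma orthogonal_summable:
  fixes w :: "'i \<Rightarrow> 'a::chilbert_space"
  assumes "\<And>i j. i \<in> A \<Longrightarrow> j \<in> A \<Longrightarrow> i \<noteq> j \<Longrightarrow> cinner (w i) (w j) = 0"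
    and "(\<lambda>i. (norm (w i))\<^sup>2) summable_on A"
  shows "w summable_on A"
proof (rule summable_on_square_bound(1)[OF assms(2), where C = 1])
  fix S assume "finite S" "S \<subseteq> A"
  thus "(norm (sum w S))\<^sup>2 \<le> 1 * (\<Sum>i\<in>S. (norm (w i))\<^sup>2)"
    using norm_sum_orthogonal[of S w] assms(1) by (simp add: subset_iff)
qed simp

lemma orthogonal_norm_has_sum:
  fixes w :: "'i \<Rightarrow> 'a::chilbert_space"
  assumes "\<And>i j. i \<in> A \<Longrightarrow> j \<in> A \<Longrightarrow> i \<noteq> j \<Longrightarrow> cinner (w i) (w j) = 0"
    and "(w has_sum u) A"
  shows "((\<lambda>i. (norm (w i))\<^sup>2) has_sum (norm u)\<^sup>2) A"
  unfolding has_sum_def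
proof (rule Lim_transform_eventually)
  show "((\<lambda>S. (norm (sum w S))\<^sup>2) \<longlongrightarrow> (norm u)\<^sup>2) (finite_subsets_at_top A)"
    using assms(2) by (intro tendsto_intros) (simp add: has_sum_def)
  show "\<forall>\<^sub>F S in finite_subsets_at_top A. (norm (sum w S))\<^sup>2 = (\<Sum>i\<in>S. (norm (w i))\<^sup>2)"
    by (rule eventually_finite_subsets_at_top_weakI, rule norm_sum_orthogonal)
       (use assms(1) in auto)
qed

subsection \<open>Complex linearity\<close>

lemma cbop_scaleC: "T \<in> cbop \<Longrightarrow> T (c *\<^sub>C x) = c *\<^sub>C T x"
  by (simp add: cbop_def)

lemma cbop_id [simp]: "id_blinfun \<in> cbop" and cbop_zero [simp]: "0 \<in> cbop"
  by (auto simp: cbop_def)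

lemma cbop_compose [simp]: "S \<in> cbop \<Longrightarrow> T \<in> cbop \<Longrightarrow> S \<circ>\<^sub>L T \<in> cbop"
  by (simp add: cbop_def)

lemma cbop_add [simp]: "S \<in> cbop \<Longrightarrow> T \<in> cbop \<Longrightarrow> S + T \<in> cbop"
  and cbop_diff [simp]: "S \<in> cbop \<Longrightarrow> T \<in> cbop \<Longrightarrow> S - T \<in> cbop"
  by (simp_all add: cbop_def blinfun.bilinear_simps scaleC_add_right scaleC_diff_right)

lemma scaleR_scaleC_commute: "r *\<^sub>R c *\<^sub>C (x::'a::chilbert_space) = c *\<^sub>C r *\<^sub>R x"
  by (simp add: scaleR_scaleC scaleC_scaleC mult.commute)

lemma cbop_scaleR [simp]: "S \<in> cbop \<Longrightarrow> r *\<^sub>R S \<in> cbop"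
  by (simp add: cbop_def blinfun.bilinear_simps scaleR_scaleC_commute)

lemma cbop_sum [simp]: "(\<And>i. i \<in> I \<Longrightarrow> S i \<in> cbop) \<Longrightarrow> sum S I \<in> cbop"
  by (induction I rule: infinite_finite_induct) auto

lemma bounded_linear_scaleC: "bounded_linear (\<lambda>x::'a::chilbert_space. c *\<^sub>C x)"
  by (rule bounded_linear_intro[where K = "cmod c"])
     (auto simp: scaleC_add_right scaleR_scaleC_commute mult.commute)

lemma cbop_of_map:
  fixes f :: "'a::chilbert_space \<Rightarrow> 'b::chilbert_space"
  assumes "\<And>x y. f (x + y) = f x + f y" "\<And>c x. f (c *\<^sub>C x) = c *\<^sub>C f x"
    and "\<And>x. norm (f x) \<le> C * norm x" "C \<ge> 0"
  obtains R where "R \<in> cbop" "\<And>x. blinfun_apply R x = f x" "norm R \<le> C"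
proof -
  have bl: "bounded_linear f"
    by (rule bounded_linear_intro[where K = C])
       (auto simp: assms scaleR_scaleC mult.commute)
  show ?thesis
  proof (rule that[of "Blinfun f"])
    show ap: "Blinfun f x = f x" for x using bl by (simp add: bounded_linear_Blinfun_apply)
    show "Blinfun f \<in> cbop" by (simp add: cbop_def ap assms)
    show "norm (Blinfun f) \<le> C" by (rule norm_blinfun_bound) (auto simp: ap assms)
  qed
qed

lemma norm_blinfun_le: "norm S \<le> C \<Longrightarrow> norm (blinfun_apply S x) \<le> C * norm x"
  by (meson norm_blinfun order_trans mult_right_mono norm_ge_zero)

lemma norm_compose_le: "norm S \<le> a \<Longrightarrow> norm T \<le> b \<Longrightarrow> norm (S \<circ>\<^sub>L T) \<le> a * b"
  by (meson norm_blinfun_compose order_trans mult_mono norm_ge_zero)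

lemmas compose_simps = bounded_bilinear.add_left[OF bounded_bilinear_blinfun_compose]
  bounded_bilinear.add_right[OF bounded_bilinear_blinfun_compose]
  bounded_bilinear.diff_left[OF bounded_bilinear_blinfun_compose]
  bounded_bilinear.diff_right[OF bounded_bilinear_blinfun_compose]
  bounded_bilinear.minus_left[OF bounded_bilinear_blinfun_compose]
  bounded_bilinear.minus_right[OF bounded_bilinear_blinfun_compose]
  bounded_bilinear.scaleR_left[OF bounded_bilinear_blinfun_compose]
  bounded_bilinear.scaleR_right[OF bounded_bilinear_blinfun_compose]

lemma compose_assoc: "(A \<circ>\<^sub>L B) \<circ>\<^sub>L C = A \<circ>\<^sub>L (B \<circ>\<^sub>L C)"
  by (rule blinfun_eqI) simp

lemma compose_id [simp]: "A \<circ>\<^sub>L id_blinfun = A" "id_blinfun \<circ>\<^sub>L A = A"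
  by (auto intro: blinfun_eqI)

lemma closed_cbop: "closed (cbop :: ('a::chilbert_space \<Rightarrow>\<^sub>L 'b::chilbert_space) set)"
proof -
  have "closed {T :: 'a \<Rightarrow>\<^sub>L 'b. T (c *\<^sub>C x) = c *\<^sub>C T x}" for c x
    by (intro closed_Collect_eq continuous_intros bounded_linear.continuous_on[OF bounded_linear_scaleC])
  hence "closed (\<Inter>c. \<Inter>x. {T :: 'a \<Rightarrow>\<^sub>L 'b. T (c *\<^sub>C x) = c *\<^sub>C T x})" by auto
  moreover have "(\<Inter>c. \<Inter>x. {T :: 'a \<Rightarrow>\<^sub>L 'b. T (c *\<^sub>C x) = c *\<^sub>C T x}) = cbop"
    by (auto simp: cbop_def)
  ultimately show ?thesis by simp
qed

subsection \<open>Adjoints\<close>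

text \<open>The representing vector is \<open>\<Sum> cnj (\<phi> b) b\<close>; testing \<open>\<phi>\<close> on the partial sums of this series bounds
  their norms by that of \<open>\<phi>\<close>.\<close>

lemma riesz_representation:
  fixes \<phi> :: "'a::chilbert_space \<Rightarrow> complex"
  assumes bl: "bounded_linear \<phi>" and sc: "\<And>c x. \<phi> (c *\<^sub>C x) = c * \<phi> x"
  shows "\<exists>z. \<forall>x. \<phi> x = cinner x z"
proof -
  interpret bounded_linear \<phi> by fact
  obtain C where C: "C \<ge> 0" "\<And>x. cmod (\<phi> x) \<le> norm x * C" using nonneg_bounded by blast
  define w where "w b = cnj (\<phi> b) *\<^sub>C b" for b :: 'a
  have on: "orthonormal (onb :: 'a set)" using is_onb_onb unfolding is_onb_def by blast
  have nw: "(norm (sum w S))\<^sup>2 = (\<Sum>b\<in>S. (cmod (\<phi> b))\<^sup>2)" if "finite S" "S \<subseteq> onb" for S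
    using orthonormal_sum_norm[OF on that, of "\<lambda>b. cnj (\<phi> b)"] by (simp add: w_def)
  have bd: "(\<Sum>b\<in>S. (cmod (\<phi> b))\<^sup>2) \<le> C\<^sup>2" if S: "finite S" "S \<subseteq> onb" for S
  proof -
    have "\<phi> (sum w S) = of_real (\<Sum>b\<in>S. (cmod (\<phi> b))\<^sup>2)"
      by (simp add: sum w_def sc complex_norm_square[symmetric] mult.commute)
    also have "\<dots> = of_real ((norm (sum w S))\<^sup>2)" by (simp add: nw[OF S])
    finally have "(norm (sum w S))\<^sup>2 \<le> norm (sum w S) * C"
      using C(2)[of "sum w S"] by (simp add: norm_power)
    hence "norm (sum w S) \<le> C"
      using C(1) by (cases "norm (sum w S) = 0") (auto simp: power2_eq_square)
    thus ?thesis by (simp add: power_mono flip: nw[OF S])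
  qed
  have "(\<lambda>b. (cmod (\<phi> b))\<^sup>2) summable_on onb"
    by (rule nonneg_bdd_above_summable_on) (use bd in \<open>auto intro!: bdd_aboveI2\<close>)
  hence "w summable_on onb"
    by (rule summable_on_square_bound(1)[where C = 1]) (auto simp: nw)
  then obtain z where z: "(w has_sum z) onb" by (auto simp: summable_on_def)
  have "\<phi> x = cinner x z" for x
  proof -
    have "((\<lambda>b. cinner x (w b)) has_sum cinner x z) onb"
      by (rule has_sum_bounded_linear[OF bounded_linear_cinner_right z])
    moreover have "((\<lambda>b. \<phi> (cinner x b *\<^sub>C b)) has_sum \<phi> x) onb"
      by (rule has_sum_bounded_linear[OF bl onb_expansion[OF is_onb_onb]])
    moreover have "\<phi> (cinner x b *\<^sub>C b) = cinner x (w b)" for b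
      by (simp add: sc w_def cinner_scaleC_right mult.commute)
    ultimately show ?thesis by (metis (no_types, lifting) has_sum_cong has_sum_unique)
  qed
  thus ?thesis by blast
qed

lemma adj_exists:
  fixes T :: "'a::chilbert_space \<Rightarrow>\<^sub>L 'b::chilbert_space"
  assumes "T \<in> cbop"
  shows "\<exists>S\<in>cbop. \<forall>x y. cinner (T x) y = cinner x (S y)"
proof -
  have "\<exists>z. \<forall>x. cinner (T x) y = cinner x z" for y
    by (rule riesz_representation)
       (auto intro!: bounded_linear_compose[OF bounded_linear_cinner_left blinfun.bounded_linear_right]
          simp: cbop_scaleC[OF assms] cinner_scaleC_left)
  then obtain f where f: "\<And>x y. cinner (T x) y = cinner x (f y)" by metis
  have f': "cinner (f y) x = cinner y (T x)" for x y
    by (subst cinner_commute, subst f[symmetric], rule cinner_commute[symmetric])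
  have bound: "norm (f y) \<le> norm T * norm y" for y
  proof -
    have "(norm (f y))\<^sup>2 = cmod (cinner (f y) (f y))" by (simp add: cinner_self norm_power)
    also have "\<dots> = cmod (cinner y (T (f y)))" by (simp add: f')
    also have "\<dots> \<le> norm y * norm (T (f y))" by (rule cinner_Cauchy_Schwarz)
    also have "\<dots> \<le> norm y * (norm T * norm (f y))" by (intro mult_left_mono norm_blinfun) auto
    finally have "norm (f y) * norm (f y) \<le> (norm T * norm y) * norm (f y)"
      by (simp add: power2_eq_square algebra_simps)
    thus ?thesis by (cases "norm (f y) = 0") auto
  qed
  have add: "f (x + y) = f x + f y" for x y
    by (rule cinner_eqI) (simp add: f' cinner_add_left)
  have scl: "f (c *\<^sub>C x) = c *\<^sub>C f x" for c x
    by (rule cinner_eqI) (simp add: f' cinner_scaleC_left)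
  obtain S where S: "S \<in> cbop" "\<And>x. blinfun_apply S x = f x"
    using cbop_of_map[OF add scl bound norm_ge_zero] by blast
  show ?thesis by (rule bexI[OF _ S(1)]) (simp only: S(2) f, simp)
qed

lemma adj_eqI:
  assumes "\<And>x y. cinner (blinfun_apply T x) y = cinner x (blinfun_apply S y)"
  shows "adj T = S"
  unfolding adj_def
proof (rule the_equality)
  fix S' assume S': "\<forall>x y. cinner (T x) y = cinner x (blinfun_apply S' y)"
  show "S' = S"
    by (rule blinfun_eqI, rule cinner_eqI2) (simp flip: S' add: assms)
qed (use assms in auto)

lemma adj_cinner:
  assumes "T \<in> cbop"
  shows "cinner (blinfun_apply T x) y = cinner x (blinfun_apply (adj T) y)"
    and "cinner y (blinfun_apply T x) = cinner (blinfun_apply (adj T) y) x"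
proof -
  obtain S where S: "\<forall>x y. cinner (T x) y = cinner x (blinfun_apply S y)"
    using adj_exists[OF assms] by blast
  have "adj T = S" by (rule adj_eqI) (use S in auto)
  with S have *: "cinner (T x) y = cinner x (adj T y)" for x y by auto
  show "cinner (T x) y = cinner x (adj T y)" by (rule *)
  show "cinner y (T x) = cinner (adj T y) x"
    by (subst cinner_commute, subst *, rule cinner_commute[symmetric])
qed

lemma adj_cinner':
  assumes "T \<in> cbop"
  shows "cinner (blinfun_apply (adj T) y) x = cinner y (blinfun_apply T x)"
    and "cinner x (blinfun_apply (adj T) y) = cinner (blinfun_apply T x) y"
  by (rule adj_cinner(2)[OF assms, symmetric], rule adj_cinner(1)[OF assms, symmetric])

lemma adj_cbop [simp]: "T \<in> cbop \<Longrightarrow> adj T \<in> cbop"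
  using adj_exists[of T] adj_eqI by metis

lemma adj_adj [simp]: "T \<in> cbop \<Longrightarrow> adj (adj T) = T"
  by (rule adj_eqI) (simp add: adj_cinner')

lemma adj_id [simp]: "adj id_blinfun = (id_blinfun :: 'a::chilbert_space \<Rightarrow>\<^sub>L 'a)"
  and adj_zero [simp]: "adj (0 :: 'a::chilbert_space \<Rightarrow>\<^sub>L 'b::chilbert_space) = 0"
  by (rule adj_eqI; simp)+

lemma adj_compose [simp]: "S \<in> cbop \<Longrightarrow> T \<in> cbop \<Longrightarrow> adj (S \<circ>\<^sub>L T) = adj T \<circ>\<^sub>L adj S"
  by (rule adj_eqI) (simp add: adj_cinner')

lemma adj_diff [simp]: "S \<in> cbop \<Longrightarrow> T \<in> cbop \<Longrightarrow> adj (S - T) = adj S - adj T"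
  by (rule adj_eqI) (simp add: adj_cinner' blinfun.diff_left cinner_diff_left cinner_diff_right)

lemma norm_adj_le: assumes "T \<in> cbop" shows "norm (adj T) \<le> norm T"
proof (rule norm_blinfun_bound)
  fix y
  have "(norm (adj T y))\<^sup>2 = cmod (cinner y (T (adj T y)))"
    by (simp add: adj_cinner'(1)[OF assms, symmetric] cinner_self norm_power)
  also have "\<dots> \<le> norm y * norm (T (adj T y))" by (rule cinner_Cauchy_Schwarz)
  also have "\<dots> \<le> norm y * (norm T * norm (adj T y))" by (intro mult_left_mono norm_blinfun) auto
  finally have "norm (adj T y) * norm (adj T y) \<le> (norm T * norm y) * norm (adj T y)"
    by (simp add: power2_eq_square algebra_simps)
  thus "norm (adj T y) \<le> norm T * norm y" by (cases "norm (adj T y) = 0") auto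
qed simp

lemma norm_adj [simp]: "T \<in> cbop \<Longrightarrow> norm (adj T) = norm T"
  using norm_adj_le[of T] norm_adj_le[of "adj T"] by simp

subsection \<open>Operators on direct sums\<close>

lemma ell2_single_scaleC: "ell2_single i (c *\<^sub>C x) = c *\<^sub>C ell2_single i x"
  by (rule Rep_ell2_inject[THEN iffD1]) (auto simp: ell2_single.rep_eq scaleC_ell2.rep_eq)

lemma cinner_ell2_single: "cinner f (ell2_single i x) = cinner (Rep_ell2 f i) x"
proof -
  have "((\<lambda>j. cinner (Rep_ell2 f j) (Rep_ell2 (ell2_single i x) j)) has_sum cinner (Rep_ell2 f i) x) UNIV"
    by (rule has_sum_finite_neutralI[of "{i}"]) (auto simp: ell2_single.rep_eq)
  thus ?thesis by (simp add: cinner_ell2_def infsumI)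
qed

lemma cinner_single_single:
  "cinner (ell2_single i x) (ell2_single j y) = (if i = j then cinner x y else 0)"
  by (simp add: cinner_ell2_single ell2_single.rep_eq)

lemma norm_ell2_single [simp]: "norm (ell2_single i x) = norm x"
  by (simp add: norm_eq_cinner cinner_single_single)

lemma ell2_expansion: "((\<lambda>i. ell2_single i (Rep_ell2 f i)) has_sum f) UNIV"
proof -
  have "(\<lambda>i. ell2_single i (Rep_ell2 f i)) summable_on UNIV"
    by (rule orthogonal_summable) (auto simp: cinner_single_single Rep_ell2_summable)
  then obtain g where g: "((\<lambda>i. ell2_single i (Rep_ell2 f i)) has_sum g) UNIV"
    by (auto simp: summable_on_def)
  have "cinner (Rep_ell2 g j) x = cinner (Rep_ell2 f j) x" for j x
  proof -
    have "((\<lambda>i. cinner (ell2_single i (Rep_ell2 f i)) (ell2_single j x)) has_sum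
        cinner g (ell2_single j x)) UNIV"
      by (rule has_sum_bounded_linear[OF bounded_linear_cinner_left g])
    moreover have "((\<lambda>i. cinner (ell2_single i (Rep_ell2 f i)) (ell2_single j x)) has_sum
        cinner (Rep_ell2 f j) x) UNIV"
      by (rule has_sum_finite_neutralI[of "{j}"]) (auto simp: cinner_single_single)
    ultimately show ?thesis by (metis cinner_ell2_single has_sum_unique)
  qed
  hence "Rep_ell2 g j = Rep_ell2 f j" for j by (rule cinner_eqI)
  hence "g = f" by (metis Rep_ell2_inject ext)
  thus ?thesis using g by simp
qed

lemma ell2_operator_eqI:
  assumes "\<And>i x. blinfun_apply R (ell2_single i x) = blinfun_apply R' (ell2_single i x)"
  shows "R = R'"
proof (rule blinfun_eqI)
  fix f
  note hs = has_sum_bounded_linear[OF blinfun.bounded_linear_right ell2_expansion, of _ f]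
  show "R f = R' f"
    by (rule has_sum_unique[OF _ hs[of R']]) (use hs[of R] in \<open>simp add: assms\<close>)
qed

text \<open>With orthogonal ranges the square norm of a sum is the sum of the square norms, so uniformly bounded
  restrictions to the summands fit together.  Shifts, embeddings of the Fock space and operators on tensor
  products all arise in this way.\<close>

lemma ell2_operator_exists:
  fixes \<phi> :: "'i \<Rightarrow> 'a::chilbert_space \<Rightarrow> 'b::chilbert_space"
  assumes add: "\<And>i x y. \<phi> i (x + y) = \<phi> i x + \<phi> i y"
    and scl: "\<And>i c x. \<phi> i (c *\<^sub>C x) = c *\<^sub>C \<phi> i x"
    and bd: "\<And>i x. norm (\<phi> i x) \<le> C * norm x" and C: "C \<ge> 0"
    and orth: "\<And>i j x y. i \<noteq> j \<Longrightarrow> cinner (\<phi> i x) (\<phi> j y) = 0"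
  obtains R where "R \<in> cbop" "\<And>i x. blinfun_apply R (ell2_single i x) = \<phi> i x" "norm R \<le> C"
    "\<And>f. ((\<lambda>i. \<phi> i (Rep_ell2 f i)) has_sum blinfun_apply R f) UNIV"
proof -
  define f where "f u = (\<Sum>\<^sub>\<infinity>i. \<phi> i (Rep_ell2 u i))" for u
  have le: "(norm (\<Sum>i\<in>S. \<phi> i (Rep_ell2 u i)))\<^sup>2 \<le> C\<^sup>2 * (\<Sum>i\<in>S. (norm (Rep_ell2 u i))\<^sup>2)"
    if "finite S" for S u
  proof -
    have "(norm (\<Sum>i\<in>S. \<phi> i (Rep_ell2 u i)))\<^sup>2 = (\<Sum>i\<in>S. (norm (\<phi> i (Rep_ell2 u i)))\<^sup>2)"
      by (rule norm_sum_orthogonal[OF that orth])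
    also have "\<dots> \<le> (\<Sum>i\<in>S. (C * norm (Rep_ell2 u i))\<^sup>2)"
      by (intro sum_mono power_mono bd) auto
    finally show ?thesis by (simp add: power_mult_distrib sum_distrib_left)
  qed
  have sm: "(\<lambda>i. \<phi> i (Rep_ell2 u i)) summable_on UNIV" for u
    by (rule summable_on_square_bound(1)[OF Rep_ell2_summable[of u]]) (use le in auto)
  hence hs: "((\<lambda>i. \<phi> i (Rep_ell2 u i)) has_sum f u) UNIV" for u
    by (simp add: f_def)
  have sq: "(norm (f u))\<^sup>2 \<le> C\<^sup>2 * (norm u)\<^sup>2" for u
    unfolding f_def norm_ell2_power2
    by (rule summable_on_square_bound(2)[OF Rep_ell2_summable]) (use le in auto)
  have bound: "norm (f u) \<le> C * norm u" for u
    by (rule power2_le_imp_le) (simp_all add: C power_mult_distrib sq)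
  have fadd: "f (u + v) = f u + f v" for u v
    by (rule has_sum_unique[OF hs[of "u + v"]])
       (use has_sum_add[OF hs[of u] hs[of v]] in \<open>simp add: plus_ell2.rep_eq add\<close>)
  have fscl: "f (c *\<^sub>C u) = c *\<^sub>C f u" for c u
    by (rule has_sum_unique[OF hs[of "c *\<^sub>C u"]])
       (use has_sum_bounded_linear[OF bounded_linear_scaleC hs[of u], of c] in
         \<open>simp add: scaleC_ell2.rep_eq scl\<close>)
  obtain R where R: "R \<in> cbop" "\<And>x. blinfun_apply R x = f x" "norm R \<le> C"
    using cbop_of_map[OF fadd fscl bound C] by blast
  have z: "\<phi> i 0 = 0" for i using scl[of i 0 0] by simp
  show ?thesis
  proof (rule that[OF R(1) _ R(3)])
    show "R (ell2_single i x) = \<phi> i x" for i x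
    proof -
      have "((\<lambda>j. \<phi> j (Rep_ell2 (ell2_single i x) j)) has_sum \<phi> i x) UNIV"
        by (rule has_sum_finite_neutralI[of "{i}"]) (auto simp: ell2_single.rep_eq z)
      thus ?thesis unfolding R(2) by (rule has_sum_unique[OF hs])
    qed
    show "((\<lambda>i. \<phi> i (Rep_ell2 u i)) has_sum R u) UNIV" for u unfolding R(2) by (rule hs)
  qed
qed

subsection \<open>Density arguments\<close>

lemma closed_subspace_UNIV:
  fixes W :: "'a::real_normed_vector set"
  assumes "closed W" "subspace W" "S \<subseteq> W" "closure (span S) = UNIV"
  shows "W = UNIV"
  using closure_minimal[of "span S" W] span_minimal[of S W] assms by auto

lemma total_blinfun_eqI:
  assumes "closure (span S) = UNIV" "\<And>x. x \<in> S \<Longrightarrow> blinfun_apply R x = blinfun_apply R' x"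
  shows "R = R'"
proof -
  have "closed {x. R x = R' x}"
    by (intro closed_Collect_eq linear_continuous_on blinfun.bounded_linear_right)
  moreover have "subspace {x. R x = R' x}"
    by (rule subspaceI) (simp_all add: blinfun.bilinear_simps)
  ultimately have "{x. R x = R' x} = UNIV"
    by (rule closed_subspace_UNIV[OF _ _ _ assms(1)]) (use assms(2) in blast)
  thus ?thesis by (intro blinfun_eqI) auto
qed

text \<open>Equiboundedness makes the set of vectors at which the family converges a closed subspace, so it is
  everything as soon as it contains a total set.\<close>

lemma strong_limit_exists:
  fixes Q :: "'r \<Rightarrow> 'a::real_normed_vector \<Rightarrow>\<^sub>L 'b::banach"
  assumes S: "closure (span S) = UNIV" and F: "F \<noteq> bot"
    and C: "eventually (\<lambda>r. norm (Q r) \<le> C) F"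
    and conv: "\<And>x. x \<in> S \<Longrightarrow> \<exists>l. ((\<lambda>r. blinfun_apply (Q r) x) \<longlongrightarrow> l) F"
  obtains T where "\<And>x. ((\<lambda>r. blinfun_apply (Q r) x) \<longlongrightarrow> blinfun_apply T x) F" "norm T \<le> C"
proof -
  have C0: "C \<ge> 0"
    using eventually_happens[OF C] F norm_ge_zero order_trans by blast
  define W where "W = {x. \<exists>l. ((\<lambda>r. blinfun_apply (Q r) x) \<longlongrightarrow> l) F}"
  have "subspace W"
  proof (rule subspaceI)
    show "0 \<in> W" by (auto simp: W_def)
    fix x y and c :: real
    assume "x \<in> W"
    then obtain a where a: "((\<lambda>r. Q r x) \<longlongrightarrow> a) F" by (auto simp: W_def)
    have "((\<lambda>r. Q r (c *\<^sub>R x)) \<longlongrightarrow> c *\<^sub>R a) F"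
      unfolding blinfun.scaleR_right by (intro tendsto_intros a)
    thus "c *\<^sub>R x \<in> W" by (auto simp: W_def)
    assume "y \<in> W"
    then obtain b where b: "((\<lambda>r. Q r y) \<longlongrightarrow> b) F" by (auto simp: W_def)
    have "((\<lambda>r. Q r (x + y)) \<longlongrightarrow> a + b) F" unfolding blinfun.add_right by (intro tendsto_intros a b)
    thus "x + y \<in> W" by (auto simp: W_def)
  qed
  \<comment> \<open>an \<open>\<epsilon>/3\<close> argument; \<open>K > 0\<close> avoids a case distinction on \<open>C = 0\<close>\<close>
  moreover have "x \<in> W" if x: "x \<in> closure W" for x
    unfolding W_def mem_Collect_eq
  proof (rule convergent_along_filter)
    fix e :: real assume "e > 0"
    define K where "K = C + 1"
    have K: "K > 0" using C0 by (simp add: K_def)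
    define d where "d = e / (3 * K)"
    have "d > 0" using \<open>e > 0\<close> K by (simp add: d_def)
    then obtain y where y: "y \<in> W" "norm (x - y) < d"
      using x unfolding closure_approachable dist_norm norm_minus_commute[of x] by blast
    have "C * norm (x - y) \<le> K * d" using y(2) C0 by (intro mult_mono) (auto simp: K_def)
    also have "\<dots> = e/3" using K by (simp add: d_def)
    finally have small: "C * norm (x - y) \<le> e/3" .
    obtain l where l: "((\<lambda>r. Q r y) \<longlongrightarrow> l) F" using y(1) by (auto simp: W_def)
    define P where "P r \<longleftrightarrow> norm (Q r) \<le> C \<and> dist (Q r y) l < e/6" for r
    have "eventually P F"
      unfolding P_def using tendstoD[OF l, of "e/6"] \<open>e > 0\<close> C by (simp add: eventually_conj_iff)
    moreover have "dist (Q r x) (Q s x) < e" if "P r" "P s" for r s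
    proof -
      have b: "norm (Q k (x - y)) \<le> e/3" if "P k" for k
        using norm_blinfun_le[of "Q k" C "x - y"] small that by (simp add: P_def)
      have "dist (Q r y) (Q s y) < e/3"
        using dist_triangle2[of "Q r y" "Q s y" l] that by (simp add: P_def)
      moreover have "Q r x - Q s x = Q r (x - y) + (Q r y - Q s y) - Q s (x - y)"
        by (simp add: blinfun.diff_right)
      hence "norm (Q r x - Q s x) \<le> norm (Q r (x - y)) + norm (Q r y - Q s y) + norm (Q s (x - y))"
        by (simp only:) (rule order_trans[OF norm_triangle_ineq4 add_right_mono[OF norm_triangle_ineq]])
      ultimately show ?thesis using b[OF that(1)] b[OF that(2)] by (simp add: dist_norm)
    qed
    ultimately show "\<exists>P. eventually P F \<and> (\<forall>r s. P r \<and> P s \<longrightarrow> dist (Q r x) (Q s x) < e)" by blast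
  qed
  hence "closure W \<subseteq> W" by blast
  hence "closed W" by (metis closure_eq closure_subset subset_antisym)
  ultimately have "W = UNIV"
    using conv by (intro closed_subspace_UNIV[OF _ _ _ S]) (auto simp: W_def)
  hence "\<forall>x. \<exists>l. ((\<lambda>r. Q r x) \<longlongrightarrow> l) F" by (auto simp: W_def)
  then obtain f where f: "\<And>x. ((\<lambda>r. Q r x) \<longlongrightarrow> f x) F" by metis
  have bd: "norm (f x) \<le> C * norm x" for x
  proof (rule tendsto_upperbound[OF tendsto_norm[OF f] _ F])
    show "\<forall>\<^sub>F r in F. norm (Q r x) \<le> C * norm x"
      using C by eventually_elim (rule norm_blinfun_le)
  qed
  have bl: "bounded_linear f"
  proof (rule bounded_linear_intro[where K = C])
    show "f (x + y) = f x + f y" for x y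
      by (rule tendsto_unique[OF F f]) (unfold blinfun.add_right, intro tendsto_intros f)
    show "f (c *\<^sub>R x) = c *\<^sub>R f x" for c x
      by (rule tendsto_unique[OF F f]) (unfold blinfun.scaleR_right, intro tendsto_intros f)
    show "norm (f x) \<le> norm x * C" for x using bd by (simp add: mult.commute)
  qed
  show ?thesis
  proof (rule that[of "Blinfun f"])
    show "((\<lambda>r. Q r x) \<longlongrightarrow> Blinfun f x) F" for x using f by (simp add: bounded_linear_Blinfun_apply[OF bl])
    show "norm (Blinfun f) \<le> C"
      by (rule norm_blinfun_bound[OF C0]) (simp add: bounded_linear_Blinfun_apply[OF bl] bd)
  qed
qed

lemma tendsto_total:
  fixes Q :: "'r \<Rightarrow> 'a::real_normed_vector \<Rightarrow>\<^sub>L 'b::banach"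
  assumes S: "closure (span S) = UNIV" and F: "F \<noteq> bot" and C: "eventually (\<lambda>r. norm (Q r) \<le> C) F"
    and conv: "\<And>x. x \<in> S \<Longrightarrow> ((\<lambda>r. blinfun_apply (Q r) x) \<longlongrightarrow> blinfun_apply T x) F"
  shows "((\<lambda>r. blinfun_apply (Q r) x) \<longlongrightarrow> blinfun_apply T x) F"
proof -
  obtain T' where T': "\<And>x. ((\<lambda>r. blinfun_apply (Q r) x) \<longlongrightarrow> blinfun_apply T' x) F"
    using strong_limit_exists[OF S F C] conv by blast
  have "T' = T"
    by (rule total_blinfun_eqI[OF S]) (rule tendsto_unique[OF F T' conv])
  thus ?thesis using T' by simp
qed

section \<open>Inverses, square roots and defect operators\<close>

lemma op_invI:
  assumes "S \<circ>\<^sub>L T = id_blinfun" "T \<circ>\<^sub>L S = id_blinfun"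
  shows "op_inv T = S"
  unfolding op_inv_def
proof (rule the_equality)
  fix S' assume S': "S' \<circ>\<^sub>L T = id_blinfun \<and> T \<circ>\<^sub>L S' = id_blinfun"
  have "S' = S' \<circ>\<^sub>L (T \<circ>\<^sub>L S)" by (simp add: assms)
  also have "\<dots> = S" using S' by (simp flip: compose_assoc)
  finally show "S' = S" .
qed (use assms in simp)

lemma neumann_inverse:
  fixes T :: "'a::chilbert_space \<Rightarrow>\<^sub>L 'a"
  assumes "norm T < 1"
  shows "op_inv (id_blinfun - T) \<circ>\<^sub>L (id_blinfun - T) = id_blinfun"
    and "(id_blinfun - T) \<circ>\<^sub>L op_inv (id_blinfun - T) = id_blinfun"
proof -
  have "\<exists>!S :: 'a \<Rightarrow>\<^sub>L 'a. id_blinfun + T \<circ>\<^sub>L S = S"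
  proof (rule banach_fix_type[OF norm_ge_zero assms], intro allI)
    fix S S' :: "'a \<Rightarrow>\<^sub>L 'a"
    have "norm (T \<circ>\<^sub>L (S - S')) \<le> norm T * norm (S - S')" by (rule norm_blinfun_compose)
    thus "dist (id_blinfun + T \<circ>\<^sub>L S) (id_blinfun + T \<circ>\<^sub>L S') \<le> norm T * dist S S'"
      by (simp add: dist_norm compose_simps)
  qed
  then obtain S where S: "id_blinfun + T \<circ>\<^sub>L S = S" by blast
  have "\<exists>!S :: 'a \<Rightarrow>\<^sub>L 'a. id_blinfun + S \<circ>\<^sub>L T = S"
  proof (rule banach_fix_type[OF norm_ge_zero assms], intro allI)
    fix S S' :: "'a \<Rightarrow>\<^sub>L 'a"
    have "norm ((S - S') \<circ>\<^sub>L T) \<le> norm (S - S') * norm T" by (rule norm_blinfun_compose)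
    thus "dist (id_blinfun + S \<circ>\<^sub>L T) (id_blinfun + S' \<circ>\<^sub>L T) \<le> norm T * dist S S'"
      by (simp add: dist_norm compose_simps mult.commute)
  qed
  then obtain S' where S': "id_blinfun + S' \<circ>\<^sub>L T = S'" by blast
  have 1: "(id_blinfun - T) \<circ>\<^sub>L S = id_blinfun"
    using S by (simp add: compose_simps algebra_simps)
  have 2: "S' \<circ>\<^sub>L (id_blinfun - T) = id_blinfun"
    using S' by (simp add: compose_simps algebra_simps)
  have "S' = S' \<circ>\<^sub>L ((id_blinfun - T) \<circ>\<^sub>L S)" by (simp add: 1)
  also have "\<dots> = S" using 2 by (simp flip: compose_assoc)
  finally have 3: "S' = S" .
  have "op_inv (id_blinfun - T) = S" using 1 2 unfolding 3 by (intro op_invI) simp_all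
  thus "op_inv (id_blinfun - T) \<circ>\<^sub>L (id_blinfun - T) = id_blinfun"
    "(id_blinfun - T) \<circ>\<^sub>L op_inv (id_blinfun - T) = id_blinfun"
    using 1 2 unfolding 3 by simp_all
qed

lemma neumann_inverse_apply:
  fixes T :: "'a::chilbert_space \<Rightarrow>\<^sub>L 'a"
  assumes "norm T < 1"
  shows "op_inv (id_blinfun - T) (x - T x) = x"
    and "op_inv (id_blinfun - T) x - T (op_inv (id_blinfun - T) x) = x"
  using neumann_inverse[OF assms, THEN arg_cong, of "\<lambda>S. S x"] by (simp_all add: blinfun.diff_left)

lemma cbop_neumann_inverse:
  fixes T :: "'a::chilbert_space \<Rightarrow>\<^sub>L 'a"
  assumes "norm T < 1" "T \<in> cbop"
  shows "op_inv (id_blinfun - T) \<in> cbop"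
  unfolding cbop_def mem_Collect_eq
proof (intro allI)
  fix c x
  define y where "y = op_inv (id_blinfun - T) x"
  have "c *\<^sub>C x = c *\<^sub>C y - T (c *\<^sub>C y)"
    using neumann_inverse_apply(2)[OF assms(1), of x]
    by (simp add: y_def[symmetric] cbop_scaleC[OF assms(2)] flip: scaleC_diff_right)
  thus "op_inv (id_blinfun - T) (c *\<^sub>C x) = c *\<^sub>C op_inv (id_blinfun - T) x"
    by (simp add: neumann_inverse_apply(1)[OF assms(1)] y_def)
qed

lemma norm_neumann_inverse_le:
  fixes T :: "'a::chilbert_space \<Rightarrow>\<^sub>L 'a"
  assumes "norm T \<le> a" "a < 1"
  shows "norm (op_inv (id_blinfun - T)) \<le> 1 / (1 - a)"
proof (rule norm_blinfun_bound)
  fix x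
  define y where "y = op_inv (id_blinfun - T) x"
  have "norm x = norm (y - T y)"
    using neumann_inverse_apply(2)[of T x] assms by (simp add: y_def)
  also have "norm y - norm (T y) \<le> \<dots>" by (rule norm_triangle_ineq2)
  finally have "(1 - a) * norm y \<le> norm x"
    using norm_blinfun_le[OF assms(1), of y] by (simp add: algebra_simps)
  thus "norm (op_inv (id_blinfun - T) x) \<le> 1 / (1 - a) * norm x"
    using assms(2) by (simp add: y_def field_simps)
qed (use assms in simp)

text \<open>The square root of \<open>I - T\<close> is \<open>I - R\<close>, where \<open>R\<close> is the fixed point of the contraction
  \<open>R \<mapsto> (T + R\<^sup>2) / 2\<close> on a ball of radius less than 1.  Strict contractivity of \<open>R\<close> replaces
  spectral arguments below; the commutation property yields uniqueness of the positive square root.\<close>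

lemma strict_sqrt_exists:
  fixes T :: "'a::chilbert_space \<Rightarrow>\<^sub>L 'a"
  assumes T: "T \<in> cbop" "adj T = T" "norm T < 1"
  obtains R :: "'a \<Rightarrow>\<^sub>L 'a" where "R \<in> cbop" "adj R = R" "norm R < 1"
    "(id_blinfun - R) \<circ>\<^sub>L (id_blinfun - R) = id_blinfun - T"
    "\<forall>B. B \<circ>\<^sub>L T = T \<circ>\<^sub>L B \<longrightarrow> B \<circ>\<^sub>L R = R \<circ>\<^sub>L B"
proof -
  \<comment> \<open>the smaller root of \<open>\<rho> = (\<parallel>T\<parallel> + \<rho>\<^sup>2) / 2\<close>\<close>
  define \<rho> where "\<rho> = 1 - sqrt (1 - norm T)"
  have \<rho>: "0 \<le> \<rho>" "\<rho> < 1" using T(3) by (auto simp: \<rho>_def)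
  have \<rho>_eq: "norm T + \<rho> * \<rho> = 2 * \<rho>"
    using T(3) by (simp add: \<rho>_def algebra_simps)
  define S where "S = cbop \<inter> {R :: 'a \<Rightarrow>\<^sub>L 'a. norm R \<le> \<rho>}
    \<inter> (\<Inter>x. \<Inter>y. {R. cinner (blinfun_apply R x) y = cinner x (blinfun_apply R y)})
    \<inter> (\<Inter>B\<in>{B. B \<circ>\<^sub>L T = T \<circ>\<^sub>L B}. {R. B \<circ>\<^sub>L R = R \<circ>\<^sub>L B})"
  define f where "f R = (1/2) *\<^sub>R (T + R \<circ>\<^sub>L R)" for R :: "'a \<Rightarrow>\<^sub>L 'a"
  have cb: "R \<in> cbop" and nR: "norm R \<le> \<rho>"
    and sa: "cinner (blinfun_apply R x) y = cinner x (blinfun_apply R y)"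
    and cm: "B \<circ>\<^sub>L T = T \<circ>\<^sub>L B \<Longrightarrow> B \<circ>\<^sub>L R = R \<circ>\<^sub>L B"
    if "R \<in> S" for R :: "'a \<Rightarrow>\<^sub>L 'a" and B x y c
    using that by (auto simp: S_def)
  have "closed {R :: 'a \<Rightarrow>\<^sub>L 'a. cinner (blinfun_apply R x) y = cinner x (blinfun_apply R y)}" for x y
    by (intro closed_Collect_eq linear_continuous_on
        bounded_linear_compose[OF bounded_linear_cinner_left blinfun.bounded_linear_left]
        bounded_linear_compose[OF bounded_linear_cinner_right blinfun.bounded_linear_left])
  moreover have "closed {R :: 'a \<Rightarrow>\<^sub>L 'a. B \<circ>\<^sub>L R = R \<circ>\<^sub>L B}" for B
    by (intro closed_Collect_eq linear_continuous_on
        bounded_bilinear.bounded_linear_left[OF bounded_bilinear_blinfun_compose]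
        bounded_bilinear.bounded_linear_right[OF bounded_bilinear_blinfun_compose])
  moreover have "closed {R :: 'a \<Rightarrow>\<^sub>L 'a. norm R \<le> \<rho>}"
    by (intro closed_Collect_le continuous_intros)
  ultimately have "closed S"
    unfolding S_def by (intro closed_Int closed_INT closed_cbop ballI)
  hence "complete S" by (simp add: complete_eq_closed)
  moreover have "S \<noteq> {}"
  proof -
    have "0 \<in> S" using \<rho> by (simp add: S_def)
    thus ?thesis by blast
  qed
  moreover note \<rho>
  moreover have "f ` S \<subseteq> S"
  proof (intro image_subsetI)
    fix R assume R: "R \<in> S"
    have "norm (T + R \<circ>\<^sub>L R) \<le> norm T + \<rho> * \<rho>"
      by (intro norm_triangle_mono norm_compose_le nR R order_refl)
    hence "norm (f R) \<le> \<rho>" by (simp add: f_def \<rho>_eq)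
    moreover have "f R \<in> cbop" using cb[OF R] T(1) by (simp add: f_def)
    moreover have "cinner (f R x) y = cinner x (f R y)" for x y
      using adj_cinner[OF T(1), of x y]
      by (simp add: f_def blinfun.bilinear_simps scaleR_scaleC cinner_scaleC_left cinner_scaleC_right
          cinner_add_left cinner_add_right sa[OF R] T(2))
    moreover have "B \<circ>\<^sub>L f R = f R \<circ>\<^sub>L B" if "B \<circ>\<^sub>L T = T \<circ>\<^sub>L B" for B
    proof -
      have "B \<circ>\<^sub>L (R \<circ>\<^sub>L R) = R \<circ>\<^sub>L R \<circ>\<^sub>L B"
        by (simp add: compose_assoc[symmetric] cm[OF R that]) (simp add: compose_assoc cm[OF R that])
      thus ?thesis by (simp add: f_def compose_simps that)
    qed
    ultimately show "f R \<in> S" by (simp add: S_def)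
  qed
  moreover have "dist (f R) (f R') \<le> \<rho> * dist R R'" if "R \<in> S" "R' \<in> S" for R R'
  proof -
    have eq: "f R - f R' = (1/2) *\<^sub>R (R \<circ>\<^sub>L (R - R') + (R - R') \<circ>\<^sub>L R')"
      by (simp add: f_def compose_simps algebra_simps)
    have "norm (R \<circ>\<^sub>L (R - R') + (R - R') \<circ>\<^sub>L R') \<le> \<rho> * norm (R - R') + norm (R - R') * \<rho>"
      by (intro norm_triangle_mono norm_compose_le nR that order_refl)
    thus ?thesis unfolding dist_norm eq by simp
  qed
  ultimately have "\<exists>!R\<in>S. f R = R" by (rule Banach_fix)
  then obtain R :: "'a \<Rightarrow>\<^sub>L 'a" where R: "R \<in> S" "f R = R" by blast
  show ?thesis
  proof (rule that)
    show "R \<in> cbop" by (rule cb[OF R(1)])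
    show "adj R = R" by (rule adj_eqI) (rule sa[OF R(1)])
    show "norm R < 1" using nR[OF R(1)] \<rho> by simp
    have "2 *\<^sub>R f R = 2 *\<^sub>R R" by (simp only: R(2))
    hence "T + R \<circ>\<^sub>L R = R + R" by (simp add: f_def scaleR_2)
    thus "(id_blinfun - R) \<circ>\<^sub>L (id_blinfun - R) = id_blinfun - T"
      by (simp add: compose_simps algebra_simps)
    show "\<forall>B. B \<circ>\<^sub>L T = T \<circ>\<^sub>L B \<longrightarrow> B \<circ>\<^sub>L R = R \<circ>\<^sub>L B" using cm[OF R(1)] by blast
  qed
qed

lemma strict_positive:
  fixes R :: "'a::chilbert_space \<Rightarrow>\<^sub>L 'a"
  assumes "R \<in> cbop" "adj R = R" "norm R < 1"
  shows "positive_op (id_blinfun - R)"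
    and "(1 - norm R) * (norm x)\<^sup>2 \<le> Re (cinner ((id_blinfun - R) x) x)"
proof -
  have im: "Im (cinner (R x) x) = 0" for x
  proof -
    have "cinner (R x) x = cnj (cinner (R x) x)"
      using adj_cinner(1)[OF assms(1), of x x] cinner_commute[of "R x" x] assms(2) by simp
    from arg_cong[OF this, of Im] show ?thesis by simp
  qed
  show re: "(1 - norm R) * (norm x)\<^sup>2 \<le> Re (cinner ((id_blinfun - R) x) x)" for x
  proof -
    have "Re (cinner (R x) x) \<le> cmod (cinner (R x) x)" by (rule complex_Re_le_cmod)
    also have "\<dots> \<le> norm (R x) * norm x" by (rule cinner_Cauchy_Schwarz)
    also have "\<dots> \<le> norm R * norm x * norm x" by (intro mult_right_mono norm_blinfun) auto
    finally show ?thesis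
      by (simp add: blinfun.diff_left cinner_diff_left cinner_self power2_eq_square algebra_simps)
  qed
  have "0 \<le> Re (cinner ((id_blinfun - R) x) x)" for x
    by (rule order_trans[OF _ re]) (use assms(3) in simp)
  thus "positive_op (id_blinfun - R)"
    using assms(1) by (simp add: positive_op_def blinfun.diff_left cinner_diff_left cinner_self im)
qed

text \<open>A positive square root \<open>Q\<close> of \<open>I - T\<close> commutes with \<open>T\<close>, hence with the root \<open>P\<close> constructed above.  Then
  \<open>(Q + P) (Q - P) = 0\<close>, and \<open>Q + P\<close> is injective because \<open>P\<close> is bounded below.\<close>

lemma op_sqrt_eqI:
  fixes T R :: "'a::chilbert_space \<Rightarrow>\<^sub>L 'a"
  assumes T: "T \<in> cbop" "adj T = T" "norm T < 1"
    and R: "R \<in> cbop" "adj R = R" "norm R < 1" "(id_blinfun - R) \<circ>\<^sub>L (id_blinfun - R) = id_blinfun - T"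
  shows "op_sqrt (id_blinfun - T) = id_blinfun - R"
proof -
  obtain R0 :: "'a \<Rightarrow>\<^sub>L 'a" where R0: "R0 \<in> cbop" "adj R0 = R0" "norm R0 < 1"
    "(id_blinfun - R0) \<circ>\<^sub>L (id_blinfun - R0) = id_blinfun - T"
    "\<forall>B. B \<circ>\<^sub>L T = T \<circ>\<^sub>L B \<longrightarrow> B \<circ>\<^sub>L R0 = R0 \<circ>\<^sub>L B"
    by (rule strict_sqrt_exists[OF T])
  have unique: "Q = id_blinfun - R0" if Q: "positive_op Q" "Q \<circ>\<^sub>L Q = id_blinfun - T" for Q
  proof -
    define P where "P = id_blinfun - R0"
    have "T = id_blinfun - Q \<circ>\<^sub>L Q" using Q(2) by simp
    hence "Q \<circ>\<^sub>L T = T \<circ>\<^sub>L Q" by (simp add: compose_simps compose_assoc)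
    hence "Q \<circ>\<^sub>L R0 = R0 \<circ>\<^sub>L Q" using R0(5) by blast
    hence comm: "Q \<circ>\<^sub>L P = P \<circ>\<^sub>L Q" by (simp add: P_def compose_simps)
    have PP: "P \<circ>\<^sub>L P = Q \<circ>\<^sub>L Q" using R0(4) Q(2) by (simp add: P_def)
    have "Q x = P x" for x
    proof -
      define y where "y = Q x - P x"
      have "Q (P x) = P (Q x)" "P (P x) = Q (Q x)"
        using comm[THEN arg_cong, of "\<lambda>S. S x"] PP[THEN arg_cong, of "\<lambda>S. S x"] by simp_all
      hence "Q y + P y = 0" by (simp add: y_def blinfun.diff_right)
      hence "Re (cinner (Q y + P y) y) = 0" by simp
      hence "Re (cinner (Q y) y) + Re (cinner (P y) y) = 0" by (simp add: cinner_add_left)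
      moreover have "0 \<le> Re (cinner (Q y) y)" using Q(1) by (simp add: positive_op_def)
      moreover have "(1 - norm R0) * (norm y)\<^sup>2 \<le> Re (cinner (P y) y)"
        unfolding P_def by (rule strict_positive(2)[OF R0(1-3)])
      ultimately have "(1 - norm R0) * (norm y)\<^sup>2 \<le> 0" by linarith
      hence "y = 0" using R0(3) by (simp add: mult_le_0_iff)
      thus ?thesis by (simp add: y_def)
    qed
    hence "Q = P" by (rule blinfun_eqI)
    thus ?thesis by (simp add: P_def)
  qed
  have "op_sqrt (id_blinfun - T) = id_blinfun - R0"
    unfolding op_sqrt_def
    by (rule the_equality) (simp add: R0(4) strict_positive(1)[OF R0(1-3)], rule unique, simp_all)
  moreover have "id_blinfun - R = id_blinfun - R0"
    by (rule unique[OF strict_positive(1)[OF R(1-3)] R(4)])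
  ultimately show ?thesis by simp
qed

lemma adj_self_compose:
  assumes "A \<in> cbop"
  shows "adj A \<circ>\<^sub>L A \<in> cbop" "adj (adj A \<circ>\<^sub>L A) = adj A \<circ>\<^sub>L A"
    "norm A < 1 \<Longrightarrow> norm (adj A \<circ>\<^sub>L A) < 1"
proof -
  show "adj A \<circ>\<^sub>L A \<in> cbop" "adj (adj A \<circ>\<^sub>L A) = adj A \<circ>\<^sub>L A" using assms by simp_all
  assume "norm A < 1"
  have "norm (adj A \<circ>\<^sub>L A) \<le> norm (adj A) * norm A" by (rule norm_blinfun_compose)
  also have "\<dots> = norm A * norm A" using assms by simp
  also have "\<dots> \<le> norm A * 1" using \<open>norm A < 1\<close> by (intro mult_left_mono) auto
  also have "\<dots> < 1" using \<open>norm A < 1\<close> by simp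
  finally show "norm (adj A \<circ>\<^sub>L A) < 1" .
qed

lemma defect_decomposition:
  fixes A :: "'a::chilbert_space \<Rightarrow>\<^sub>L 'b::chilbert_space"
  assumes "A \<in> cbop" "norm A < 1"
  obtains R :: "'a \<Rightarrow>\<^sub>L 'a" where "R \<in> cbop" "adj R = R" "norm R < 1" "defect A = id_blinfun - R"
    "defect A \<circ>\<^sub>L defect A = id_blinfun - adj A \<circ>\<^sub>L A"
proof -
  note T = adj_self_compose[OF assms(1)] 
  obtain R :: "'a \<Rightarrow>\<^sub>L 'a" where R: "R \<in> cbop" "adj R = R" "norm R < 1"
    "(id_blinfun - R) \<circ>\<^sub>L (id_blinfun - R) = id_blinfun - adj A \<circ>\<^sub>L A"
    by (rule strict_sqrt_exists[OF T(1,2) T(3)[OF assms(2)]])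
  have D: "defect A = id_blinfun - R"
    unfolding defect_def by (rule op_sqrt_eqI[OF T(1,2) T(3)[OF assms(2)] R])
  show ?thesis by (rule that[OF R(1-3) D]) (simp only: D R(4))
qed

lemma defect_unique:
  fixes A :: "'a::chilbert_space \<Rightarrow>\<^sub>L 'b::chilbert_space"
  assumes "A \<in> cbop" "norm A < 1"
    and "R \<in> cbop" "adj R = R" "norm R < 1" "(id_blinfun - R) \<circ>\<^sub>L (id_blinfun - R) = id_blinfun - adj A \<circ>\<^sub>L A"
  shows "defect A = id_blinfun - R"
  unfolding defect_def
  by (rule op_sqrt_eqI[OF adj_self_compose(1,2)[OF assms(1)] adj_self_compose(3)[OF assms(1,2)] assms(3-6)])

lemma defect_properties:
  fixes A :: "'a::chilbert_space \<Rightarrow>\<^sub>L 'b::chilbert_space"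
  assumes "A \<in> cbop" "norm A < 1"
  shows "defect A \<in> cbop" "adj (defect A) = defect A" "norm (defect A) \<le> 2"
    "defect A (defect A x) = x - adj A (A x)"
    "defect A x = 0 \<Longrightarrow> x = 0"
proof -
  obtain R :: "'a \<Rightarrow>\<^sub>L 'a" where R: "R \<in> cbop" "adj R = R" "norm R < 1" "defect A = id_blinfun - R"
    "defect A \<circ>\<^sub>L defect A = id_blinfun - adj A \<circ>\<^sub>L A"
    by (rule defect_decomposition[OF assms])
  show "defect A \<in> cbop" "adj (defect A) = defect A" using R(1,2) by (simp_all add: R(4))
  have "norm (defect A) \<le> norm (id_blinfun :: 'a \<Rightarrow>\<^sub>L 'a) + norm R"
    unfolding R(4) by (rule norm_triangle_ineq4)
  thus "norm (defect A) \<le> 2" using R(3) norm_blinfun_id_le[where 'a = 'a] by linarith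
  show "defect A (defect A x) = x - adj A (A x)"
    using R(5)[THEN arg_cong, of "\<lambda>S. S x"] by (simp add: blinfun.diff_left)
  show "x = 0" if "defect A x = 0"
  proof -
    have "(1 - norm R) * (norm x)\<^sup>2 \<le> 0"
      using strict_positive(2)[OF R(1-3), of x] that by (simp flip: R(4))
    thus ?thesis using R(3) by (simp add: mult_le_0_iff)
  qed
qed

text \<open>For \<open>Y = A D\<^sub>A - D\<^bsub>A*\<^esub> A\<close> one has \<open>D\<^bsub>A*\<^esub> Y + Y D\<^sub>A = 0\<close>.  Writing both defect operators as \<open>I\<close>
  minus a strict contraction turns this Sylvester equation into \<open>2 \<parallel>Y\<parallel> < 2 \<parallel>Y\<parallel>\<close> unless \<open>Y = 0\<close>.\<close>

lemma defect_intertwine: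
  fixes A :: "'a::chilbert_space \<Rightarrow>\<^sub>L 'b::chilbert_space"
  assumes "A \<in> cbop" "norm A < 1"
  shows "A (defect A x) = defect (adj A) (A x)"
proof -
  obtain R :: "'a \<Rightarrow>\<^sub>L 'a" where R: "R \<in> cbop" "adj R = R" "norm R < 1" "defect A = id_blinfun - R"
    "defect A \<circ>\<^sub>L defect A = id_blinfun - adj A \<circ>\<^sub>L A"
    by (rule defect_decomposition[OF assms])
  obtain R' :: "'b \<Rightarrow>\<^sub>L 'b" where R': "R' \<in> cbop" "adj R' = R'" "norm R' < 1" "defect (adj A) = id_blinfun - R'"
    "defect (adj A) \<circ>\<^sub>L defect (adj A) = id_blinfun - adj (adj A) \<circ>\<^sub>L adj A"
    by (rule defect_decomposition[of "adj A"]) (use assms in simp_all)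
  define D E where "D = defect A" and "E = defect (adj A)"
  define Y where "Y = A \<circ>\<^sub>L D - E \<circ>\<^sub>L A"
  have "E \<circ>\<^sub>L Y + Y \<circ>\<^sub>L D = A \<circ>\<^sub>L (D \<circ>\<^sub>L D) - (E \<circ>\<^sub>L E) \<circ>\<^sub>L A"
    by (simp add: Y_def compose_simps compose_assoc)
  also have "\<dots> = 0"
    using R(5) R'(5) assms(1) by (simp add: D_def E_def compose_simps compose_assoc)
  finally have "Y + Y = R' \<circ>\<^sub>L Y + Y \<circ>\<^sub>L R"
    using R(4) R'(4) by (simp add: D_def E_def compose_simps algebra_simps)
  hence "norm (Y + Y) \<le> norm R' * norm Y + norm Y * norm R"
    by (simp add: norm_triangle_mono norm_blinfun_compose)
  moreover have "norm (Y + Y) = 2 * norm Y" by (simp flip: scaleR_2)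
  ultimately have "(1 - norm R') * norm Y + (1 - norm R) * norm Y \<le> 0" by (simp add: algebra_simps)
  moreover have "0 \<le> (1 - norm R') * norm Y" "0 \<le> (1 - norm R) * norm Y" using R(3) R'(3) by auto
  ultimately have "(1 - norm R) * norm Y = 0" by linarith
  hence "Y = 0" using R(3) by simp
  hence "blinfun_apply (A \<circ>\<^sub>L D) x = blinfun_apply (E \<circ>\<^sub>L A) x" by (simp add: Y_def)
  thus ?thesis by (simp add: D_def E_def)
qed

section \<open>The operator Moebius transform\<close>

lemma inverse_push_through:
  fixes C :: "'b::chilbert_space \<Rightarrow>\<^sub>L 'a::chilbert_space" and B :: "'a \<Rightarrow>\<^sub>L 'b"
  assumes "norm (B \<circ>\<^sub>L C) < 1" "norm (C \<circ>\<^sub>L B) < 1"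
  shows "op_inv (id_blinfun - B \<circ>\<^sub>L C) (B x) = B (op_inv (id_blinfun - C \<circ>\<^sub>L B) x)"
proof -
  define y where "y = op_inv (id_blinfun - C \<circ>\<^sub>L B) x"
  have "x = y - C (B y)" using neumann_inverse_apply(2)[OF assms(2), of x] by (simp add: y_def)
  hence "B x = B y - (B \<circ>\<^sub>L C) (B y)" by (simp add: blinfun.diff_right)
  thus ?thesis using neumann_inverse_apply(1)[OF assms(1), of "B y"] by (simp add: y_def)
qed

lemma norm_compose_less_1:
  assumes "norm A < 1" "norm B \<le> 1"
  shows "norm (A \<circ>\<^sub>L B) < 1" "norm (B \<circ>\<^sub>L A) < 1"
proof -
  have "norm A * norm B \<le> norm A * 1" using assms by (intro mult_left_mono) auto
  thus "norm (A \<circ>\<^sub>L B) < 1" using norm_blinfun_compose[of A B] assms by linarith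
next
  have "norm B * norm A \<le> 1 * norm A" using assms by (intro mult_right_mono) auto
  thus "norm (B \<circ>\<^sub>L A) < 1" using norm_blinfun_compose[of B A] assms by linarith
qed

context
  fixes A B :: "'a::chilbert_space \<Rightarrow>\<^sub>L 'b::chilbert_space"
  assumes A: "A \<in> cbop" "norm A < 1" and B: "B \<in> cbop" "norm B \<le> 1"
begin

lemma mobius_norms:
  "norm (adj A \<circ>\<^sub>L B) < 1" "norm (B \<circ>\<^sub>L adj A) < 1" "norm (A \<circ>\<^sub>L adj B) < 1" "norm (adj B \<circ>\<^sub>L A) < 1"
  by (rule norm_compose_less_1; use A B in simp)+

text \<open>The internal signal \<open>u\<close> of the loop turns every identity for \<open>\<Psi>\<^sub>A(B)\<close> into one for the Julia operator of
  \<open>A\<close>, in which no inverse occurs.\<close>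

lemma mobius_feedback:
  fixes x defines "u \<equiv> op_inv (id_blinfun - adj A \<circ>\<^sub>L B) (defect A x)"
  shows "mobius A B x = A x - defect (adj A) (B u)" and "u = defect A x + adj A (B u)"
proof -
  show "mobius A B x = A x - defect (adj A) (B u)"
    by (simp add: mobius_def blinfun.diff_left u_def inverse_push_through mobius_norms)
  show "u = defect A x + adj A (B u)"
    using neumann_inverse_apply(2)[OF mobius_norms(1), of "defect A x"]
    by (simp add: u_def algebra_simps)
qed

lemma mobius_cbop: "mobius A B \<in> cbop"
  unfolding mobius_def using A B
  by (intro cbop_diff cbop_compose cbop_neumann_inverse mobius_norms defect_properties) simp_all

text \<open>The diagonal terms are the definitions of the two defect operators; the cross terms cancel because
  \<open>A D\<^sub>A = D\<^bsub>A*\<^esub> A\<close>.\<close>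

lemma julia_unitary:
  "cinner (A x - defect (adj A) b) (A x' - defect (adj A) b')
     + cinner (defect A x + adj A b) (defect A x' + adj A b') = cinner x x' + cinner b b'"
proof -
  note D = defect_properties[OF A]
  have A': "adj A \<in> cbop" "norm (adj A) < 1" using A by simp_all
  note E = defect_properties[OF A']
  have s1: "cinner (A x) (A x') + cinner (defect A x) (defect A x') = cinner x x'"
    using adj_cinner(2)[OF D(1), of "defect A x" x'] adj_cinner(2)[OF A(1), of "A x" x']
    by (simp add: D(2,4) cinner_diff_left)
  have s2: "cinner (defect (adj A) b) (defect (adj A) b') + cinner (adj A b) (adj A b') = cinner b b'"
    using adj_cinner(2)[OF E(1), of "defect (adj A) b" b'] adj_cinner(1)[OF A(1), of "adj A b" b'] A(1)
    by (simp add: E(2,4) cinner_diff_left)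
  have s3: "cinner (A x) (defect (adj A) b') = cinner (defect A x) (adj A b')"
  proof -
    have "cinner (A x) (defect (adj A) b') = cinner (defect (adj A) (A x)) b'"
      using adj_cinner(2)[OF E(1), of "A x" b'] by (simp add: E(2))
    also have "\<dots> = cinner (A (defect A x)) b'" by (simp add: defect_intertwine[OF A])
    finally show ?thesis by (simp add: adj_cinner(1)[OF A(1)])
  qed
  have s4: "cinner (defect (adj A) b) (A x') = cinner (adj A b) (defect A x')"
  proof -
    have "cinner (defect (adj A) b) (A x') = cinner b (defect (adj A) (A x'))"
      using adj_cinner(1)[OF E(1), of b "A x'"] by (simp add: E(2))
    also have "\<dots> = cinner b (A (defect A x'))" by (simp add: defect_intertwine[OF A])
    finally show ?thesis by (simp add: adj_cinner(2)[OF A(1)])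
  qed
  show ?thesis
    unfolding s1[symmetric] s2[symmetric] cinner_diff_left cinner_diff_right cinner_add_left
      cinner_add_right s3 s4 by simp
qed

lemma mobius_cinner:
  "cinner x x' - cinner (mobius A B x) (mobius A B x') =
    (let u = op_inv (id_blinfun - adj A \<circ>\<^sub>L B) (defect A x);
         u' = op_inv (id_blinfun - adj A \<circ>\<^sub>L B) (defect A x')
     in cinner u u' - cinner (B u) (B u'))"
  using julia_unitary[of x "B (op_inv (id_blinfun - adj A \<circ>\<^sub>L B) (defect A x))"
      x' "B (op_inv (id_blinfun - adj A \<circ>\<^sub>L B) (defect A x'))"]
  unfolding Let_def mobius_feedback(1)[symmetric] mobius_feedback(2)[symmetric]
  by (simp add: algebra_simps)

lemma mobius_norm:
  fixes x defines "u \<equiv> op_inv (id_blinfun - adj A \<circ>\<^sub>L B) (defect A x)"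
  shows "(norm x)\<^sup>2 - (norm (mobius A B x))\<^sup>2 = (norm u)\<^sup>2 - (norm (B u))\<^sup>2"
proof -
  have "complex_of_real ((norm x)\<^sup>2 - (norm (mobius A B x))\<^sup>2) = of_real ((norm u)\<^sup>2 - (norm (B u))\<^sup>2)"
    using mobius_cinner[of x x] by (simp add: Let_def u_def cinner_self)
  thus ?thesis by (simp only: of_real_eq_iff)
qed

lemma norm_mobius_le: "norm (mobius A B) \<le> 1"
proof (rule norm_blinfun_bound)
  fix x
  have "(norm (B u))\<^sup>2 \<le> (norm u)\<^sup>2" for u
    using norm_blinfun_le[OF B(2), of u] by (intro power_mono) auto
  hence "0 \<le> (norm x)\<^sup>2 - (norm (mobius A B x))\<^sup>2" unfolding mobius_norm by simp
  thus "norm (mobius A B x) \<le> 1 * norm x" by (simp add: power2_le_iff_abs_le)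
qed simp

lemma mobius_isometry:
  assumes "isometry_op B" shows "isometry_op (mobius A B)"
  unfolding isometry_op_def
proof
  fix x
  have "(norm x)\<^sup>2 - (norm (mobius A B x))\<^sup>2 = 0"
    unfolding mobius_norm using assms by (simp add: isometry_op_def)
  thus "norm (mobius A B x) = norm x" by (simp add: power2_eq_iff_nonneg)
qed

text \<open>Taking adjoints exchanges \<open>(A, B)\<close> with \<open>(A*, B*)\<close>; this reduces the second defect identity to the first.\<close>

lemma adj_op_inv:
  "adj (op_inv (id_blinfun - adj A \<circ>\<^sub>L B)) = op_inv (id_blinfun - adj B \<circ>\<^sub>L A)"
proof (rule op_invI[symmetric])
  note c = cbop_neumann_inverse[OF mobius_norms(1)]
  have cb: "op_inv (id_blinfun - adj A \<circ>\<^sub>L B) \<in> cbop" using A B by (intro c) simp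
  have d: "id_blinfun - adj B \<circ>\<^sub>L A = adj (id_blinfun - adj A \<circ>\<^sub>L B)" using A B by simp
  have m: "id_blinfun - adj A \<circ>\<^sub>L B \<in> cbop" using A B by simp
  show "adj (op_inv (id_blinfun - adj A \<circ>\<^sub>L B)) \<circ>\<^sub>L (id_blinfun - adj B \<circ>\<^sub>L A) = id_blinfun"
    unfolding d adj_compose[OF m cb, symmetric] neumann_inverse[OF mobius_norms(1)] by simp
  show "(id_blinfun - adj B \<circ>\<^sub>L A) \<circ>\<^sub>L adj (op_inv (id_blinfun - adj A \<circ>\<^sub>L B)) = id_blinfun"
    unfolding d adj_compose[OF cb m, symmetric] neumann_inverse[OF mobius_norms(1)] by simp
qed

lemma mobius_defect_right:
  "id_blinfun - adj (mobius A B) \<circ>\<^sub>L mobius A B =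
    defect A \<circ>\<^sub>L op_inv (id_blinfun - adj B \<circ>\<^sub>L A) \<circ>\<^sub>L (id_blinfun - adj B \<circ>\<^sub>L B)
      \<circ>\<^sub>L op_inv (id_blinfun - adj A \<circ>\<^sub>L B) \<circ>\<^sub>L defect A"
proof (rule blinfun_eqI, rule cinner_eqI)
  fix x z
  let ?W = "op_inv (id_blinfun - adj A \<circ>\<^sub>L B)"
  note D = defect_properties[OF A]
  have W: "?W \<in> cbop" using A B by (intro cbop_neumann_inverse mobius_norms) simp
  have D': "cinner (defect A y) z = cinner y (defect A z)" for y z
    using adj_cinner(1)[OF D(1), of y z] by (simp add: D(2))
  have "cinner ((id_blinfun - adj (mobius A B) \<circ>\<^sub>L mobius A B) x) z
      = cinner x z - cinner (mobius A B x) (mobius A B z)"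
    by (simp add: blinfun.diff_left cinner_diff_left adj_cinner'[OF mobius_cbop])
  also have "\<dots> = cinner (?W (defect A x)) (?W (defect A z))
      - cinner (B (?W (defect A x))) (B (?W (defect A z)))"
    using mobius_cinner[of x z] by (simp add: Let_def)
  also have "\<dots> = cinner ((defect A \<circ>\<^sub>L adj ?W \<circ>\<^sub>L (id_blinfun - adj B \<circ>\<^sub>L B) \<circ>\<^sub>L ?W \<circ>\<^sub>L defect A) x) z"
    by (simp add: D' adj_cinner'[OF W] adj_cinner'[OF B(1)] blinfun.diff_left cinner_diff_left)
  finally show "cinner ((id_blinfun - adj (mobius A B) \<circ>\<^sub>L mobius A B) x) z = cinner ((defect A
      \<circ>\<^sub>L op_inv (id_blinfun - adj B \<circ>\<^sub>L A) \<circ>\<^sub>L (id_blinfun - adj B \<circ>\<^sub>L B) \<circ>\<^sub>L ?W \<circ>\<^sub>L defect A) x) z"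
    by (simp only: adj_op_inv)
qed

lemma adj_mobius: "adj (mobius A B) = mobius (adj A) (adj B)"
proof (rule adj_eqI)
  fix x y
  have A': "adj A \<in> cbop" "norm (adj A) < 1" using A by simp_all
  note D = defect_properties[OF A] and E = defect_properties[OF A']
  have W: "op_inv (id_blinfun - adj A \<circ>\<^sub>L B) \<in> cbop"
    using A B by (intro cbop_neumann_inverse mobius_norms) simp
  have D': "cinner (defect A y) z = cinner y (defect A z)" for y z
    using adj_cinner(1)[OF D(1), of y z] by (simp add: D(2))
  have E': "cinner (defect (adj A) y) z = cinner y (defect (adj A) z)" for y z
    using adj_cinner(1)[OF E(1), of y z] by (simp add: E(2))
  have "mobius (adj A) (adj B) y
      = adj A y - defect A (op_inv (id_blinfun - adj B \<circ>\<^sub>L A) (adj B (defect (adj A) y)))"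
    using A by (simp add: mobius_def blinfun.diff_left)
  thus "cinner (mobius A B x) y = cinner x (mobius (adj A) (adj B) y)"
    by (simp add: mobius_feedback(1) cinner_diff_left cinner_diff_right adj_cinner(1)[OF A(1)] E'
        adj_cinner(1)[OF B(1)] adj_cinner(1)[OF W] adj_op_inv D')
qed

text \<open>Let \<open>x\<close> be the internal signal of \<open>\<Psi>\<^sub>A(\<Psi>\<^sub>A(B))\<close> at the input \<open>s\<close>, and \<open>u\<close> that of \<open>\<Psi>\<^sub>A(B)\<close> at \<open>x\<close>.  The
  inverse of the Julia operator is its adjoint, which expresses \<open>(x, B u)\<close> through \<open>(\<Psi>\<^sub>A(B) x, u)\<close>; comparison
  with the defining equation of \<open>x\<close> gives \<open>s = u\<close>, and then the output is \<open>B s\<close>.\<close>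

lemma mobius_involution: "mobius A (mobius A B) = B"
proof (rule blinfun_eqI)
  fix s
  define M where "M = mobius A B"
  have nM: "norm (adj A \<circ>\<^sub>L M) < 1"
    using norm_compose_less_1(1)[of "adj A" M] norm_mobius_le A by (simp add: M_def)
  have nM': "norm (M \<circ>\<^sub>L adj A) < 1"
    using norm_compose_less_1(2)[of "adj A" M] norm_mobius_le A by (simp add: M_def)
  define x where "x = op_inv (id_blinfun - adj A \<circ>\<^sub>L M) (defect A s)"
  define u where "u = op_inv (id_blinfun - adj A \<circ>\<^sub>L B) (defect A x)"
  have A': "adj A \<in> cbop" "norm (adj A) < 1" using A by simp_all
  note D = defect_properties[OF A] and E = defect_properties[OF A']
  have y: "M x = A x - defect (adj A) (B u)" and u: "u = defect A x + adj A (B u)"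
    unfolding M_def u_def by (rule mobius_feedback)+
  have x: "x = defect A s + adj A (M x)"
    using neumann_inverse_apply(2)[OF nM, of "defect A s"] by (simp add: x_def algebra_simps)
  have i: "adj A (defect (adj A) z) = defect A (adj A z)" for z
    using defect_intertwine[OF A', of z] A by simp
  have "adj A (M x) + defect A u = x"
  proof -
    have "adj A (M x) = adj A (A x) - defect A (adj A (B u))"
      by (simp add: y blinfun.diff_right i)
    moreover have "defect A u = (x - adj A (A x)) + defect A (adj A (B u))"
      by (subst u) (simp add: blinfun.add_right D(4))
    ultimately show ?thesis by simp
  qed
  from trans[OF this x] have "defect A (s - u) = 0"
    by (simp add: blinfun.diff_right add.commute)
  hence su: "s = u" using D(5)[of "s - u"] by simp
  have "A u - defect (adj A) (M x) = B u"
  proof -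
    have "A u = defect (adj A) (A x) + A (adj A (B u))"
      by (subst u) (simp add: blinfun.add_right defect_intertwine[OF A])
    moreover have "defect (adj A) (M x) = defect (adj A) (A x) - (B u - A (adj A (B u)))"
      using A by (simp add: y blinfun.diff_right E(4))
    ultimately show ?thesis by simp
  qed
  moreover have "mobius A M s = A s - defect (adj A) (M x)"
    by (simp add: mobius_def blinfun.diff_left inverse_push_through[OF nM' nM] x_def)
  ultimately show "mobius A (mobius A B) s = B s" by (simp add: su M_def)
qed

end

lemma mobius_defect_left:
  fixes A B :: "'a::chilbert_space \<Rightarrow>\<^sub>L 'b::chilbert_space"
  assumes "A \<in> cbop" "norm A < 1" "B \<in> cbop" "norm B \<le> 1"
  shows "id_blinfun - mobius A B \<circ>\<^sub>L adj (mobius A B) =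
    defect (adj A) \<circ>\<^sub>L op_inv (id_blinfun - B \<circ>\<^sub>L adj A) \<circ>\<^sub>L (id_blinfun - B \<circ>\<^sub>L adj B)
      \<circ>\<^sub>L op_inv (id_blinfun - A \<circ>\<^sub>L adj B) \<circ>\<^sub>L defect (adj A)"
  using mobius_defect_right[of "adj A" "adj B"] assms mobius_cbop[OF assms]
  by (simp add: adj_mobius[OF assms, symmetric])

lemma mobius_isometry_iff:
  fixes A B :: "'a::chilbert_space \<Rightarrow>\<^sub>L 'b::chilbert_space"
  assumes "A \<in> cbop" "norm A < 1" "B \<in> cbop" "norm B \<le> 1"
  shows "isometry_op (mobius A B) \<longleftrightarrow> isometry_op B"
  using mobius_isometry[OF assms] mobius_isometry[OF assms(1,2) mobius_cbop[OF assms] norm_mobius_le[OF assms]]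
    mobius_involution[OF assms] by auto

lemma mobius_zero: "mobius A 0 = A"
  by (simp add: mobius_def)

lemma mobius_self:
  fixes A :: "'a::chilbert_space \<Rightarrow>\<^sub>L 'b::chilbert_space"
  assumes A: "A \<in> cbop" "norm A < 1"
  shows "mobius A A = 0"
  using mobius_involution[OF A cbop_zero] by (simp add: mobius_zero)

text \<open>The estimate rests on the resolvent identity
  \<open>(I - B A*)\<^sup>-\<^sup>1 B - (I - B' A*)\<^sup>-\<^sup>1 B' = (I - B A*)\<^sup>-\<^sup>1 (B - B') (I - A* B')\<^sup>-\<^sup>1\<close>.\<close>

lemma mobius_lipschitz:
  fixes A B B' :: "'a::chilbert_space \<Rightarrow>\<^sub>L 'b::chilbert_space"
  assumes A: "A \<in> cbop" "norm A < 1" and B: "norm B \<le> 1" "norm B' \<le> 1"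
  shows "norm (mobius A B - mobius A B') \<le> (2 / (1 - norm A))\<^sup>2 * norm (B - B')"
proof -
  have A': "adj A \<in> cbop" "norm (adj A) < 1" using A by simp_all
  have n: "norm (B \<circ>\<^sub>L adj A) \<le> norm A" "norm (adj A \<circ>\<^sub>L B') \<le> norm A" "norm (B' \<circ>\<^sub>L adj A) \<le> norm A"
    using norm_compose_le[of B 1 "adj A" "norm A"] norm_compose_le[of "adj A" "norm A" B' 1]
      norm_compose_le[of B' 1 "adj A" "norm A"] A B by simp_all
  define Z where "Z = op_inv (id_blinfun - B \<circ>\<^sub>L adj A)"
  define W where "W = op_inv (id_blinfun - adj A \<circ>\<^sub>L B')"
  have "mobius A B - mobius A B'
      = - (defect (adj A) \<circ>\<^sub>L (Z \<circ>\<^sub>L ((B - B') \<circ>\<^sub>L (W \<circ>\<^sub>L defect A))))"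
  proof (rule blinfun_eqI)
    fix x
    define y where "y = W (defect A x)"
    have d: "defect A x = y - adj A (B' y)"
      using neumann_inverse_apply(2)[of "adj A \<circ>\<^sub>L B'" "defect A x"] n A by (simp add: y_def W_def)
    have z: "Z (B' y - B (adj A (B' y))) = B' y"
      using neumann_inverse_apply(1)[of "B \<circ>\<^sub>L adj A" "B' y"] n A by (simp add: Z_def)
    have "Z (B (defect A x)) - B' y = Z (B (y - adj A (B' y))) - Z (B' y - B (adj A (B' y)))"
      by (simp only: d z)
    also have "\<dots> = Z (B y - B' y)" by (simp add: blinfun.diff_right)
    finally have "Z (B (defect A x)) - B' y = Z (B y - B' y)" .
    moreover have "op_inv (id_blinfun - B' \<circ>\<^sub>L adj A) (B' (defect A x)) = B' y"
      unfolding y_def W_def by (rule inverse_push_through) (use n A in linarith)+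
    ultimately have "op_inv (id_blinfun - B' \<circ>\<^sub>L adj A) (B' (defect A x)) - Z (B (defect A x))
        = - Z (B y - B' y)"
      by (simp add: algebra_simps)
    moreover have "(mobius A B - mobius A B') x = defect (adj A)
        (op_inv (id_blinfun - B' \<circ>\<^sub>L adj A) (B' (defect A x)) - Z (B (defect A x)))"
      by (simp add: mobius_def blinfun.bilinear_simps Z_def)
    ultimately show "(mobius A B - mobius A B') x
        = (- (defect (adj A) \<circ>\<^sub>L (Z \<circ>\<^sub>L ((B - B') \<circ>\<^sub>L (W \<circ>\<^sub>L defect A))))) x"
      by (simp add: blinfun.minus_left blinfun.minus_right blinfun.diff_left y_def)
  qed
  also have "norm \<dots> \<le> 2 * (1 / (1 - norm A) * (norm (B - B') * (1 / (1 - norm A) * 2)))"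
    unfolding norm_minus_cancel Z_def W_def
    by (intro norm_compose_le norm_neumann_inverse_le defect_properties A A' n order_refl)
  also have "\<dots> = (2 / (1 - norm A))\<^sup>2 * norm (B - B')"
    by (simp add: power2_eq_square)
  finally show ?thesis .
qed

section \<open>Tensor products of operators\<close>

lemma norm_tensor: "norm (x \<otimes>\<^sub>h y) = norm x * norm y"
proof -
  have "complex_of_real ((norm (x \<otimes>\<^sub>h y))\<^sup>2) = of_real ((norm x * norm y)\<^sup>2)"
    by (simp only: cinner_self[symmetric] cinner_tensor) (simp add: cinner_self power_mult_distrib)
  hence "(norm (x \<otimes>\<^sub>h y))\<^sup>2 = (norm x * norm y)\<^sup>2" by (simp only: of_real_eq_iff)
  thus ?thesis by (simp add: power2_eq_iff_nonneg)
qed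

lemma htensor_operator_eqI:
  assumes "\<And>x y. blinfun_apply R (x \<otimes>\<^sub>h y) = blinfun_apply R' (x \<otimes>\<^sub>h y)"
  shows "R = R'"
  by (rule total_blinfun_eqI[OF closure_span_tensor]) (auto simp: assms)

lemma htensor_cinner_eqI:
  assumes "\<And>x y. cinner (x \<otimes>\<^sub>h y) u = cinner (x \<otimes>\<^sub>h y) v"
  shows "u = v"
proof (rule cinner_eqI2)
  fix z
  have bl: "bounded_linear (\<lambda>z. cinner z w)" for w :: "('a, 'b) htensor"
    by (rule bounded_linear_cinner_left)
  have "Blinfun (\<lambda>z. cinner z u) = Blinfun (\<lambda>z. cinner z v)"
    by (rule htensor_operator_eqI) (simp add: bounded_linear_Blinfun_apply[OF bl] assms)
  thus "cinner z u = cinner z v" by (metis bounded_linear_Blinfun_apply[OF bl])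
qed

text \<open>In coordinates with respect to the chosen orthonormal basis of the second factor this is an operator on a
  direct sum.  The orthogonality condition makes the ranges on different basis vectors orthogonal; the flip, the
  amplification \<open>S \<otimes> I\<close> and the change of bracketing all satisfy it.\<close>

lemma htensor_operator_exists:
  fixes \<phi> :: "'a::chilbert_space \<Rightarrow> 'b::chilbert_space \<Rightarrow> 'c::chilbert_space"
  assumes addl: "\<And>x x' y. \<phi> (x + x') y = \<phi> x y + \<phi> x' y"
    and addr: "\<And>x y y'. \<phi> x (y + y') = \<phi> x y + \<phi> x y'"
    and scll: "\<And>c x y. \<phi> (c *\<^sub>C x) y = c *\<^sub>C \<phi> x y"
    and sclr: "\<And>c x y. \<phi> x (c *\<^sub>C y) = c *\<^sub>C \<phi> x y"
    and bd: "\<And>x y. norm (\<phi> x y) \<le> C * norm x * norm y" and C: "C \<ge> 0"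
    and orth: "\<And>x x' y y'. cinner y y' = 0 \<Longrightarrow> cinner (\<phi> x y) (\<phi> x' y') = 0"
  obtains R where "R \<in> cbop" "\<And>x y. blinfun_apply R (x \<otimes>\<^sub>h y) = \<phi> x y" "norm R \<le> C"
proof -
  have on: "orthonormal (onb :: 'b set)" using is_onb_onb unfolding is_onb_def by blast
  define \<psi> where "\<psi> b x = (if b \<in> onb then \<phi> x b else 0)" for b x
  have pb: "norm (\<psi> b x) \<le> C * norm x" for b x
    using bd[of x b] on C by (auto simp: \<psi>_def orthonormal_def)
  have po: "cinner (\<psi> b x) (\<psi> b' x') = 0" if "b \<noteq> b'" for b b' x x'
    using orth[of b b' x x'] on that by (auto simp: \<psi>_def orthonormal_def)
  have padd: "\<psi> b (x + x') = \<psi> b x + \<psi> b x'" and pscl: "\<psi> b (c *\<^sub>C x) = c *\<^sub>C \<psi> b x" for b c x x'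
    by (simp_all add: \<psi>_def addl scll)
  obtain R0 where R0: "R0 \<in> cbop" "norm R0 \<le> C"
    "\<And>f. ((\<lambda>i. \<psi> i (Rep_ell2 f i)) has_sum blinfun_apply R0 f) UNIV"
    by (rule ell2_operator_exists[OF padd pscl pb C], erule po, blast)
  obtain R where R: "R \<in> cbop" "\<And>u. blinfun_apply R u = R0 (Rep_htensor u)" "norm R \<le> C"
  proof (rule cbop_of_map[of "\<lambda>u. R0 (Rep_htensor u)" C])
    show "norm (R0 (Rep_htensor u)) \<le> C * norm u" for u :: "('a, 'b) htensor"
      using norm_blinfun_le[OF R0(2), of "Rep_htensor u"] by (simp add: norm_htensor.rep_eq)
  qed (simp_all add: plus_htensor.rep_eq scaleC_htensor.rep_eq blinfun.add_right cbop_scaleC[OF R0(1)] C)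
  show ?thesis
  proof (rule that[OF R(1) _ R(3)])
    fix x y
    have bl: "bounded_linear (\<phi> x)"
      by (rule bounded_linear_intro[where K = "C * norm x"])
         (use bd[of x] in \<open>auto simp: addr sclr scaleR_scaleC mult.commute\<close>)
    have "((\<lambda>b. \<phi> x (cinner y b *\<^sub>C b)) has_sum \<phi> x y) onb"
      by (rule has_sum_bounded_linear[OF bl onb_expansion[OF is_onb_onb]])
    hence "((\<lambda>b. \<psi> b (Rep_ell2 (Rep_htensor (x \<otimes>\<^sub>h y)) b)) has_sum \<phi> x y) UNIV"
      by (rule has_sum_cong_neutral[THEN iffD1, rotated -1])
         (auto simp: \<psi>_def Rep_tensor sclr scll)
    thus "R (x \<otimes>\<^sub>h y) = \<phi> x y"
      unfolding R(2) using R0(3) by (rule has_sum_unique[rotated])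
  qed
qed

lemma tensor_flip_exists:
  obtains R :: "('a::chilbert_space, 'b::chilbert_space) htensor \<Rightarrow>\<^sub>L ('b, 'a) htensor"
  where "R \<in> cbop" "\<And>x y. blinfun_apply R (x \<otimes>\<^sub>h y) = y \<otimes>\<^sub>h x" "norm R \<le> 1"
  by (rule htensor_operator_exists[of "\<lambda>x y. y \<otimes>\<^sub>h x" 1])
     (auto simp: tensor_add_left tensor_add_right tensor_scaleC_left tensor_scaleC_right norm_tensor
        cinner_tensor)

lemma tensor_left_factor_exists:
  fixes S :: "'a::chilbert_space \<Rightarrow>\<^sub>L 'c::chilbert_space"
  assumes "S \<in> cbop"
  obtains R :: "('a, 'b::chilbert_space) htensor \<Rightarrow>\<^sub>L ('c, 'b) htensor"
  where "R \<in> cbop" "\<And>x y. blinfun_apply R (x \<otimes>\<^sub>h y) = S x \<otimes>\<^sub>h y" "norm R \<le> norm S"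
  by (rule htensor_operator_exists[of "\<lambda>x y. S x \<otimes>\<^sub>h y" "norm S"])
     (auto simp: tensor_add_left tensor_add_right tensor_scaleC_left tensor_scaleC_right norm_tensor
        cinner_tensor blinfun.add_right cbop_scaleC[OF assms] intro!: mult_right_mono norm_blinfun)

text \<open>Only the first factor is accessible in coordinates: \<open>I \<otimes> T\<close> does not preserve orthogonality in the second
  one.  So \<open>S \<otimes> T\<close> is composed of two left amplifications and two flips.\<close>

lemma op_tensor_exists:
  fixes S :: "'a::chilbert_space \<Rightarrow>\<^sub>L 'c::chilbert_space" and T :: "'b::chilbert_space \<Rightarrow>\<^sub>L 'd::chilbert_space"
  assumes "S \<in> cbop" "T \<in> cbop"
  obtains R where "R \<in> cbop" "\<And>x y. blinfun_apply R (x \<otimes>\<^sub>h y) = S x \<otimes>\<^sub>h T y" "norm R \<le> norm S * norm T"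
proof -
  obtain f1 :: "('c, 'b) htensor \<Rightarrow>\<^sub>L ('b, 'c) htensor" where
    f1: "f1 \<in> cbop" "\<And>x y. blinfun_apply f1 (x \<otimes>\<^sub>h y) = y \<otimes>\<^sub>h x" "norm f1 \<le> 1"
    by (rule tensor_flip_exists) blast
  obtain f2 :: "('d, 'c) htensor \<Rightarrow>\<^sub>L ('c, 'd) htensor" where
    f2: "f2 \<in> cbop" "\<And>x y. blinfun_apply f2 (x \<otimes>\<^sub>h y) = y \<otimes>\<^sub>h x" "norm f2 \<le> 1"
    by (rule tensor_flip_exists) blast
  obtain s :: "('a, 'b) htensor \<Rightarrow>\<^sub>L ('c, 'b) htensor" where
    s: "s \<in> cbop" "\<And>x y. blinfun_apply s (x \<otimes>\<^sub>h y) = S x \<otimes>\<^sub>h y" "norm s \<le> norm S"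
    by (rule tensor_left_factor_exists[OF assms(1)]) blast
  obtain t :: "('b, 'c) htensor \<Rightarrow>\<^sub>L ('d, 'c) htensor" where
    t: "t \<in> cbop" "\<And>x y. blinfun_apply t (x \<otimes>\<^sub>h y) = T x \<otimes>\<^sub>h y" "norm t \<le> norm T"
    by (rule tensor_left_factor_exists[OF assms(2)]) blast
  show ?thesis
  proof (rule that)
    show "f2 \<circ>\<^sub>L (t \<circ>\<^sub>L (f1 \<circ>\<^sub>L s)) \<in> cbop" using f1 f2 s t by simp
    show "blinfun_apply (f2 \<circ>\<^sub>L (t \<circ>\<^sub>L (f1 \<circ>\<^sub>L s))) (x \<otimes>\<^sub>h y) = S x \<otimes>\<^sub>h T y" for x y
      by (simp add: f1 f2 s t)
    have "norm (f2 \<circ>\<^sub>L (t \<circ>\<^sub>L (f1 \<circ>\<^sub>L s))) \<le> 1 * (norm T * (1 * norm S))"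
      by (intro norm_compose_le f1 f2 s t)
    thus "norm (f2 \<circ>\<^sub>L (t \<circ>\<^sub>L (f1 \<circ>\<^sub>L s))) \<le> norm S * norm T" by (simp add: mult.commute)
  qed
qed

lemma op_tensor_eqI:
  assumes "R \<in> cbop" "\<And>x y. blinfun_apply R (x \<otimes>\<^sub>h y) = blinfun_apply S x \<otimes>\<^sub>h blinfun_apply T y"
  shows "S \<otimes>\<^sub>o T = R"
  unfolding op_tensor_def
  by (rule the_equality) (simp_all add: assms htensor_operator_eqI)

lemma op_tensor:
  assumes "S \<in> cbop" "T \<in> cbop"
  shows op_tensor_cbop [simp]: "S \<otimes>\<^sub>o T \<in> cbop"
    and op_tensor_apply [simp]: "blinfun_apply (S \<otimes>\<^sub>o T) (x \<otimes>\<^sub>h y) = blinfun_apply S x \<otimes>\<^sub>h blinfun_apply T y"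
    and norm_op_tensor_le: "norm (S \<otimes>\<^sub>o T) \<le> norm S * norm T"
proof -
  obtain R where R: "R \<in> cbop" "\<And>x y. blinfun_apply R (x \<otimes>\<^sub>h y) = blinfun_apply S x \<otimes>\<^sub>h blinfun_apply T y"
    "norm R \<le> norm S * norm T"
    by (rule op_tensor_exists[OF assms]) blast
  have "S \<otimes>\<^sub>o T = R" by (rule op_tensor_eqI[OF R(1,2)])
  thus "S \<otimes>\<^sub>o T \<in> cbop" "(S \<otimes>\<^sub>o T) (x \<otimes>\<^sub>h y) = blinfun_apply S x \<otimes>\<^sub>h blinfun_apply T y"
    "norm (S \<otimes>\<^sub>o T) \<le> norm S * norm T" using R by simp_all
qed

lemma norm_id_op_tensor_le: "T \<in> cbop \<Longrightarrow> norm (id_blinfun \<otimes>\<^sub>o T) \<le> norm T"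
  using norm_op_tensor_le[OF cbop_id, of T] mult_right_mono[OF norm_blinfun_id_le norm_ge_zero]
  by (metis mult_1 order_trans)

lemma norm_op_tensor_id_le: "T \<in> cbop \<Longrightarrow> norm (T \<otimes>\<^sub>o id_blinfun) \<le> norm T"
  using norm_op_tensor_le[OF _ cbop_id, of T] mult_left_mono[OF norm_blinfun_id_le norm_ge_zero]
  by (metis mult_1_right order_trans)

lemma op_tensor_compose:
  assumes "S \<in> cbop" "T \<in> cbop" "S' \<in> cbop" "T' \<in> cbop"
  shows "(S \<otimes>\<^sub>o T) \<circ>\<^sub>L (S' \<otimes>\<^sub>o T') = (S \<circ>\<^sub>L S') \<otimes>\<^sub>o (T \<circ>\<^sub>L T')"
  by (rule htensor_operator_eqI) (simp add: assms)

lemma op_tensor_adj: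
  assumes "S \<in> cbop" "T \<in> cbop"
  shows "adj (S \<otimes>\<^sub>o T) = adj S \<otimes>\<^sub>o adj T"
proof (rule htensor_operator_eqI, rule htensor_cinner_eqI)
  fix x y x' y'
  show "cinner (x' \<otimes>\<^sub>h y') (adj (S \<otimes>\<^sub>o T) (x \<otimes>\<^sub>h y)) = cinner (x' \<otimes>\<^sub>h y') ((adj S \<otimes>\<^sub>o adj T) (x \<otimes>\<^sub>h y))"
    by (simp add: assms adj_cinner' cinner_tensor)
qed

lemma op_tensor_id [simp]: "id_blinfun \<otimes>\<^sub>o id_blinfun = id_blinfun"
  by (rule op_tensor_eqI) simp_all

lemma tensor_zero [simp]: "x \<otimes>\<^sub>h 0 = 0" "0 \<otimes>\<^sub>h x = 0"
  using norm_tensor[of x 0] norm_tensor[of 0 x] by simp_all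

lemma op_tensor_zero [simp]: "S \<otimes>\<^sub>o 0 = 0" "0 \<otimes>\<^sub>o S = 0"
  by (rule op_tensor_eqI; simp)+

lemma tensor_minus: "x \<otimes>\<^sub>h (- y) = - (x \<otimes>\<^sub>h y)" "(- x) \<otimes>\<^sub>h y = - (x \<otimes>\<^sub>h y)"
  using tensor_add_right[of x y "- y"] tensor_add_left[of x "- x" y]
  by (simp_all add: eq_neg_iff_add_eq_0 add.commute)

lemma tensor_diff: "x \<otimes>\<^sub>h (y - z) = x \<otimes>\<^sub>h y - x \<otimes>\<^sub>h z" "(x - w) \<otimes>\<^sub>h y = x \<otimes>\<^sub>h y - w \<otimes>\<^sub>h y"
  using tensor_add_right[of x y "- z"] tensor_add_left[of x "- w" y] by (simp_all add: tensor_minus)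

lemma op_tensor_diff_right:
  assumes "S \<in> cbop" "T \<in> cbop" "T' \<in> cbop"
  shows "S \<otimes>\<^sub>o (T - T') = S \<otimes>\<^sub>o T - S \<otimes>\<^sub>o T'"
  by (rule op_tensor_eqI) (simp_all add: assms blinfun.diff_left tensor_diff)

lemma op_tensor_add_right:
  assumes "S \<in> cbop" "T \<in> cbop" "T' \<in> cbop"
  shows "S \<otimes>\<^sub>o (T + T') = S \<otimes>\<^sub>o T + S \<otimes>\<^sub>o T'"
  by (rule op_tensor_eqI) (simp_all add: assms blinfun.add_left tensor_add_right)

lemma op_tensor_add_left:
  assumes "S \<in> cbop" "S' \<in> cbop" "T \<in> cbop"
  shows "(S + S') \<otimes>\<^sub>o T = S \<otimes>\<^sub>o T + S' \<otimes>\<^sub>o T"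
  by (rule op_tensor_eqI) (simp_all add: assms blinfun.add_left tensor_add_left)

lemma op_tensor_sum_right:
  assumes "S \<in> cbop" "\<And>i. i \<in> I \<Longrightarrow> T i \<in> cbop"
  shows "S \<otimes>\<^sub>o (\<Sum>i\<in>I. T i) = (\<Sum>i\<in>I. S \<otimes>\<^sub>o T i)"
  using assms(2) by (induction I rule: infinite_finite_induct) (simp_all add: assms(1) op_tensor_add_right)

lemma op_tensor_sum_left:
  assumes "S \<in> cbop" "\<And>i. i \<in> I \<Longrightarrow> T i \<in> cbop"
  shows "(\<Sum>i\<in>I. T i) \<otimes>\<^sub>o S = (\<Sum>i\<in>I. T i \<otimes>\<^sub>o S)"
  using assms(2) by (induction I rule: infinite_finite_induct) (simp_all add: assms(1) op_tensor_add_left)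

text \<open>If \<open>D\<^sub>A = I - R\<close> with \<open>R\<close> self-adjoint and strictly contractive, then \<open>I \<otimes> R\<close> has the same properties, so
  uniqueness of square roots applies to \<open>I \<otimes> D\<^sub>A\<close>.\<close>

lemma defect_id_tensor:
  fixes A :: "'a::chilbert_space \<Rightarrow>\<^sub>L 'b::chilbert_space"
  assumes "A \<in> cbop" "norm A < 1"
  shows "defect (id_blinfun \<otimes>\<^sub>o A) = (id_blinfun :: 'h::chilbert_space \<Rightarrow>\<^sub>L 'h) \<otimes>\<^sub>o defect A"
proof -
  obtain R :: "'a \<Rightarrow>\<^sub>L 'a" where R: "R \<in> cbop" "adj R = R" "norm R < 1" "defect A = id_blinfun - R"
    "defect A \<circ>\<^sub>L defect A = id_blinfun - adj A \<circ>\<^sub>L A"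
    by (rule defect_decomposition[OF assms])
  let ?I = "id_blinfun :: 'h \<Rightarrow>\<^sub>L 'h"
  have eq: "?I \<otimes>\<^sub>o (id_blinfun - T) = id_blinfun - ?I \<otimes>\<^sub>o T" if "T \<in> cbop" for T :: "'a \<Rightarrow>\<^sub>L 'a"
    using that by (simp add: op_tensor_diff_right)
  have "defect (?I \<otimes>\<^sub>o A) = id_blinfun - ?I \<otimes>\<^sub>o R"
  proof (rule defect_unique)
    show "norm (?I \<otimes>\<^sub>o A) < 1" "norm (?I \<otimes>\<^sub>o R) < 1"
      by (rule le_less_trans[OF norm_id_op_tensor_le], use assms R(1,3) in simp_all)+
    show "(id_blinfun - ?I \<otimes>\<^sub>o R) \<circ>\<^sub>L (id_blinfun - ?I \<otimes>\<^sub>o R) = id_blinfun - adj (?I \<otimes>\<^sub>o A) \<circ>\<^sub>L (?I \<otimes>\<^sub>o A)"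
      using R(1,5) assms defect_properties(1)[OF assms] by (simp add: eq[symmetric] op_tensor_compose op_tensor_adj flip: R(4))
  qed (use assms R in \<open>simp_all add: op_tensor_adj\<close>)
  thus ?thesis by (simp add: R(4) eq[OF R(1)])
qed

subsection \<open>Elementary embeddings and associativity\<close>

definition scalar_op :: "complex \<Rightarrow> 'a::chilbert_space \<Rightarrow>\<^sub>L 'a" where
  "scalar_op c = Blinfun (\<lambda>x. c *\<^sub>C x)"

lemma scalar_op_apply [simp]: "scalar_op c x = c *\<^sub>C x"
  by (simp add: scalar_op_def bounded_linear_Blinfun_apply bounded_linear_scaleC)

lemma scalar_op_cbop [simp]: "scalar_op c \<in> cbop"
  by (simp add: cbop_def scaleC_scaleC mult.commute)

definition tensor_left :: "'a::chilbert_space \<Rightarrow> ('b::chilbert_space \<Rightarrow>\<^sub>L ('a, 'b) htensor)" where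
  "tensor_left f = Blinfun (\<lambda>x. f \<otimes>\<^sub>h x)"

definition tensor_right :: "'b::chilbert_space \<Rightarrow> ('a::chilbert_space \<Rightarrow>\<^sub>L ('a, 'b) htensor)" where
  "tensor_right x = Blinfun (\<lambda>f. f \<otimes>\<^sub>h x)"

lemma tensor_left_apply [simp]:
  fixes f :: "'a::chilbert_space" and x :: "'b::chilbert_space"
  shows "tensor_left f x = f \<otimes>\<^sub>h x"
proof -
  have "bounded_linear (\<lambda>x::'b. f \<otimes>\<^sub>h x)"
    by (rule bounded_linear_intro[where K = "norm f"])
       (auto simp: tensor_add_right scaleR_scaleC tensor_scaleC_right norm_tensor)
  thus ?thesis by (simp add: tensor_left_def bounded_linear_Blinfun_apply)
qed

lemma tensor_right_apply [simp]:
  fixes f :: "'a::chilbert_space" and x :: "'b::chilbert_space"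
  shows "tensor_right x f = f \<otimes>\<^sub>h x"
proof -
  have "bounded_linear (\<lambda>f::'a. f \<otimes>\<^sub>h x)"
    by (rule bounded_linear_intro[where K = "norm x"])
       (auto simp: tensor_add_left scaleR_scaleC tensor_scaleC_left norm_tensor)
  thus ?thesis by (simp add: tensor_right_def bounded_linear_Blinfun_apply)
qed

lemma tensor_left_cbop [simp]: "tensor_left f \<in> cbop"
  and tensor_right_cbop [simp]: "tensor_right x \<in> cbop"
  by (simp_all add: cbop_def tensor_scaleC_left tensor_scaleC_right)

lemma norm_tensor_right_le: "norm (tensor_right x) \<le> norm x"
  by (rule norm_blinfun_bound) (simp_all add: norm_tensor mult.commute)

lemma adj_tensor_left [simp]: "adj (tensor_left f) (g \<otimes>\<^sub>h x) = cinner g f *\<^sub>C x"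
  by (rule cinner_eqI) (simp add: adj_cinner' cinner_tensor cinner_scaleC_left)

lemma adj_tensor_right [simp]: "adj (tensor_right x) (f \<otimes>\<^sub>h y) = cinner y x *\<^sub>C f"
  by (rule cinner_eqI) (simp add: adj_cinner' cinner_tensor cinner_scaleC_left mult.commute)

lemma tensor_assoc_exists:
  obtains R :: "(('a::chilbert_space, 'b::chilbert_space) htensor, 'c::chilbert_space) htensor
     \<Rightarrow>\<^sub>L ('a, ('b, 'c) htensor) htensor"
  where "R \<in> cbop" "\<And>x y z. blinfun_apply R ((x \<otimes>\<^sub>h y) \<otimes>\<^sub>h z) = x \<otimes>\<^sub>h (y \<otimes>\<^sub>h z)"
proof -
  let ?I = "id_blinfun :: 'a \<Rightarrow>\<^sub>L 'a"
  \<comment> \<open>for fixed \<open>z\<close> the map is the amplification of \<open>y \<mapsto> y \<otimes> z\<close>, and \<open>t z'* t z\<close> is a multiple of the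
    identity by \<open>\<langle>z, z'\<rangle>\<close>\<close>
  define t where "t z = ?I \<otimes>\<^sub>o (tensor_right z :: 'b \<Rightarrow>\<^sub>L ('b, 'c) htensor)" for z
  have t: "t z \<in> cbop" "blinfun_apply (t z) (x \<otimes>\<^sub>h y) = x \<otimes>\<^sub>h (y \<otimes>\<^sub>h z)" for x y z
    by (simp_all add: t_def)
  have add: "t (z + z') = t z + t z'" for z z'
    by (rule htensor_operator_eqI) (simp add: t blinfun.add_left tensor_add_right)
  have "t (c *\<^sub>C z) = scalar_op c \<circ>\<^sub>L t z" for c z
    by (rule htensor_operator_eqI) (simp add: t tensor_scaleC_right)
  hence scl: "blinfun_apply (t (c *\<^sub>C z)) u = c *\<^sub>C blinfun_apply (t z) u" for c z u
    by simp
  have bd: "norm (blinfun_apply (t z) u) \<le> norm u * norm z" for z u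
  proof -
    have "norm (t z) \<le> norm z"
      unfolding t_def by (rule order_trans[OF norm_id_op_tensor_le norm_tensor_right_le]) simp
    thus ?thesis using norm_blinfun_le[of "t z" "norm z" u] by (simp add: mult.commute)
  qed
  have orth: "cinner (blinfun_apply (t z) u) (blinfun_apply (t z') u') = 0" if "cinner z z' = 0" for z z' u u'
  proof -
    have "adj (t z') \<circ>\<^sub>L t z = 0"
      by (rule htensor_operator_eqI) (simp add: t_def op_tensor_adj that)
    hence "blinfun_apply (adj (t z')) (blinfun_apply (t z) u) = 0"
      by (metis blinfun_apply_blinfun_compose blinfun.zero_left)
    thus ?thesis by (simp add: adj_cinner(2)[OF t(1)])
  qed
  obtain R where "R \<in> cbop" "\<And>u z. blinfun_apply R (u \<otimes>\<^sub>h z) = blinfun_apply (t z) u"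
    by (rule htensor_operator_exists[of "\<lambda>u z. blinfun_apply (t z) u" 1])
       (auto simp: add blinfun.bilinear_simps scl cbop_scaleC[OF t(1)] bd orth)
  thus ?thesis using that[of R] t(2) by simp
qed

lemma htensor3_operator_eqI:
  fixes R R' :: "(('a::chilbert_space, 'b::chilbert_space) htensor, 'c::chilbert_space) htensor
     \<Rightarrow>\<^sub>L 'd::chilbert_space"
  assumes "\<And>x y z. blinfun_apply R ((x \<otimes>\<^sub>h y) \<otimes>\<^sub>h z) = blinfun_apply R' ((x \<otimes>\<^sub>h y) \<otimes>\<^sub>h z)"
  shows "R = R'"
proof (rule htensor_operator_eqI)
  fix u z
  have "R \<circ>\<^sub>L tensor_right z = R' \<circ>\<^sub>L tensor_right z"
    by (rule htensor_operator_eqI) (simp add: assms)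
  from arg_cong[OF this, of "\<lambda>S. blinfun_apply S u"] show "R (u \<otimes>\<^sub>h z) = R' (u \<otimes>\<^sub>h z)" by simp
qed

lemma tensor_assoc:
  fixes x :: "'a::chilbert_space" and y :: "'b::chilbert_space" and z :: "'c::chilbert_space"
  shows tensor_assoc_cbop [simp]: "tensor_assoc \<in>
      (cbop :: ((('a, 'b) htensor, 'c) htensor \<Rightarrow>\<^sub>L ('a, ('b, 'c) htensor) htensor) set)"
    and tensor_assoc_apply [simp]: "tensor_assoc ((x \<otimes>\<^sub>h y) \<otimes>\<^sub>h z) = x \<otimes>\<^sub>h (y \<otimes>\<^sub>h z)"
proof -
  obtain R :: "(('a, 'b) htensor, 'c) htensor \<Rightarrow>\<^sub>L ('a, ('b, 'c) htensor) htensor"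
    where R: "R \<in> cbop" "\<And>x y z. blinfun_apply R ((x \<otimes>\<^sub>h y) \<otimes>\<^sub>h z) = x \<otimes>\<^sub>h (y \<otimes>\<^sub>h z)"
    by (rule tensor_assoc_exists) blast
  have "tensor_assoc = R"
    unfolding tensor_assoc_def
    by (rule the_equality) (simp_all add: R htensor3_operator_eqI)
  thus "tensor_assoc \<in> (cbop :: ((('a, 'b) htensor, 'c) htensor \<Rightarrow>\<^sub>L ('a, ('b, 'c) htensor) htensor) set)"
    "tensor_assoc ((x \<otimes>\<^sub>h y) \<otimes>\<^sub>h z) = x \<otimes>\<^sub>h (y \<otimes>\<^sub>h z)" using R by simp_all
qed

lemma adj_tensor_assoc [simp]: "adj tensor_assoc (x \<otimes>\<^sub>h (y \<otimes>\<^sub>h z)) = (x \<otimes>\<^sub>h y) \<otimes>\<^sub>h z"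
proof -
  let ?u = "adj tensor_assoc (x \<otimes>\<^sub>h (y \<otimes>\<^sub>h z))" and ?v = "(x \<otimes>\<^sub>h y) \<otimes>\<^sub>h z"
  have "adj (tensor_right c) ?u = adj (tensor_right c) ?v" for c
  proof (rule htensor_cinner_eqI)
    fix a b
    have "cinner (a \<otimes>\<^sub>h b) (adj (tensor_right c) ?u) = cinner ((a \<otimes>\<^sub>h b) \<otimes>\<^sub>h c) ?u"
      by (simp add: adj_cinner'(2)[OF tensor_right_cbop])
    also have "\<dots> = cinner ((a \<otimes>\<^sub>h b) \<otimes>\<^sub>h c) ?v"
      by (simp add: adj_cinner'(2)[OF tensor_assoc_cbop] cinner_tensor)
    also have "\<dots> = cinner (a \<otimes>\<^sub>h b) (adj (tensor_right c) ?v)"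
      by (subst adj_cinner'(2)[OF tensor_right_cbop]) simp
    finally show "cinner (a \<otimes>\<^sub>h b) (adj (tensor_right c) ?u) = cinner (a \<otimes>\<^sub>h b) (adj (tensor_right c) ?v)" .
  qed
  hence "cinner w (adj (tensor_right c) ?u) = cinner w (adj (tensor_right c) ?v)" for w c by simp
  hence "cinner (w \<otimes>\<^sub>h c) ?u = cinner (w \<otimes>\<^sub>h c) ?v" for w c
    unfolding adj_cinner'(2)[OF tensor_right_cbop] by simp
  thus ?thesis by (rule htensor_cinner_eqI)
qed

lemma adj_tensor_assoc_compose [simp]: "adj tensor_assoc \<circ>\<^sub>L tensor_assoc = id_blinfun"
  by (rule htensor3_operator_eqI) simp

subsection \<open>Amplification of column estimates\<close>

text \<open>A column bound \<open>\<Sum> \<parallel>T\<^sub>i x\<parallel>\<^sup>2 \<le> C \<parallel>x\<parallel>\<^sup>2\<close> says that the positive operator \<open>\<Sum> T\<^sub>i* T\<^sub>i\<close> has norm at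
  most \<open>C\<close>, and in this form it survives tensoring with the identity.\<close>

lemma column_gram_norm:
  assumes T: "\<And>i. i \<in> I \<Longrightarrow> T i \<in> cbop"
    and le: "\<And>x. (\<Sum>i\<in>I. (norm (blinfun_apply (T i) x))\<^sup>2) \<le> C * (norm x)\<^sup>2" and C: "C \<ge> 0"
  shows "norm (\<Sum>i\<in>I. adj (T i) \<circ>\<^sub>L T i) \<le> C"
proof (rule norm_blinfun_bound[OF C])
  fix x
  define M where "M = (\<Sum>i\<in>I. adj (T i) \<circ>\<^sub>L T i)"
  have "cinner (M x) (M x) = (\<Sum>i\<in>I. cinner (T i x) (T i (M x)))"
  proof -
    have "cinner (M x) y = (\<Sum>i\<in>I. cinner (T i x) (T i y))" for y
      unfolding M_def blinfun.sum_left cinner_sum_left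
      by (rule sum.cong) (simp_all add: adj_cinner'(1)[OF T])
    thus ?thesis .
  qed
  hence "(norm (M x))\<^sup>2 = cmod (\<Sum>i\<in>I. cinner (T i x) (T i (M x)))"
    by (metis cinner_self norm_of_real abs_of_nonneg zero_le_power2)
  also have "\<dots> \<le> (\<Sum>i\<in>I. norm (T i x) * norm (T i (M x)))"
    by (intro sum_norm_le cinner_Cauchy_Schwarz)
  finally have "((norm (M x))\<^sup>2)\<^sup>2 \<le> (\<Sum>i\<in>I. norm (T i x) * norm (T i (M x)))\<^sup>2"
    by (intro power_mono) auto
  also have "\<dots> \<le> (\<Sum>i\<in>I. (norm (T i x))\<^sup>2) * (\<Sum>i\<in>I. (norm (T i (M x)))\<^sup>2)"
    by (rule Cauchy_Schwarz_ineq_sum)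
  also have "\<dots> \<le> (C * (norm x)\<^sup>2) * (C * (norm (M x))\<^sup>2)"
    by (intro mult_mono le sum_nonneg) (use C in auto)
  finally have "(norm (M x) * norm (M x))\<^sup>2 \<le> (C * norm x * norm (M x))\<^sup>2"
    by (simp add: power2_eq_square algebra_simps)
  hence "norm (M x) * norm (M x) \<le> C * norm x * norm (M x)"
    using C by (simp add: power2_le_iff_abs_le)
  thus "norm (M x) \<le> C * norm x"
    using C by (cases "norm (M x) = 0") (auto simp: mult_le_cancel_right)
qed

lemma gram_sum_norm:
  assumes T: "\<And>i. i \<in> I \<Longrightarrow> T i \<in> cbop"
  shows "(\<Sum>i\<in>I. (norm (blinfun_apply (T i) x))\<^sup>2) \<le> norm (\<Sum>i\<in>I. adj (T i) \<circ>\<^sub>L T i) * (norm x)\<^sup>2"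
proof -
  define s where "s = (\<Sum>i\<in>I. (norm (T i x))\<^sup>2)"
  have "s \<ge> 0" by (simp add: s_def sum_nonneg)
  have "complex_of_real s = (\<Sum>i\<in>I. cinner (T i x) (T i x))"
    by (simp add: s_def cinner_self)
  also have "\<dots> = cinner ((\<Sum>i\<in>I. adj (T i) \<circ>\<^sub>L T i) x) x"
    unfolding blinfun.sum_left cinner_sum_left
    by (rule sum.cong) (simp_all add: adj_cinner'(1)[OF T])
  finally have "cmod (complex_of_real s) \<le> norm ((\<Sum>i\<in>I. adj (T i) \<circ>\<^sub>L T i) x) * norm x"
    by (simp only: cinner_Cauchy_Schwarz)
  also have "\<dots> \<le> norm (\<Sum>i\<in>I. adj (T i) \<circ>\<^sub>L T i) * norm x * norm x"
    by (intro mult_right_mono norm_blinfun) auto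
  finally show ?thesis using \<open>s \<ge> 0\<close> by (simp only: norm_of_real abs_of_nonneg s_def power2_eq_square mult.assoc)
qed

lemma amplify_column:
  fixes T :: "'i \<Rightarrow> 'a::chilbert_space \<Rightarrow>\<^sub>L 'b::chilbert_space"
    and u :: "('h::chilbert_space, 'a) htensor" and v :: "('a, 'h) htensor"
  assumes T: "\<And>i. i \<in> I \<Longrightarrow> T i \<in> cbop"
    and le: "\<And>x. (\<Sum>i\<in>I. (norm (blinfun_apply (T i) x))\<^sup>2) \<le> C * (norm x)\<^sup>2" and C: "C \<ge> 0"
  shows "(\<Sum>i\<in>I. (norm (blinfun_apply (id_blinfun \<otimes>\<^sub>o T i) u))\<^sup>2) \<le> C * (norm u)\<^sup>2"
    and "(\<Sum>i\<in>I. (norm (blinfun_apply (T i \<otimes>\<^sub>o id_blinfun) v))\<^sup>2) \<le> C * (norm v)\<^sup>2"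
proof -
  let ?I = "id_blinfun :: 'h \<Rightarrow>\<^sub>L 'h"
  let ?M = "\<Sum>i\<in>I. adj (T i) \<circ>\<^sub>L T i"
  have M: "?M \<in> cbop" using T by simp
  have nM: "norm ?M \<le> C" by (rule column_gram_norm[OF T le C])
  have "(\<Sum>i\<in>I. adj (?I \<otimes>\<^sub>o T i) \<circ>\<^sub>L (?I \<otimes>\<^sub>o T i)) = ?I \<otimes>\<^sub>o ?M"
    using T by (simp add: op_tensor_sum_right op_tensor_adj op_tensor_compose)
  hence 1: "norm (\<Sum>i\<in>I. adj (?I \<otimes>\<^sub>o T i) \<circ>\<^sub>L (?I \<otimes>\<^sub>o T i)) \<le> C"
    by (simp only:) (rule order_trans[OF norm_id_op_tensor_le[OF M] nM])
  show "(\<Sum>i\<in>I. (norm (blinfun_apply (?I \<otimes>\<^sub>o T i) u))\<^sup>2) \<le> C * (norm u)\<^sup>2"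
    by (rule order_trans[OF gram_sum_norm mult_right_mono[OF 1]]) (simp_all add: T)
  have "(\<Sum>i\<in>I. adj (T i \<otimes>\<^sub>o ?I) \<circ>\<^sub>L (T i \<otimes>\<^sub>o ?I)) = ?M \<otimes>\<^sub>o ?I"
    using T by (simp add: op_tensor_sum_left op_tensor_adj op_tensor_compose)
  hence 2: "norm (\<Sum>i\<in>I. adj (T i \<otimes>\<^sub>o ?I) \<circ>\<^sub>L (T i \<otimes>\<^sub>o ?I)) \<le> C"
    by (simp only:) (rule order_trans[OF norm_op_tensor_id_le[OF M] nM])
  show "(\<Sum>i\<in>I. (norm (blinfun_apply (T i \<otimes>\<^sub>o ?I) v))\<^sup>2) \<le> C * (norm v)\<^sup>2"
    by (rule order_trans[OF gram_sum_norm mult_right_mono[OF 2]]) (simp_all add: T)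
qed

section \<open>The full Fock space and multi-analytic operators\<close>

lemma cinner_fock_basis: "cinner (fock_basis \<alpha>) (fock_basis \<beta>) = (if \<alpha> = \<beta> then 1 else 0)"
  by (simp add: fock_basis_def cinner_single_single cinner_complex_def)

lemma norm_fock_basis [simp]: "norm (fock_basis \<alpha>) = 1"
  by (simp add: fock_basis_def)

lemma ell2_single_fock: "ell2_single \<alpha> c = c *\<^sub>C fock_basis \<alpha>"
  by (simp add: fock_basis_def flip: ell2_single_scaleC)

lemma fock_operator_eqI:
  assumes "R \<in> cbop" "R' \<in> cbop"
    and "\<And>\<alpha>. blinfun_apply R (fock_basis \<alpha>) = blinfun_apply R' (fock_basis \<alpha>)"
  shows "R = R'"
  by (rule ell2_operator_eqI)
     (simp add: ell2_single_fock cbop_scaleC[OF assms(1)] cbop_scaleC[OF assms(2)] assms(3))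

lemma fock_operator_exists:
  fixes j :: "'n list \<Rightarrow> 'c::chilbert_space"
  assumes "\<And>\<alpha> \<beta>. \<alpha> \<noteq> \<beta> \<Longrightarrow> cinner (j \<alpha>) (j \<beta>) = 0" "\<And>\<alpha>. norm (j \<alpha>) \<le> C" "C \<ge> 0"
  shows "\<exists>R. R \<in> cbop \<and> (\<forall>\<alpha>. blinfun_apply R (fock_basis \<alpha>) = j \<alpha>) \<and> norm R \<le> C"
proof -
  have bd: "cmod c * norm (j \<alpha>) \<le> C * cmod c" for c \<alpha>
    using mult_left_mono[OF assms(2) norm_ge_zero, of c \<alpha>] by (simp add: mult.commute)
  obtain R :: "'n fock \<Rightarrow>\<^sub>L 'c" where R: "R \<in> cbop" "\<And>\<alpha> c. blinfun_apply R (ell2_single \<alpha> c) = c *\<^sub>C j \<alpha>"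
    "norm R \<le> C"
    by (rule ell2_operator_exists[of "\<lambda>\<alpha> c. c *\<^sub>C j \<alpha>" C])
       (auto simp: scaleC_add_left scaleC_scaleC cinner_scaleC_left cinner_scaleC_right assms(1,3) bd)
  have "R (fock_basis \<alpha>) = j \<alpha>" for \<alpha> using R(2)[of \<alpha> 1] by (simp add: fock_basis_def)
  thus ?thesis using R by auto
qed

lemma creation: 
  shows creation_cbop [simp]: "creation i \<in> cbop"
    and creation_basis [simp]: "creation i (fock_basis \<alpha>) = fock_basis (i # \<alpha>)"
    and norm_creation_le: "norm (creation i) \<le> 1"
proof -
  have "\<exists>R. R \<in> cbop \<and> (\<forall>\<alpha>. blinfun_apply R (fock_basis \<alpha>) = fock_basis (i # \<alpha>)) \<and> norm R \<le> 1"
    by (rule fock_operator_exists) (auto simp: cinner_fock_basis)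
  then obtain R where R: "R \<in> cbop" "\<And>\<alpha>. blinfun_apply R (fock_basis \<alpha>) = fock_basis (i # \<alpha>)" "norm R \<le> 1"
    by blast
  have "creation i = R"
    unfolding creation_def
    by (rule the_equality) (auto simp: R intro: fock_operator_eqI)
  thus "creation i \<in> cbop" "creation i (fock_basis \<alpha>) = fock_basis (i # \<alpha>)" "norm (creation i) \<le> 1"
    using R by simp_all
qed

lemma word_op_simps [simp]:
  "word_op X [] = id_blinfun" "word_op X (i # \<alpha>) = X i \<circ>\<^sub>L word_op X \<alpha>"
  by (simp_all add: word_op_def)

lemma word_op_append: "word_op X (\<alpha> @ \<beta>) = word_op X \<alpha> \<circ>\<^sub>L word_op X \<beta>"
  by (induction \<alpha>) (simp_all add: compose_assoc)

lemma word_op_cbop [simp]: "(\<And>i. X i \<in> cbop) \<Longrightarrow> word_op X \<alpha> \<in> cbop"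
  by (induction \<alpha>) simp_all

lemma word_op_creation:
  "word_op (\<lambda>i. r *\<^sub>R creation i) \<alpha> (fock_basis \<beta>) = r ^ length \<alpha> *\<^sub>R fock_basis (\<alpha> @ \<beta>)"
  by (induction \<alpha>) (simp_all add: blinfun.bilinear_simps mult.commute)

definition right_shift :: "'n list \<Rightarrow> ('n fock \<Rightarrow>\<^sub>L 'n fock)" where
  "right_shift \<beta> = (SOME R. R \<in> cbop \<and> (\<forall>\<alpha>. blinfun_apply R (fock_basis \<alpha>) = fock_basis (\<alpha> @ \<beta>)))"

lemma right_shift:
  shows right_shift_cbop [simp]: "right_shift \<beta> \<in> cbop"
    and right_shift_basis [simp]: "right_shift \<beta> (fock_basis \<alpha>) = fock_basis (\<alpha> @ \<beta>)"
proof -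
  have "\<exists>R. R \<in> cbop \<and> (\<forall>\<alpha>. blinfun_apply R (fock_basis \<alpha>) = fock_basis (\<alpha> @ \<beta>)) \<and> norm R \<le> 1"
    by (rule fock_operator_exists) (auto simp: cinner_fock_basis)
  hence "\<exists>R. R \<in> cbop \<and> (\<forall>\<alpha>. blinfun_apply R (fock_basis \<alpha>) = fock_basis (\<alpha> @ \<beta>))" by blast
  from someI_ex[OF this] show "right_shift \<beta> \<in> cbop" "right_shift \<beta> (fock_basis \<alpha>) = fock_basis (\<alpha> @ \<beta>)"
    by (simp_all add: right_shift_def)
qed

text \<open>This operator relates a function at \<open>r S\<close> to its boundary function: on vacuum vectors the value at \<open>r S\<close> is
  the boundary function followed by it.\<close>

definition gauge_op :: "real \<Rightarrow> ('n fock \<Rightarrow>\<^sub>L 'n fock)" where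
  "gauge_op r = (SOME R. R \<in> cbop \<and> (\<forall>\<alpha>. blinfun_apply R (fock_basis \<alpha>) = r ^ length \<alpha> *\<^sub>R fock_basis \<alpha>)
     \<and> norm R \<le> 1)"

lemma gauge_op:
  assumes "0 \<le> r" "r \<le> 1"
  shows "gauge_op r \<in> cbop"
    and "gauge_op r (fock_basis \<alpha>) = r ^ length \<alpha> *\<^sub>R fock_basis \<alpha>"
    and "norm (gauge_op r :: 'n fock \<Rightarrow>\<^sub>L 'n fock) \<le> 1"
proof -
  have "\<exists>R. R \<in> cbop \<and> (\<forall>\<alpha>. blinfun_apply R (fock_basis \<alpha>) = r ^ length \<alpha> *\<^sub>R (fock_basis \<alpha> :: 'm fock))
      \<and> norm R \<le> 1"
    by (rule fock_operator_exists)
       (use assms in \<open>auto simp: scaleR_scaleC cinner_scaleC_left cinner_scaleC_right cinner_fock_basis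
          norm_power power_le_one\<close>)
  note * = someI_ex[OF this]
  show "gauge_op r \<in> cbop" "gauge_op r (fock_basis \<alpha>) = r ^ length \<alpha> *\<^sub>R fock_basis \<alpha>"
    "norm (gauge_op r :: 'n fock \<Rightarrow>\<^sub>L 'n fock) \<le> 1"
    unfolding gauge_op_def using * by blast+
qed

lemma subspace_closure:
  fixes W :: "'a::real_normed_vector set"
  assumes "subspace W" shows "subspace (closure W)"
proof (rule subspaceI)
  show "0 \<in> closure W" using closure_subset subspace_0[OF assms] by blast
  fix x y and c :: real assume xy: "x \<in> closure W"
  then obtain f where f: "\<And>n. f n \<in> W" "f \<longlonglongrightarrow> x"
    by (auto simp: closure_sequential)
  have "(\<lambda>n. c *\<^sub>R f n) \<longlonglongrightarrow> c *\<^sub>R x" by (intro tendsto_intros f)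
  moreover have "c *\<^sub>R f n \<in> W" for n using f subspace_scale[OF assms] by blast
  ultimately show "c *\<^sub>R x \<in> closure W"
    unfolding closure_sequential by (intro exI[of _ "\<lambda>n. c *\<^sub>R f n"]) simp
  assume "y \<in> closure W"
  then obtain g where g: "\<And>n. g n \<in> W" "g \<longlonglongrightarrow> y"
    by (auto simp: closure_sequential)
  have "(\<lambda>n. f n + g n) \<longlonglongrightarrow> x + y" by (intro tendsto_intros f g)
  moreover have "f n + g n \<in> W" for n using f g subspace_add[OF assms] by blast
  ultimately show "x + y \<in> closure W"
    unfolding closure_sequential by (intro exI[of _ "\<lambda>n. f n + g n"]) simp
qed

text \<open>The tensors \<open>e\<^sub>\<alpha> \<otimes> x\<close> serve as a test set because the vectors \<open>e\<^sub>\<alpha>\<close>, unlike the abstract basis used in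
  the construction of the tensor product, are the ones on which shifts are explicit.\<close>

lemma fock_tensor_total:
  "closure (span {fock_basis \<alpha> \<otimes>\<^sub>h x | \<alpha> x. True}) = (UNIV :: ('n fock, 'e::chilbert_space) htensor set)"
proof -
  define S :: "('n fock, 'e) htensor set" where "S = {fock_basis \<alpha> \<otimes>\<^sub>h x | \<alpha> x. True}"
  have "(f :: 'n fock) \<otimes>\<^sub>h (x :: 'e) \<in> closure (span S)" for f x
  proof -
    have "((\<lambda>\<alpha>. tensor_right x (ell2_single \<alpha> (Rep_ell2 f \<alpha>))) has_sum tensor_right x f) UNIV"
      by (rule has_sum_bounded_linear[OF blinfun.bounded_linear_right ell2_expansion])
    hence hs: "((\<lambda>\<alpha>. fock_basis \<alpha> \<otimes>\<^sub>h (Rep_ell2 f \<alpha> *\<^sub>C x)) has_sum f \<otimes>\<^sub>h x) UNIV"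
      by (simp add: ell2_single_fock tensor_scaleC_left tensor_scaleC_right)
    show ?thesis
    proof (rule Lim_in_closed_set[OF closed_closure])
      show "(sum (\<lambda>\<alpha>. fock_basis \<alpha> \<otimes>\<^sub>h (Rep_ell2 f \<alpha> *\<^sub>C x)) \<longlongrightarrow> f \<otimes>\<^sub>h x) (finite_subsets_at_top UNIV)"
        using hs by (simp add: has_sum_def)
      show "\<forall>\<^sub>F A in finite_subsets_at_top UNIV.
          (\<Sum>\<alpha>\<in>A. fock_basis \<alpha> \<otimes>\<^sub>h (Rep_ell2 f \<alpha> *\<^sub>C x)) \<in> closure (span S)"
        by (intro always_eventually allI subsetD[OF closure_subset] span_sum span_base)
           (auto simp: S_def)
    qed simp
  qed
  hence "{f \<otimes>\<^sub>h x | f x. True} \<subseteq> closure (span S)" by auto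
  hence "closure (span S) = UNIV"
    by (intro closed_subspace_UNIV[OF _ _ _ closure_span_tensor] subspace_closure subspace_span) auto
  thus ?thesis by (simp add: S_def)
qed

lemma fock_tensor_operator_eqI:
  fixes R R' :: "('n fock, 'e::chilbert_space) htensor \<Rightarrow>\<^sub>L 'c::chilbert_space"
  assumes "\<And>\<alpha> x. blinfun_apply R (fock_basis \<alpha> \<otimes>\<^sub>h x) = blinfun_apply R' (fock_basis \<alpha> \<otimes>\<^sub>h x)"
  shows "R = R'"
  by (rule total_blinfun_eqI[OF fock_tensor_total]) (auto simp: assms)

definition fock_coord :: "'n list \<Rightarrow> ('n fock, 'e::chilbert_space) htensor \<Rightarrow>\<^sub>L 'e" where
  "fock_coord \<alpha> = adj (tensor_left (fock_basis \<alpha>))"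

lemma fock_coord_cbop [simp]: "fock_coord \<alpha> \<in> cbop"
  by (simp add: fock_coord_def)

lemma fock_coord_basis [simp]: "fock_coord \<alpha> (fock_basis \<beta> \<otimes>\<^sub>h x) = (if \<alpha> = \<beta> then x else 0)"
  by (auto simp: fock_coord_def cinner_fock_basis)

lemma cinner_fock_coord: "cinner (fock_coord \<alpha> u) x = cinner u (fock_basis \<alpha> \<otimes>\<^sub>h x)"
  by (simp add: fock_coord_def adj_cinner')

text \<open>The finite partial sums are projections, hence equibounded, and on \<open>e\<^sub>\<beta> \<otimes> x\<close> they are eventually constant.\<close>

lemma fock_expansion:
  fixes u :: "('n fock, 'e::chilbert_space) htensor"
  shows "((\<lambda>\<alpha>. fock_basis \<alpha> \<otimes>\<^sub>h fock_coord \<alpha> u) has_sum u) UNIV"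
proof -
  define Q :: "'n list set \<Rightarrow> ('n fock, 'e) htensor \<Rightarrow>\<^sub>L ('n fock, 'e) htensor"
    where "Q S = (\<Sum>\<alpha>\<in>S. tensor_left (fock_basis \<alpha>) \<circ>\<^sub>L fock_coord \<alpha>)" for S
  have Q: "Q S u = (\<Sum>\<alpha>\<in>S. fock_basis \<alpha> \<otimes>\<^sub>h fock_coord \<alpha> u)" for S and u :: "('n fock, 'e) htensor"
    by (simp add: Q_def blinfun.sum_left)
  have "norm (Q S) \<le> 1" if "finite S" for S :: "'n list set"
  proof (rule norm_blinfun_bound)
    fix u :: "('n fock, 'e) htensor"
    define s where "s = (\<Sum>\<alpha>\<in>S. (norm (fock_coord \<alpha> u))\<^sup>2)"
    have s0: "s \<ge> 0" by (simp add: s_def sum_nonneg)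
    have "(norm (Q S u))\<^sup>2 = (\<Sum>\<alpha>\<in>S. (norm (fock_basis \<alpha> \<otimes>\<^sub>h fock_coord \<alpha> u))\<^sup>2)"
      unfolding Q by (rule norm_sum_orthogonal) (auto simp: that cinner_tensor cinner_fock_basis)
    hence s: "(norm (Q S u))\<^sup>2 = s" by (simp add: norm_tensor s_def)
    have "cinner u (Q S u) = (\<Sum>\<alpha>\<in>S. cinner (fock_coord \<alpha> u) (fock_coord \<alpha> u))"
      by (simp add: Q cinner_sum_right cinner_fock_coord)
    also have "\<dots> = complex_of_real s" by (simp add: cinner_self s_def)
    finally have "s \<le> norm u * norm (Q S u)"
      using cinner_Cauchy_Schwarz[of u "Q S u"] s0 by simp
    hence "norm (Q S u) * norm (Q S u) \<le> norm u * norm (Q S u)" by (simp flip: s add: power2_eq_square)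
    thus "norm (Q S u) \<le> 1 * norm u" by (cases "norm (Q S u) = 0") auto
  qed simp
  hence "\<forall>\<^sub>F S in finite_subsets_at_top UNIV. norm (Q S) \<le> 1"
    by (intro eventually_finite_subsets_at_top_weakI) auto
  moreover have "((\<lambda>S. Q S v) \<longlongrightarrow> id_blinfun v) (finite_subsets_at_top UNIV)"
    if "v \<in> {fock_basis \<alpha> \<otimes>\<^sub>h x | \<alpha> x. True}" for v
  proof -
    from that obtain \<beta> x where v: "v = fock_basis \<beta> \<otimes>\<^sub>h x" by auto
    have "Q S v = v" if "finite S" "\<beta> \<in> S" for S
    proof -
      have "Q S v = (\<Sum>\<alpha>\<in>S. if \<alpha> = \<beta> then v else 0)"
        unfolding Q by (rule sum.cong) (auto simp: v)
      thus ?thesis using that by simp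
    qed
    hence "\<forall>\<^sub>F S in finite_subsets_at_top UNIV. id_blinfun v = Q S v"
      unfolding eventually_finite_subsets_at_top by (intro exI[of _ "{\<beta>}"]) auto
    thus ?thesis by (rule Lim_transform_eventually[OF tendsto_const])
  qed
  ultimately have "((\<lambda>S. Q S u) \<longlongrightarrow> id_blinfun u) (finite_subsets_at_top UNIV)"
    by (rule tendsto_total[OF fock_tensor_total finite_subsets_at_top_neq_bot])
  thus ?thesis by (simp add: has_sum_def Q)
qed

lemma fock_coord_norm_has_sum:
  "((\<lambda>\<alpha>. (norm (fock_coord \<alpha> u))\<^sup>2) has_sum (norm u)\<^sup>2) UNIV"
  using orthogonal_norm_has_sum[OF _ fock_expansion, of u]
  by (simp add: cinner_tensor cinner_fock_basis norm_tensor)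

lemma fock_coord_eqI:
  assumes "\<And>\<alpha>. fock_coord \<alpha> u = fock_coord \<alpha> v"
  shows "u = v"
  using fock_expansion[of v] unfolding assms[symmetric]
  by (rule has_sum_unique[OF fock_expansion])

lemma fock_coord_gauge:
  assumes "0 \<le> r" "r \<le> 1"
  shows "fock_coord \<alpha> ((gauge_op r \<otimes>\<^sub>o id_blinfun) u) = r ^ length \<alpha> *\<^sub>R fock_coord \<alpha> u"
proof -
  have "fock_coord \<alpha> \<circ>\<^sub>L (gauge_op r \<otimes>\<^sub>o id_blinfun) = r ^ length \<alpha> *\<^sub>R fock_coord \<alpha>"
    by (rule fock_tensor_operator_eqI)
       (simp add: gauge_op[OF assms] blinfun.bilinear_simps scaleR_scaleC tensor_scaleC_left
          cbop_scaleC[OF fock_coord_cbop])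
  from arg_cong[OF this, of "\<lambda>S. blinfun_apply S u"] show ?thesis by (simp add: blinfun.scaleR_left)
qed

text \<open>Multi-analytic operators, the commutant of the right shifts, are determined by their action on the
  vacuum vectors.  Being a commutant, they are closed under products and inverses, and therefore under Moebius
  transforms with constant parameter.\<close>

definition multi_analytic ::
  "(('n fock, 'e::chilbert_space) htensor \<Rightarrow>\<^sub>L ('n fock, 'g::chilbert_space) htensor) \<Rightarrow> bool" where
  "multi_analytic T \<longleftrightarrow> T \<in> cbop \<and>
     (\<forall>\<beta>. T \<circ>\<^sub>L (right_shift \<beta> \<otimes>\<^sub>o id_blinfun) = (right_shift \<beta> \<otimes>\<^sub>o id_blinfun) \<circ>\<^sub>L T)"

definition fock_coeff ::
  "(('n fock, 'e::chilbert_space) htensor \<Rightarrow>\<^sub>L ('n fock, 'g::chilbert_space) htensor)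
    \<Rightarrow> 'n list \<Rightarrow> 'e \<Rightarrow>\<^sub>L 'g" where
  "fock_coeff T \<alpha> = fock_coord \<alpha> \<circ>\<^sub>L T \<circ>\<^sub>L tensor_left (fock_basis [])"

lemma multi_analytic_cbop: "multi_analytic T \<Longrightarrow> T \<in> cbop"
  by (simp add: multi_analytic_def)

lemma fock_coeff_cbop: "T \<in> cbop \<Longrightarrow> fock_coeff T \<alpha> \<in> cbop"
  by (simp add: fock_coeff_def)

lemma multi_analytic_apply:
  assumes "multi_analytic T"
  shows "T ((right_shift \<beta> \<otimes>\<^sub>o id_blinfun) u) = (right_shift \<beta> \<otimes>\<^sub>o id_blinfun) (T u)"
    and "T (fock_basis \<beta> \<otimes>\<^sub>h x) = (right_shift \<beta> \<otimes>\<^sub>o id_blinfun) (T (fock_basis [] \<otimes>\<^sub>h x))"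
proof -
  have eq: "T \<circ>\<^sub>L (right_shift \<beta> \<otimes>\<^sub>o id_blinfun) = (right_shift \<beta> \<otimes>\<^sub>o id_blinfun) \<circ>\<^sub>L T"
    using assms by (simp add: multi_analytic_def)
  show *: "T ((right_shift \<beta> \<otimes>\<^sub>o id_blinfun) u) = (right_shift \<beta> \<otimes>\<^sub>o id_blinfun) (T u)" for u
    using arg_cong[OF eq, of "\<lambda>S. blinfun_apply S u"] by simp
  show "T (fock_basis \<beta> \<otimes>\<^sub>h x) = (right_shift \<beta> \<otimes>\<^sub>o id_blinfun) (T (fock_basis [] \<otimes>\<^sub>h x))"
    using *[of "fock_basis [] \<otimes>\<^sub>h x"] by simp
qed

lemma multi_analytic_expansion:
  fixes T :: "('n fock, 'e::chilbert_space) htensor \<Rightarrow>\<^sub>L ('n fock, 'g::chilbert_space) htensor"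
  assumes "multi_analytic T"
  shows "((\<lambda>\<alpha>. fock_basis (\<alpha> @ \<beta>) \<otimes>\<^sub>h fock_coeff T \<alpha> x) has_sum T (fock_basis \<beta> \<otimes>\<^sub>h x)) UNIV"
  using has_sum_bounded_linear[OF blinfun.bounded_linear_right fock_expansion[of "T (fock_basis [] \<otimes>\<^sub>h x)"],
      of "right_shift \<beta> \<otimes>\<^sub>o id_blinfun"]
  by (simp add: multi_analytic_apply(2)[OF assms, of \<beta>] fock_coeff_def)

lemma multi_analytic_eqI:
  assumes "multi_analytic T" "multi_analytic T'" "\<And>\<alpha>. fock_coeff T \<alpha> = fock_coeff T' \<alpha>"
  shows "T = T'"
proof (rule fock_tensor_operator_eqI)
  fix \<beta> x
  show "T (fock_basis \<beta> \<otimes>\<^sub>h x) = T' (fock_basis \<beta> \<otimes>\<^sub>h x)"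
    using multi_analytic_expansion[OF assms(1), of \<beta> x] unfolding assms(3)
    by (rule has_sum_unique[OF _ multi_analytic_expansion[OF assms(2)]])
qed

text \<open>The coefficients applied to \<open>x\<close> are the coordinates of the image of the vacuum vector \<open>1 \<otimes> x\<close>.\<close>

lemma fock_coeff_column:
  fixes T :: "('n fock, 'e::chilbert_space) htensor \<Rightarrow>\<^sub>L ('n fock, 'g::chilbert_space) htensor"
  assumes "finite S"
  shows "(\<Sum>\<alpha>\<in>S. (norm (fock_coeff T \<alpha> x))\<^sup>2) \<le> (norm T)\<^sup>2 * (norm x)\<^sup>2"
proof -
  have "(\<Sum>\<alpha>\<in>S. (norm (fock_coeff T \<alpha> x))\<^sup>2) \<le> (norm (T (fock_basis [] \<otimes>\<^sub>h x)))\<^sup>2"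
    using has_sum_mono_neutral[OF has_sum_finite[OF assms]
        fock_coord_norm_has_sum[of "T (fock_basis [] \<otimes>\<^sub>h x)"], of "\<lambda>\<alpha>. (norm (fock_coeff T \<alpha> x))\<^sup>2"]
    by (simp add: fock_coeff_def)
  also have "\<dots> \<le> (norm T * norm x)\<^sup>2"
    using norm_blinfun[of T "fock_basis [] \<otimes>\<^sub>h x"] by (intro power_mono) (simp_all add: norm_tensor)
  finally show ?thesis by (simp add: power_mult_distrib)
qed

lemma multi_analytic_id_tensor:
  "A \<in> cbop \<Longrightarrow> multi_analytic (id_blinfun \<otimes>\<^sub>o A)"
  by (simp add: multi_analytic_def op_tensor_compose)

lemma multi_analytic_compose:
  assumes "multi_analytic S" "multi_analytic T"
  shows "multi_analytic (S \<circ>\<^sub>L T)"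
  unfolding multi_analytic_def
  using multi_analytic_apply(1)[OF assms(1)] multi_analytic_apply(1)[OF assms(2)] assms
  by (auto intro!: blinfun_eqI simp: multi_analytic_cbop)

lemma multi_analytic_diff:
  assumes "multi_analytic S" "multi_analytic T"
  shows "multi_analytic (S - T)"
  unfolding multi_analytic_def
  using multi_analytic_apply(1)[OF assms(1)] multi_analytic_apply(1)[OF assms(2)] assms
  by (auto intro!: blinfun_eqI simp: multi_analytic_cbop blinfun.bilinear_simps)

lemma multi_analytic_inverse:
  fixes T :: "('n fock, 'e::chilbert_space) htensor \<Rightarrow>\<^sub>L ('n fock, 'e) htensor"
  assumes "multi_analytic T" "norm T < 1"
  shows "multi_analytic (op_inv (id_blinfun - T))"
  unfolding multi_analytic_def
proof (intro conjI allI blinfun_eqI)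
  show "op_inv (id_blinfun - T) \<in> cbop"
    by (rule cbop_neumann_inverse[OF assms(2) multi_analytic_cbop[OF assms(1)]])
  fix \<beta> :: "'n list" and u
  let ?r = "right_shift \<beta> \<otimes>\<^sub>o (id_blinfun :: 'e \<Rightarrow>\<^sub>L 'e)"
  define v where "v = op_inv (id_blinfun - T) u"
  have "u = v - T v" using neumann_inverse_apply(2)[OF assms(2), of u] by (simp add: v_def)
  hence "?r u = ?r v - T (?r v)"
    by (simp add: blinfun.diff_right multi_analytic_apply(1)[OF assms(1)])
  hence "op_inv (id_blinfun - T) (?r u) = ?r v" by (simp add: neumann_inverse_apply(1)[OF assms(2)])
  thus "(op_inv (id_blinfun - T) \<circ>\<^sub>L ?r) u = (?r \<circ>\<^sub>L op_inv (id_blinfun - T)) u"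
    by (simp add: v_def)
qed

lemma multi_analytic_mobius:
  fixes T :: "('n fock, 'e::chilbert_space) htensor \<Rightarrow>\<^sub>L ('n fock, 'g::chilbert_space) htensor"
  assumes T: "multi_analytic T" "norm T \<le> 1" and A: "A \<in> cbop" "norm A < 1"
  shows "multi_analytic (mobius (id_blinfun \<otimes>\<^sub>o A) T)"
proof -
  have A': "adj A \<in> cbop" "norm (adj A) < 1" using A by simp_all
  let ?A = "id_blinfun \<otimes>\<^sub>o adj A :: ('n fock, 'g) htensor \<Rightarrow>\<^sub>L ('n fock, 'e) htensor"
  have "norm ?A < 1" using norm_id_op_tensor_le[OF A'(1)] A'(2) by (rule le_less_trans)
  hence "norm (T \<circ>\<^sub>L ?A) < 1" by (rule norm_compose_less_1(2)) (rule T(2))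
  thus ?thesis
    unfolding mobius_def op_tensor_adj[OF cbop_id A(1)] adj_id defect_id_tensor[OF A] defect_id_tensor[OF A']
    by (intro multi_analytic_diff multi_analytic_compose multi_analytic_inverse multi_analytic_id_tensor
        A(1) A' T(1) defect_properties(1)[OF A] defect_properties(1)[OF A'])
qed

section \<open>The noncommutative Poisson kernel\<close>

lemma isometry_cinner:
  fixes T :: "'a::chilbert_space \<Rightarrow>\<^sub>L 'b::chilbert_space"
  assumes "T \<in> cbop" "isometry_op T"
  shows "cinner (T x) (T y) = cinner x y"
proof -
  have n: "norm (T z) = norm z" for z using assms(2) by (simp add: isometry_op_def)
  have re: "Re (cinner (T x) (T y)) = Re (cinner x y)" for x y
  proof -
    have "inner (T x) (T y) = inner x y"
      unfolding dot_norm by (simp add: n flip: blinfun.add_right)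
    thus ?thesis by (simp add: inner_eq_Re_cinner)
  qed
  have "Re (cinner (T (\<i> *\<^sub>C x)) (T y)) = Re (cinner (\<i> *\<^sub>C x) y)" by (rule re)
  hence "Im (cinner (T x) (T y)) = Im (cinner x y)"
    by (simp add: cbop_scaleC[OF assms(1)] cinner_scaleC_left)
  thus ?thesis using re by (simp add: complex_eq_iff)
qed

lemma isometry_adj_compose:
  assumes "T \<in> cbop" "isometry_op T"
  shows "adj T \<circ>\<^sub>L T = id_blinfun"
proof (rule blinfun_eqI, rule cinner_eqI)
  fix x z
  show "cinner ((adj T \<circ>\<^sub>L T) x) z = cinner (id_blinfun x) z"
    by (simp add: adj_cinner'(1)[OF assms(1)] isometry_cinner[OF assms])
qed

subsection \<open>Summation over words\<close>

abbreviation words :: "nat \<Rightarrow> 'n list set" where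
  "words k \<equiv> {\<alpha>. length \<alpha> = k}"

lemma bij_betw_words: "bij_betw snd (SIGMA k:UNIV. words k) UNIV"
  by (rule bij_betwI[where g = "\<lambda>\<alpha>. (length \<alpha>, \<alpha>)"]) auto

lemma has_sum_words_sums:
  fixes f :: "'n list \<Rightarrow> 'a::banach"
  assumes "(f has_sum S) UNIV" "\<And>k. (f has_sum g k) (words k)"
  shows "g sums S"
proof -
  have "((\<lambda>p. f (snd p)) has_sum S) (SIGMA k:UNIV. words k)"
    using has_sum_reindex_bij_betw[OF bij_betw_words, of f S] assms(1) by simp
  hence "(g has_sum S) UNIV" by (rule has_sum_SigmaD) (simp add: assms(2))
  thus ?thesis by (rule has_sum_imp_sums)
qed

lemma sums_words_has_sum:
  fixes f :: "'n list \<Rightarrow> real"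
  assumes "g sums S" "\<And>k. (f has_sum g k) (words k)" "\<And>\<alpha>. f \<alpha> \<ge> 0"
  shows "(f has_sum S) UNIV"
proof -
  have g0: "g k \<ge> 0" for k using assms(2) by (rule has_sum_nonneg) (rule assms(3))
  have g: "(g has_sum S) UNIV" by (rule sums_nonneg_imp_has_sum[OF assms(1) g0])
  have "((\<lambda>p. f (snd p)) has_sum S) (SIGMA k:UNIV. words k)"
  proof (rule has_sum_SigmaI[OF _ g])
    show "(\<lambda>p. f (snd p)) summable_on (SIGMA k:UNIV. words k)"
      by (rule summable_on_SigmaI[OF _ has_sum_imp_summable[OF g]]) (simp_all add: assms)
  qed (simp add: assms)
  thus ?thesis using has_sum_reindex_bij_betw[OF bij_betw_words, of f S] by simp
qed

subsection \<open>The kernel and its amplification\<close>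

text \<open>The kernel \<open>K\<^sub>X\<close> amplified by the identity and rebracketed; the Poisson transform is compression by it.\<close>

definition poisson_embedding ::
  "('n::countable \<Rightarrow> 'h::chilbert_space \<Rightarrow>\<^sub>L 'h)
    \<Rightarrow> (('h, 'e::chilbert_space) htensor \<Rightarrow>\<^sub>L ('h, ('n fock, 'e) htensor) htensor)" where
  "poisson_embedding X = tensor_assoc \<circ>\<^sub>L (poisson_kernel X \<otimes>\<^sub>o id_blinfun)"

lemma fock_tensor2_operator_eqI:
  fixes R R' :: "('h::chilbert_space, ('n fock, 'e::chilbert_space) htensor) htensor \<Rightarrow>\<^sub>L 'c::chilbert_space"
  assumes "\<And>h \<alpha> x. blinfun_apply R (h \<otimes>\<^sub>h (fock_basis \<alpha> \<otimes>\<^sub>h x)) = blinfun_apply R' (h \<otimes>\<^sub>h (fock_basis \<alpha> \<otimes>\<^sub>h x))"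
  shows "R = R'"
proof (rule htensor_operator_eqI)
  fix h u
  have "R \<circ>\<^sub>L tensor_left h = R' \<circ>\<^sub>L tensor_left h"
    by (rule fock_tensor_operator_eqI) (simp add: assms)
  from arg_cong[OF this, of "\<lambda>S. blinfun_apply S u"] show "R (h \<otimes>\<^sub>h u) = R' (h \<otimes>\<^sub>h u)" by simp
qed

context
  fixes X :: "'n::countable \<Rightarrow> 'h::chilbert_space \<Rightarrow>\<^sub>L 'h" and R :: "('n, 'h) ell2 \<Rightarrow>\<^sub>L 'h"
  assumes X: "\<And>i. X i \<in> cbop" and R: "R \<in> cbop" "\<And>i h. blinfun_apply R (ell2_single i h) = X i h"
    "norm R < 1"
begin

lemma adj_row: "Rep_ell2 (adj R h) i = adj (X i) h"
  by (rule cinner_eqI) (simp add: cinner_ell2_single[symmetric] adj_cinner'(1) R X)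

lemma adj_row_norm: "((\<lambda>i. (norm (adj (X i) h))\<^sup>2) has_sum (norm (adj R h))\<^sup>2) UNIV"
  using has_sum_infsum[OF Rep_ell2_summable[of "adj R h"]] by (simp add: norm_ell2_power2 adj_row)

lemma row_defect_eq: "row_defect X = defect (adj R)"
proof -
  have "sot_has_sum (\<lambda>i. X i \<circ>\<^sub>L adj (X i)) (R \<circ>\<^sub>L adj R) UNIV"
    unfolding sot_has_sum_def
  proof
    fix h
    show "((\<lambda>i. (X i \<circ>\<^sub>L adj (X i)) h) has_sum (R \<circ>\<^sub>L adj R) h) UNIV"
      using has_sum_bounded_linear[OF blinfun.bounded_linear_right ell2_expansion[of "adj R h"], of R]
      by (simp add: R(2) adj_row)
  qed
  hence "(THE T. sot_has_sum (\<lambda>i. X i \<circ>\<^sub>L adj (X i)) T UNIV) = R \<circ>\<^sub>L adj R"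
    by (rule the_equality) (use \<open>sot_has_sum _ _ UNIV\<close> in
       \<open>auto intro!: blinfun_eqI intro: has_sum_unique simp: sot_has_sum_def\<close>)
  thus ?thesis using R(1) by (simp add: row_defect_def defect_def)
qed

lemma row_defect_props:
  shows "row_defect X \<in> cbop" "adj (row_defect X) = row_defect X"
    and "(norm (row_defect X h))\<^sup>2 = (norm h)\<^sup>2 - (norm (adj R h))\<^sup>2"
proof -
  have A: "adj R \<in> cbop" "norm (adj R) < 1" using R by simp_all
  note D = defect_properties[OF A]
  show "row_defect X \<in> cbop" "adj (row_defect X) = row_defect X" by (simp_all add: row_defect_eq D)
  have "cinner (defect (adj R) h) (defect (adj R) h) = cinner (h - R (adj R h)) h"
    using adj_cinner(2)[OF D(1), of "defect (adj R) h" h] R(1) by (simp add: D(2,4))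
  also have "\<dots> = cinner h h - cinner (adj R h) (adj R h)"
    by (simp add: cinner_diff_left adj_cinner(1)[OF R(1)])
  finally have "complex_of_real ((norm (row_defect X h))\<^sup>2) = of_real ((norm h)\<^sup>2 - (norm (adj R h))\<^sup>2)"
    by (simp add: cinner_self row_defect_eq)
  thus "(norm (row_defect X h))\<^sup>2 = (norm h)\<^sup>2 - (norm (adj R h))\<^sup>2" by (simp only: of_real_eq_iff)
qed

text \<open>Words of length \<open>k + 1\<close> are taken as \<open>\<alpha> i\<close>, with the new letter last, because
  \<open>(X\<^sub>\<alpha> X\<^sub>i)* = X\<^sub>i* X\<^sub>\<alpha>*\<close> lets the adjoint row act on the vectors \<open>X\<^sub>\<alpha>* h\<close>.\<close>

lemma word_row_step:
  assumes "((\<lambda>\<alpha>. (norm (adj R (adj (word_op X \<alpha>) h)))\<^sup>2) has_sum G) (words k)"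
  shows "((\<lambda>\<alpha>. (norm (adj (word_op X \<alpha>) h))\<^sup>2) has_sum G) (words (Suc k))"
proof -
  let ?W = "words k"
  define f where "f = (\<lambda>p. (norm (adj (word_op X (fst p @ [snd p])) h))\<^sup>2)"
  have row: "((\<lambda>i. f (\<alpha>, i)) has_sum (norm (adj R (adj (word_op X \<alpha>) h)))\<^sup>2) UNIV" for \<alpha>
    using adj_row_norm[of "adj (word_op X \<alpha>) h"] X by (simp add: f_def word_op_append)
  have "(f has_sum G) (?W \<times> UNIV)"
  proof (rule has_sum_SigmaI[OF row assms])
    show "f summable_on ?W \<times> UNIV"
      by (rule summable_on_SigmaI[OF row has_sum_imp_summable[OF assms]]) (simp add: f_def)
  qed
  moreover have "bij_betw (\<lambda>p. fst p @ [snd p]) (?W \<times> UNIV) (words (Suc k))"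
    by (rule bij_betwI[where g = "\<lambda>\<alpha>. (butlast \<alpha>, last \<alpha>)"]) (auto simp: length_Suc_conv_rev)
  ultimately show ?thesis
    using has_sum_reindex_bij_betw[of "\<lambda>p. fst p @ [snd p]" "?W \<times> UNIV" "words (Suc k)"
        "\<lambda>\<alpha>. (norm (adj (word_op X \<alpha>) h))\<^sup>2" G]
    by (simp add: f_def)
qed

lemma row_square_has_sum:
  assumes "((\<lambda>\<alpha>. (norm (u \<alpha>))\<^sup>2) has_sum a) W"
  shows "\<exists>b. ((\<lambda>\<alpha>. (norm (adj R (u \<alpha>)))\<^sup>2) has_sum b) W \<and> b \<le> (norm R)\<^sup>2 * a"
proof -
  have le: "(norm (adj R y))\<^sup>2 \<le> (norm R)\<^sup>2 * (norm y)\<^sup>2" for y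
    using power_mono[OF norm_blinfun[of "adj R" y], of 2] R(1) by (simp add: power_mult_distrib)
  have aR: "((\<lambda>\<alpha>. (norm R)\<^sup>2 * (norm (u \<alpha>))\<^sup>2) has_sum (norm R)\<^sup>2 * a) W"
    by (rule has_sum_cmult_right[OF assms])
  have "(\<lambda>\<alpha>. (norm (adj R (u \<alpha>)))\<^sup>2) summable_on W"
    by (rule summable_on_comparison_test[OF has_sum_imp_summable[OF aR]]) (simp_all add: le)
  then obtain b where b: "((\<lambda>\<alpha>. (norm (adj R (u \<alpha>)))\<^sup>2) has_sum b) W"
    by (auto simp: summable_on_def)
  have "b \<le> (norm R)\<^sup>2 * a" by (rule has_sum_mono[OF b aR le])
  with b show ?thesis by blast
qed

lemma word_row_bound:
  "\<exists>a. ((\<lambda>\<alpha>. (norm (adj (word_op X \<alpha>) h))\<^sup>2) has_sum a) (words k)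
     \<and> a \<le> (norm R)\<^sup>2 ^ k * (norm h)\<^sup>2"
proof (induction k)
  case 0
  show ?case by (intro exI[of _ "(norm h)\<^sup>2"]) (auto intro!: has_sum_finiteI)
next
  case (Suc k)
  then obtain a where a: "((\<lambda>\<alpha>. (norm (adj (word_op X \<alpha>) h))\<^sup>2) has_sum a) (words k)"
    "a \<le> (norm R)\<^sup>2 ^ k * (norm h)\<^sup>2" by blast
  from row_square_has_sum[OF a(1)]
  obtain b where b: "((\<lambda>\<alpha>. (norm (adj R (adj (word_op X \<alpha>) h)))\<^sup>2) has_sum b) (words k)"
    "b \<le> (norm R)\<^sup>2 * a" by blast
  note b(2)
  also have "\<dots> \<le> (norm R)\<^sup>2 * ((norm R)\<^sup>2 ^ k * (norm h)\<^sup>2)" by (intro mult_left_mono a) simp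
  finally show ?case using word_row_step[OF b(1)] by (intro exI[of _ b]) (simp add: mult.assoc)
qed

lemma word_row_finite:
  assumes "finite S" "S \<subseteq> words k"
  shows "(\<Sum>\<alpha>\<in>S. (norm (adj (word_op X \<alpha>) h))\<^sup>2) \<le> (norm R)\<^sup>2 ^ k * (norm h)\<^sup>2"
proof -
  obtain a where a: "((\<lambda>\<alpha>. (norm (adj (word_op X \<alpha>) h))\<^sup>2) has_sum a) (words k)"
    "a \<le> (norm R)\<^sup>2 ^ k * (norm h)\<^sup>2" using word_row_bound by blast
  have "(\<Sum>\<alpha>\<in>S. (norm (adj (word_op X \<alpha>) h))\<^sup>2) \<le> a"
    by (rule has_sum_mono_neutral[OF has_sum_finite[OF assms(1)] a(1)]) (use assms(2) in auto)
  thus ?thesis using a(2) by linarith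
qed

text \<open>The norms \<open>\<parallel>\<Delta> X\<^sub>\<alpha>* h\<parallel>\<^sup>2\<close> summed over words of length \<open>k\<close> telescope, since
  \<open>\<parallel>\<Delta> y\<parallel>\<^sup>2 = \<parallel>y\<parallel>\<^sup>2 - \<Sum> \<parallel>X\<^sub>i* y\<parallel>\<^sup>2\<close>; the remainder tends to zero because the row is a strict contraction.\<close>

lemma poisson_norm_has_sum:
  "((\<lambda>\<alpha>. (norm (row_defect X (adj (word_op X \<alpha>) h)))\<^sup>2) has_sum (norm h)\<^sup>2) UNIV"
proof -
  obtain a where a: "\<And>k. ((\<lambda>\<alpha>. (norm (adj (word_op X \<alpha>) h))\<^sup>2) has_sum a k) (words k)"
    "\<And>k. a k \<le> (norm R)\<^sup>2 ^ k * (norm h)\<^sup>2" using word_row_bound by metis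
  have a0: "a k \<ge> 0" for k using a(1)[of k] by (rule has_sum_nonneg) simp
  have aSuc: "((\<lambda>\<alpha>. (norm (adj R (adj (word_op X \<alpha>) h)))\<^sup>2) has_sum a (Suc k)) (words k)" for k
  proof -
    from row_square_has_sum[OF a(1)]
    obtain b where b: "((\<lambda>\<alpha>. (norm (adj R (adj (word_op X \<alpha>) h)))\<^sup>2) has_sum b) (words k)"
      by blast
    with has_sum_unique[OF word_row_step[OF b] a(1)] show ?thesis by simp
  qed
  have "(norm R)\<^sup>2 < 1" using R(3) by (simp add: abs_square_less_1)
  hence "(\<lambda>k. (norm R)\<^sup>2 ^ k * (norm h)\<^sup>2) \<longlonglongrightarrow> 0 * (norm h)\<^sup>2"
    by (intro tendsto_intros LIMSEQ_realpow_zero) auto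
  hence "a \<longlonglongrightarrow> 0"
    by (intro tendsto_sandwich[of "\<lambda>_. 0" a _ "\<lambda>k. (norm R)\<^sup>2 ^ k * (norm h)\<^sup>2"])
       (simp_all add: a0 a(2) always_eventually)
  hence "(\<lambda>k. a k - a (Suc k)) sums (a 0 - 0)" by (rule telescope_sums')
  moreover have "a 0 = (norm h)\<^sup>2"
    by (rule has_sum_unique[OF a(1)]) (auto intro!: has_sum_finiteI)
  ultimately have "(\<lambda>k. a k - a (Suc k)) sums (norm h)\<^sup>2" by simp
  moreover have "((\<lambda>\<alpha>. (norm (row_defect X (adj (word_op X \<alpha>) h)))\<^sup>2) has_sum (a k - a (Suc k))) (words k)" for k
    using has_sum_add[OF a(1)[of k] has_sum_cmult_right[OF aSuc[of k], of "- 1"]]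
    by (simp add: row_defect_props(3))
  ultimately show ?thesis by (rule sums_words_has_sum) simp
qed

lemma poisson_kernel:
  shows poisson_kernel_cbop: "poisson_kernel X \<in> cbop"
    and poisson_kernel_isometry: "isometry_op (poisson_kernel X)"
    and poisson_kernel_has_sum: "((\<lambda>\<alpha>. row_defect X (adj (word_op X \<alpha>) h) \<otimes>\<^sub>h fock_basis \<alpha>)
      has_sum poisson_kernel X h) UNIV"
proof -
  define f where "f h = (\<Sum>\<^sub>\<infinity>\<alpha>. row_defect X (adj (word_op X \<alpha>) h) \<otimes>\<^sub>h fock_basis \<alpha>)" for h
  have orth: "cinner (x \<otimes>\<^sub>h fock_basis \<alpha>) (y \<otimes>\<^sub>h fock_basis \<beta>) = 0" if "\<alpha> \<noteq> \<beta>"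
    for x y :: 'h and \<alpha> \<beta> :: "'n list"
    using that by (simp add: cinner_tensor cinner_fock_basis)
  have "(\<lambda>\<alpha>. row_defect X (adj (word_op X \<alpha>) h) \<otimes>\<^sub>h fock_basis \<alpha>) summable_on UNIV" for h
    by (rule orthogonal_summable)
       (simp_all add: orth norm_tensor has_sum_imp_summable[OF poisson_norm_has_sum])
  hence hs: "((\<lambda>\<alpha>. row_defect X (adj (word_op X \<alpha>) h) \<otimes>\<^sub>h fock_basis \<alpha>) has_sum f h) UNIV" for h
    by (simp add: f_def)
  have nf: "norm (f h) = norm h" for h
  proof -
    have "((\<lambda>\<alpha>. (norm (row_defect X (adj (word_op X \<alpha>) h)))\<^sup>2) has_sum (norm (f h))\<^sup>2) UNIV"
      using orthogonal_norm_has_sum[OF _ hs[of h]] by (simp add: orth norm_tensor)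
    from has_sum_unique[OF this poisson_norm_has_sum] show ?thesis by (simp add: power2_eq_iff_nonneg)
  qed
  have add: "f (h + h') = f h + f h'" for h h'
    by (rule has_sum_unique[OF hs])
       (use has_sum_add[OF hs[of h] hs[of h']] in \<open>simp add: blinfun.add_right tensor_add_left\<close>)
  have scl: "f (c *\<^sub>C h) = c *\<^sub>C f h" for c h
    by (rule has_sum_unique[OF hs])
       (use has_sum_bounded_linear[OF bounded_linear_scaleC hs[of h], of c] in
         \<open>simp add: X cbop_scaleC[OF row_defect_props(1)] cbop_scaleC[OF adj_cbop[OF word_op_cbop]]
           tensor_scaleC_left\<close>)
  have bd: "norm (f h) \<le> 1 * norm h" for h by (simp add: nf)
  obtain K where K: "K \<in> cbop" "\<And>h. blinfun_apply K h = f h"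
    using cbop_of_map[OF add scl bd zero_le_one] by blast
  have Kf: "blinfun_apply K = f" by (rule ext) (rule K(2))
  have "poisson_kernel X = K"
    unfolding poisson_kernel_def f_def[symmetric] Kf[symmetric] by (rule blinfun_apply_inverse)
  thus "poisson_kernel X \<in> cbop" "isometry_op (poisson_kernel X)"
    "((\<lambda>\<alpha>. row_defect X (adj (word_op X \<alpha>) h) \<otimes>\<^sub>h fock_basis \<alpha>) has_sum poisson_kernel X h) UNIV"
    using K hs by (simp_all add: isometry_op_def nf)
qed

lemma adj_poisson_kernel:
  "adj (poisson_kernel X) (h \<otimes>\<^sub>h fock_basis \<alpha>) = word_op X \<alpha> (row_defect X h)"
proof (rule cinner_eqI)
  fix h'
  have "((\<lambda>\<beta>. cinner (h \<otimes>\<^sub>h fock_basis \<alpha>) (row_defect X (adj (word_op X \<beta>) h') \<otimes>\<^sub>h fock_basis \<beta>)) has_sum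
      cinner (h \<otimes>\<^sub>h fock_basis \<alpha>) (poisson_kernel X h')) UNIV"
    by (rule has_sum_bounded_linear[OF bounded_linear_cinner_right poisson_kernel_has_sum])
  moreover have "((\<lambda>\<beta>. cinner (h \<otimes>\<^sub>h fock_basis \<alpha>) (row_defect X (adj (word_op X \<beta>) h') \<otimes>\<^sub>h fock_basis \<beta>)) has_sum
      cinner h (row_defect X (adj (word_op X \<alpha>) h'))) UNIV"
    by (rule has_sum_finite_neutralI[of "{\<alpha>}"]) (auto simp: cinner_tensor cinner_fock_basis)
  ultimately have "cinner (h \<otimes>\<^sub>h fock_basis \<alpha>) (poisson_kernel X h') = cinner h (row_defect X (adj (word_op X \<alpha>) h'))"
    by (rule has_sum_unique)
  also have "\<dots> = cinner (word_op X \<alpha> (row_defect X h)) h'"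
    using adj_cinner(1)[OF row_defect_props(1), of h "adj (word_op X \<alpha>) h'"]
    by (simp add: row_defect_props(2) adj_cinner'(2)[OF word_op_cbop[OF X]])
  finally show "cinner (adj (poisson_kernel X) (h \<otimes>\<^sub>h fock_basis \<alpha>)) h' = cinner (word_op X \<alpha> (row_defect X h)) h'"
    by (simp add: adj_cinner'(1)[OF poisson_kernel_cbop])
qed

lemma adj_poisson_embedding:
  "adj (poisson_embedding X) (h \<otimes>\<^sub>h (fock_basis \<alpha> \<otimes>\<^sub>h x)) = word_op X \<alpha> (row_defect X h) \<otimes>\<^sub>h x"
  by (simp add: poisson_embedding_def poisson_kernel_cbop op_tensor_adj adj_poisson_kernel)

lemma poisson_embedding_isometry: "adj (poisson_embedding X) \<circ>\<^sub>L poisson_embedding X = id_blinfun"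
proof -
  let ?K = "poisson_kernel X \<otimes>\<^sub>o id_blinfun"
  have "adj (poisson_embedding X) \<circ>\<^sub>L poisson_embedding X = adj ?K \<circ>\<^sub>L (adj tensor_assoc \<circ>\<^sub>L tensor_assoc) \<circ>\<^sub>L ?K"
    by (simp only: poisson_embedding_def adj_compose tensor_assoc_cbop op_tensor_cbop
        poisson_kernel_cbop cbop_id compose_assoc)
  also have "\<dots> = id_blinfun"
    by (simp add: poisson_kernel_cbop op_tensor_adj op_tensor_compose
        isometry_adj_compose[OF poisson_kernel_cbop poisson_kernel_isometry])
  finally show ?thesis .
qed

text \<open>The sum of \<open>X\<^sub>\<alpha> \<otimes> A\<^sub>\<alpha>\<close> is a row of operators \<open>X\<^sub>\<alpha> \<otimes> I\<close> times a column of operators \<open>I \<otimes> A\<^sub>\<alpha>\<close>.  The row has norm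
  at most \<open>\<parallel>R\<parallel>\<^sup>k\<close>, since the adjoint row does.\<close>

lemma homogeneous_partial_sum:
  fixes A :: "'n list \<Rightarrow> 'e::chilbert_space \<Rightarrow>\<^sub>L 'g::chilbert_space"
  assumes "finite S" "S \<subseteq> words k" "\<And>\<alpha>. A \<alpha> \<in> cbop"
  shows "(norm (\<Sum>\<alpha>\<in>S. (word_op X \<alpha> \<otimes>\<^sub>o A \<alpha>) v))\<^sup>2
    \<le> (norm R)\<^sup>2 ^ k * (\<Sum>\<alpha>\<in>S. (norm (((id_blinfun :: 'h \<Rightarrow>\<^sub>L 'h) \<otimes>\<^sub>o A \<alpha>) v))\<^sup>2)"
proof -
  let ?B = "\<lambda>\<alpha>. (id_blinfun :: 'h \<Rightarrow>\<^sub>L 'h) \<otimes>\<^sub>o A \<alpha>"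
  let ?Y = "\<lambda>\<alpha>. adj (word_op X \<alpha>) \<otimes>\<^sub>o (id_blinfun :: 'g \<Rightarrow>\<^sub>L 'g)"
  have W: "word_op X \<alpha> \<in> cbop" for \<alpha> using X by simp
  define w where "w = (\<Sum>\<alpha>\<in>S. (word_op X \<alpha> \<otimes>\<^sub>o A \<alpha>) v)"
  define q where "q = (\<Sum>\<alpha>\<in>S. (norm (?B \<alpha> v))\<^sup>2)"
  have q0: "q \<ge> 0" by (simp add: q_def sum_nonneg)
  have "(word_op X \<alpha> \<otimes>\<^sub>o A \<alpha>) v = adj (?Y \<alpha>) (?B \<alpha> v)" for \<alpha>
  proof -
    have "word_op X \<alpha> \<otimes>\<^sub>o A \<alpha> = adj (?Y \<alpha>) \<circ>\<^sub>L ?B \<alpha>"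
      by (simp add: op_tensor_adj op_tensor_compose W assms(3))
    thus ?thesis by simp
  qed
  hence "cinner w w = (\<Sum>\<alpha>\<in>S. cinner (?B \<alpha> v) (?Y \<alpha> w))"
    unfolding w_def[THEN arg_cong, of "\<lambda>z. cinner z w"] cinner_sum_left
    by (simp add: adj_cinner'(1) W)
  hence "(norm w)\<^sup>2 = cmod (\<Sum>\<alpha>\<in>S. cinner (?B \<alpha> v) (?Y \<alpha> w))"
    by (simp flip: \<open>cinner w w = _\<close> add: cinner_self norm_power)
  also have "\<dots> \<le> (\<Sum>\<alpha>\<in>S. norm (?B \<alpha> v) * norm (?Y \<alpha> w))"
    by (intro sum_norm_le cinner_Cauchy_Schwarz)
  finally have "((norm w)\<^sup>2)\<^sup>2 \<le> (\<Sum>\<alpha>\<in>S. norm (?B \<alpha> v) * norm (?Y \<alpha> w))\<^sup>2"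
    by (intro power_mono) auto
  also have "\<dots> \<le> q * (\<Sum>\<alpha>\<in>S. (norm (?Y \<alpha> w))\<^sup>2)"
    unfolding q_def by (rule Cauchy_Schwarz_ineq_sum)
  also have "\<dots> \<le> q * ((norm R)\<^sup>2 ^ k * (norm w)\<^sup>2)"
    by (rule mult_left_mono[OF amplify_column(2) q0]) (simp_all add: W word_row_finite[OF assms(1,2)])
  finally have le: "(norm w)\<^sup>2 * (norm w)\<^sup>2 \<le> ((norm R)\<^sup>2 ^ k * q) * (norm w)\<^sup>2"
    unfolding power2_eq_square[of "(norm w)\<^sup>2"] by (simp only: mult_ac)
  have "(norm w)\<^sup>2 \<le> (norm R)\<^sup>2 ^ k * q"
  proof (cases "w = 0")
    case True thus ?thesis using q0 by simp
  next
    case False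
    hence "0 < (norm w)\<^sup>2" by simp
    with le show ?thesis by (rule mult_right_le_imp_le)
  qed
  thus ?thesis by (simp add: w_def q_def)
qed

lemma homogeneous_part_exists:
  fixes A :: "'n list \<Rightarrow> 'e::chilbert_space \<Rightarrow>\<^sub>L 'g::chilbert_space"
  assumes A: "\<And>\<alpha>. A \<alpha> \<in> cbop" and C: "C \<ge> 0"
    and col: "\<And>S x. finite S \<Longrightarrow> (\<Sum>\<alpha>\<in>S. (norm (blinfun_apply (A \<alpha>) x))\<^sup>2) \<le> C\<^sup>2 * (norm x)\<^sup>2"
  shows "\<exists>P. sot_has_sum (\<lambda>\<alpha>. word_op X \<alpha> \<otimes>\<^sub>o A \<alpha>) P (words k) \<and> norm P \<le> norm R ^ k * C"
proof -
  let ?B = "\<lambda>\<alpha>. (id_blinfun :: 'h \<Rightarrow>\<^sub>L 'h) \<otimes>\<^sub>o A \<alpha>"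
  let ?W = "words k"
  define f where "f v = (\<Sum>\<^sub>\<infinity>\<alpha>\<in>?W. (word_op X \<alpha> \<otimes>\<^sub>o A \<alpha>) v)" for v
  have Bcol: "(\<Sum>\<alpha>\<in>S. (norm (?B \<alpha> v))\<^sup>2) \<le> C\<^sup>2 * (norm v)\<^sup>2" if "finite S" for S v
    by (rule amplify_column(1)) (simp_all add: A col that)
  have sB: "(\<lambda>\<alpha>. (norm (?B \<alpha> v))\<^sup>2) summable_on ?W" for v
    by (rule nonneg_bdd_above_summable_on) (use Bcol in \<open>auto intro!: bdd_aboveI2\<close>)
  note sq = summable_on_square_bound[OF sB _ homogeneous_partial_sum[OF _ _ A]]
  have hs: "((\<lambda>\<alpha>. (word_op X \<alpha> \<otimes>\<^sub>o A \<alpha>) v) has_sum f v) ?W" for v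
    unfolding f_def by (rule has_sum_infsum, rule sq(1)) simp_all
  have bd: "norm (f v) \<le> (norm R ^ k * C) * norm v" for v
  proof (rule power2_le_imp_le)
    have "(norm (f v))\<^sup>2 \<le> (norm R)\<^sup>2 ^ k * (\<Sum>\<^sub>\<infinity>\<alpha>\<in>?W. (norm (?B \<alpha> v))\<^sup>2)"
      unfolding f_def by (rule sq(2)) simp_all
    also have "\<dots> \<le> (norm R)\<^sup>2 ^ k * (C\<^sup>2 * (norm v)\<^sup>2)"
      by (intro mult_left_mono infsum_le_finite_sums sB Bcol) auto
    finally show "(norm (f v))\<^sup>2 \<le> (norm R ^ k * C * norm v)\<^sup>2"
      by (simp add: power_mult_distrib power_mult[symmetric] mult.commute mult.left_commute)
  qed (use C in simp)
  have add: "f (u + v) = f u + f v" for u v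
    by (rule has_sum_unique[OF hs]) (use has_sum_add[OF hs[of u] hs[of v]] in \<open>simp add: blinfun.add_right\<close>)
  have scl: "f (c *\<^sub>C v) = c *\<^sub>C f v" for c v
    by (rule has_sum_unique[OF hs])
       (use has_sum_bounded_linear[OF bounded_linear_scaleC hs[of v], of c] in
         \<open>simp add: cbop_scaleC[OF op_tensor_cbop[OF word_op_cbop[OF X] A]]\<close>)
  obtain P where P: "\<And>v. blinfun_apply P v = f v" "norm P \<le> norm R ^ k * C"
    using cbop_of_map[OF add scl bd mult_nonneg_nonneg[OF zero_le_power[OF norm_ge_zero] C]] by blast
  show ?thesis
    by (rule exI[of _ P]) (simp add: sot_has_sum_def P hs)
qed

text \<open>On \<open>h \<otimes> e\<^sub>\<beta> \<otimes> x\<close> both sides of the intertwining relation are sums of \<open>X\<^sub>\<alpha> X\<^sub>\<beta> \<Delta> h \<otimes> T\<^sub>\<alpha> x\<close>: over all words on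
  the right, by continuity, and grouped by length on the left.\<close>

lemma poisson_value_exists:
  fixes T :: "('n fock, 'e::chilbert_space) htensor \<Rightarrow>\<^sub>L ('n fock, 'g::chilbert_space) htensor"
  assumes T: "multi_analytic T"
  shows "\<exists>V. fh_has_value (fock_coeff T) X V \<and>
    V \<circ>\<^sub>L adj (poisson_embedding X) = adj (poisson_embedding X) \<circ>\<^sub>L (id_blinfun \<otimes>\<^sub>o T)"
proof -
  have Tc: "T \<in> cbop" by (rule multi_analytic_cbop[OF T])
  have "\<exists>P. \<forall>k. sot_has_sum (\<lambda>\<alpha>. word_op X \<alpha> \<otimes>\<^sub>o fock_coeff T \<alpha>) (P k) (words k)
      \<and> norm (P k) \<le> norm R ^ k * norm T"
    by (intro choice allI homogeneous_part_exists fock_coeff_cbop Tc fock_coeff_column) auto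
  then obtain P where P: "\<And>k. sot_has_sum (\<lambda>\<alpha>. word_op X \<alpha> \<otimes>\<^sub>o fock_coeff T \<alpha>) (P k) (words k)"
    "\<And>k. norm (P k) \<le> norm R ^ k * norm T" by blast
  have "summable (\<lambda>k. norm R ^ k * norm T)"
    by (intro summable_mult2 summable_geometric) (use R(3) in simp)
  hence "summable P" by (rule summable_comparison_test'[where N = 0]) (rule P(2))
  then obtain V where V: "P sums V" by (auto simp: summable_def)
  have "V \<circ>\<^sub>L adj (poisson_embedding X) = adj (poisson_embedding X) \<circ>\<^sub>L (id_blinfun \<otimes>\<^sub>o T)"
  proof (rule fock_tensor2_operator_eqI)
    fix h \<beta> and x :: 'e
    define y where "y = word_op X \<beta> (row_defect X h) \<otimes>\<^sub>h x"
    define z where "z = adj (poisson_embedding X) (h \<otimes>\<^sub>h T (fock_basis \<beta> \<otimes>\<^sub>h x))"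
    have "((\<lambda>\<alpha>. (adj (poisson_embedding X) \<circ>\<^sub>L tensor_left h) (fock_basis (\<alpha> @ \<beta>) \<otimes>\<^sub>h fock_coeff T \<alpha> x))
        has_sum (adj (poisson_embedding X) \<circ>\<^sub>L tensor_left h) (T (fock_basis \<beta> \<otimes>\<^sub>h x))) UNIV"
      by (rule has_sum_bounded_linear[OF blinfun.bounded_linear_right multi_analytic_expansion[OF T]])
    hence "((\<lambda>\<alpha>. (word_op X \<alpha> \<otimes>\<^sub>o fock_coeff T \<alpha>) y) has_sum z) UNIV"
      by (simp add: adj_poisson_embedding z_def y_def word_op_append X fock_coeff_cbop[OF Tc])
    moreover have "((\<lambda>\<alpha>. (word_op X \<alpha> \<otimes>\<^sub>o fock_coeff T \<alpha>) y) has_sum P k y) (words k)" for k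
      using P(1)[of k] by (simp add: sot_has_sum_def)
    ultimately have "(\<lambda>k. P k y) sums z" by (rule has_sum_words_sums)
    moreover have "(\<lambda>k. P k y) sums V y"
      by (rule bounded_linear.sums[OF blinfun.bounded_linear_left V])
    ultimately have "V y = z" by (simp add: sums_unique2)
    thus "(V \<circ>\<^sub>L adj (poisson_embedding X)) (h \<otimes>\<^sub>h fock_basis \<beta> \<otimes>\<^sub>h x)
        = (adj (poisson_embedding X) \<circ>\<^sub>L (id_blinfun \<otimes>\<^sub>o T)) (h \<otimes>\<^sub>h fock_basis \<beta> \<otimes>\<^sub>h x)"
      by (simp add: adj_poisson_embedding y_def z_def Tc)
  qed
  thus ?thesis using P(1) V by (auto simp: fh_has_value_def)
qed

end

lemma fh_has_value_unique:
  assumes "fh_has_value A X V" "fh_has_value A X V'"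
  shows "V = V'"
proof -
  from assms obtain P P' where
    P: "\<And>k. sot_has_sum (\<lambda>\<alpha>. word_op X \<alpha> \<otimes>\<^sub>o A \<alpha>) (P k) (words k)" "P sums V" and
    P': "\<And>k. sot_has_sum (\<lambda>\<alpha>. word_op X \<alpha> \<otimes>\<^sub>o A \<alpha>) (P' k) (words k)" "P' sums V'"
    by (auto simp: fh_has_value_def)
  have "P k = P' k" for k
    by (rule blinfun_eqI) (use P(1)[of k] P'(1)[of k] in \<open>auto simp: sot_has_sum_def intro: has_sum_unique\<close>)
  hence "P = P'" by blast
  thus ?thesis using P(2) P'(2) by (simp add: sums_unique2)
qed

text \<open>The functional calculus: the range of the Poisson embedding is co-invariant for \<open>I \<otimes> T\<close>, and the
  compression of \<open>I \<otimes> T\<close> to it is the value at \<open>X\<close> of the series with the Fock coefficients of \<open>T\<close>.\<close>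

lemma poisson_calculus:
  fixes X :: "'n::countable \<Rightarrow> 'h::chilbert_space \<Rightarrow>\<^sub>L 'h"
    and T :: "('n fock, 'e::chilbert_space) htensor \<Rightarrow>\<^sub>L ('n fock, 'g::chilbert_space) htensor"
  assumes X: "X \<in> row_ball" and T: "multi_analytic T"
  shows "fh_has_value (fock_coeff T) X (poisson_transform X T)"
    and "poisson_transform X T \<circ>\<^sub>L adj (poisson_embedding X) = adj (poisson_embedding X) \<circ>\<^sub>L (id_blinfun \<otimes>\<^sub>o T)"
proof -
  from X obtain R :: "('n, 'h) ell2 \<Rightarrow>\<^sub>L 'h" where R: "\<And>i. X i \<in> cbop" "R \<in> cbop"
    "\<And>i h. blinfun_apply R (ell2_single i h) = X i h" "norm R < 1"
    unfolding row_ball_def by blast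
  obtain V where V: "fh_has_value (fock_coeff T) X V"
    "V \<circ>\<^sub>L adj (poisson_embedding X) = adj (poisson_embedding X) \<circ>\<^sub>L (id_blinfun \<otimes>\<^sub>o T)"
    using poisson_value_exists[OF R T] by blast
  have "poisson_transform X T = adj (poisson_embedding X) \<circ>\<^sub>L (id_blinfun \<otimes>\<^sub>o T) \<circ>\<^sub>L poisson_embedding X"
    by (simp add: poisson_transform_def poisson_embedding_def)
  also have "\<dots> = V \<circ>\<^sub>L (adj (poisson_embedding X) \<circ>\<^sub>L poisson_embedding X)"
    by (simp add: V(2)[symmetric] compose_assoc)
  also have "\<dots> = V" by (simp add: poisson_embedding_isometry[OF R])
  finally show "fh_has_value (fock_coeff T) X (poisson_transform X T)"
    "poisson_transform X T \<circ>\<^sub>L adj (poisson_embedding X) = adj (poisson_embedding X) \<circ>\<^sub>L (id_blinfun \<otimes>\<^sub>o T)"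
    using V by simp_all
qed

lemma poisson_embedding_left_inverse:
  assumes "X \<in> row_ball"
  shows "adj (poisson_embedding X) \<circ>\<^sub>L poisson_embedding X = id_blinfun"
proof -
  from assms obtain R where R: "\<And>i. X i \<in> cbop" "R \<in> cbop"
    "\<And>i h. blinfun_apply R (ell2_single i h) = X i h" "norm R < 1"
    unfolding row_ball_def by blast
  show ?thesis by (rule poisson_embedding_isometry[OF R])
qed

section \<open>Boundary functions\<close>

text \<open>Spans are real, so a finite orthonormal basis \<open>B\<close> would yield the finite spanning set \<open>B \<union> \<i> B\<close>.\<close>

lemma infinite_onb:
  assumes "\<not> (\<exists>B. finite B \<and> span B = (UNIV :: 'h::chilbert_space set))"
  shows "infinite (onb :: 'h set)"
proof
  assume fin: "finite (onb :: 'h set)"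
  define B where "B = onb \<union> (\<lambda>b. \<i> *\<^sub>C b) ` (onb :: 'h set)"
  have "x \<in> span B" for x
  proof -
    have eq: "(\<Sum>b\<in>onb. cinner x b *\<^sub>C b) = x"
      using has_sum_unique[OF has_sum_finite[OF fin] onb_expansion[OF is_onb_onb]] .
    have "c *\<^sub>C b \<in> span B" if "b \<in> onb" for c b
    proof -
      have "Re c *\<^sub>R b + Im c *\<^sub>R (\<i> *\<^sub>C b) = (of_real (Re c) + of_real (Im c) * \<i>) *\<^sub>C b"
        by (simp add: scaleR_scaleC scaleC_scaleC scaleC_add_left)
      also have "of_real (Re c) + of_real (Im c) * \<i> = c" by (simp add: complex_eq_iff)
      finally have "c *\<^sub>C b = Re c *\<^sub>R b + Im c *\<^sub>R (\<i> *\<^sub>C b)" by (rule sym)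
      moreover have "b \<in> B" "\<i> *\<^sub>C b \<in> B" using that by (auto simp: B_def)
      ultimately show ?thesis by (simp only: span_add span_scale span_base)
    qed
    hence "(\<Sum>b\<in>onb. cinner x b *\<^sub>C b) \<in> span B" by (intro span_sum)
    thus ?thesis unfolding eq .
  qed
  hence "span B = UNIV" by blast
  moreover have "finite B" using fin by (simp add: B_def)
  ultimately show False using assms by blast
qed

lemma fock_cinner_eqI:
  fixes u v :: "'n fock"
  assumes "\<And>\<beta>. cinner u (fock_basis \<beta>) = cinner v (fock_basis \<beta>)"
  shows "u = v"
proof -
  have "cinner w (fock_basis \<beta>) = Rep_ell2 w \<beta>" for w :: "'n fock" and \<beta>
    by (simp add: fock_basis_def cinner_ell2_single cinner_complex_def)
  hence "Rep_ell2 u = Rep_ell2 v" using assms by (intro ext) simp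
  thus ?thesis by (simp add: Rep_ell2_inject)
qed

lemma fock_embedding_exists:
  assumes "\<not> (\<exists>B. finite B \<and> span B = (UNIV :: 'h::chilbert_space set))"
  obtains J :: "'n::countable fock \<Rightarrow>\<^sub>L 'h::chilbert_space" where "J \<in> cbop" "adj J \<circ>\<^sub>L J = id_blinfun" "norm J \<le> 1"
proof -
  from infinite_countable_subset[OF infinite_onb[OF assms]]
  obtain f :: "nat \<Rightarrow> 'h" where f: "inj f" "range f \<subseteq> onb" by blast
  have on: "orthonormal (onb :: 'h set)" using is_onb_onb unfolding is_onb_def by blast
  define j where "j \<alpha> = f (to_nat \<alpha>)" for \<alpha> :: "'n list"
  have j: "j \<alpha> \<in> onb" for \<alpha> using f(2) by (auto simp: j_def)
  have j_orth: "cinner (j \<alpha>) (j \<beta>) = (if \<alpha> = \<beta> then 1 else 0)" for \<alpha> \<beta>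
    using on j f(1) by (auto simp: orthonormal_def j_def inj_eq cinner_self)
  have "\<exists>J. J \<in> cbop \<and> (\<forall>\<alpha>. blinfun_apply J (fock_basis \<alpha>) = j \<alpha>) \<and> norm J \<le> 1"
    by (rule fock_operator_exists) (use on j in \<open>auto simp: j_orth orthonormal_def\<close>)
  then obtain J where J: "J \<in> cbop" "\<And>\<alpha>. blinfun_apply J (fock_basis \<alpha>) = j \<alpha>" "norm J \<le> 1" by blast
  have "adj J \<circ>\<^sub>L J = id_blinfun"
    by (rule fock_operator_eqI)
       (auto simp: J(1,2) adj_cinner'(1)[OF J(1)] j_orth cinner_fock_basis intro!: fock_cinner_eqI)
  thus ?thesis using that J by blast
qed

lemma creation_orthogonal:
  assumes "i \<noteq> j"
  shows "cinner (creation i u) (creation j v) = 0"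
proof -
  have "adj (creation j) \<circ>\<^sub>L creation i = 0"
    by (rule fock_operator_eqI)
       (auto simp: adj_cinner'(1) cinner_fock_basis assms intro!: fock_cinner_eqI)
  from arg_cong[OF this, of "\<lambda>S. blinfun_apply S u"] have "adj (creation j) (creation i u) = 0" by simp
  thus ?thesis by (simp add: adj_cinner(2)[OF creation_cbop])
qed

lemma compressed_shift_row_ball:
  fixes J :: "'n::countable fock \<Rightarrow>\<^sub>L 'h::chilbert_space"
  assumes J: "J \<in> cbop" "adj J \<circ>\<^sub>L J = id_blinfun" "norm J \<le> 1" and r: "0 \<le> r" "r < 1"
  shows "(\<lambda>i. J \<circ>\<^sub>L (r *\<^sub>R creation i) \<circ>\<^sub>L adj J) \<in> row_ball"
proof -
  define Z where "Z i = J \<circ>\<^sub>L (r *\<^sub>R creation i) \<circ>\<^sub>L adj J" for i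
  have Z: "Z i \<in> cbop" for i using J by (simp add: Z_def)
  have "norm (r *\<^sub>R creation i :: 'n fock \<Rightarrow>\<^sub>L 'n fock) \<le> r" for i
    using mult_left_mono[OF norm_creation_le[of i] r(1)] r by simp
  hence "norm (Z i) \<le> 1 * r * 1" for i
    unfolding Z_def by (intro norm_compose_le) (use J in simp_all)
  hence bd: "norm (Z i h) \<le> r * norm h" for i h using norm_blinfun_le[of "Z i" r h] by simp
  have JJ: "adj J (J u) = u" for u using arg_cong[OF J(2), of "\<lambda>S. blinfun_apply S u"] by simp
  have orth: "cinner (Z i h) (Z j h') = 0" if "i \<noteq> j" for i j h h'
    by (simp add: Z_def adj_cinner(1)[OF J(1)] JJ blinfun.scaleR_left scaleR_scaleC cinner_scaleC_left
        cinner_scaleC_right creation_orthogonal[OF that])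
  have "\<exists>R :: ('n, 'h) ell2 \<Rightarrow>\<^sub>L 'h. R \<in> cbop \<and> (\<forall>i h. blinfun_apply R (ell2_single i h) = Z i h) \<and> norm R < 1"
    by (rule ell2_operator_exists[of "\<lambda>i. blinfun_apply (Z i)" r])
       (use r in \<open>auto simp: blinfun.add_right cbop_scaleC[OF Z] bd orth\<close>)
  thus ?thesis using Z by (simp add: row_ball_def Z_def)
qed

lemma compressed_shift_word:
  assumes J: "J \<in> cbop" "adj J \<circ>\<^sub>L J = id_blinfun"
  shows "adj J \<circ>\<^sub>L word_op (\<lambda>i. J \<circ>\<^sub>L Y i \<circ>\<^sub>L adj J) \<alpha> \<circ>\<^sub>L J = word_op Y \<alpha>"
proof -
  have JJ: "adj J (J u) = u" for u using arg_cong[OF J(2), of "\<lambda>S. blinfun_apply S u"] by simp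
  have "word_op (\<lambda>i. J \<circ>\<^sub>L Y i \<circ>\<^sub>L adj J) \<alpha> (J u) = J (word_op Y \<alpha> u)" for u
    by (induction \<alpha> arbitrary: u) (simp_all add: JJ)
  thus ?thesis by (intro blinfun_eqI) (simp add: JJ)
qed

lemma fh_has_value_compress:
  assumes "fh_has_value A X V" "J \<in> cbop" "\<And>i. X i \<in> cbop" "\<And>\<alpha>. A \<alpha> \<in> cbop"
    and Y: "\<And>\<alpha>. adj J \<circ>\<^sub>L word_op X \<alpha> \<circ>\<^sub>L J = word_op Y \<alpha>"
  shows "fh_has_value A Y ((adj J \<otimes>\<^sub>o id_blinfun) \<circ>\<^sub>L (V \<circ>\<^sub>L (J \<otimes>\<^sub>o id_blinfun)))"
proof -
  from assms(1) obtain P where P: "\<And>k. sot_has_sum (\<lambda>\<alpha>. word_op X \<alpha> \<otimes>\<^sub>o A \<alpha>) (P k) (words k)"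
    "P sums V" by (auto simp: fh_has_value_def)
  define Q where "Q k = (adj J \<otimes>\<^sub>o id_blinfun) \<circ>\<^sub>L (P k \<circ>\<^sub>L (J \<otimes>\<^sub>o id_blinfun))" for k
  have eq: "(adj J \<otimes>\<^sub>o id_blinfun) \<circ>\<^sub>L ((word_op X \<alpha> \<otimes>\<^sub>o A \<alpha>) \<circ>\<^sub>L (J \<otimes>\<^sub>o id_blinfun)) = word_op Y \<alpha> \<otimes>\<^sub>o A \<alpha>" for \<alpha>
    using assms(2-4) by (simp add: op_tensor_compose Y[symmetric] compose_assoc)
  have "sot_has_sum (\<lambda>\<alpha>. word_op Y \<alpha> \<otimes>\<^sub>o A \<alpha>) (Q k) (words k)" for k
    unfolding sot_has_sum_def
  proof
    fix v
    have "((\<lambda>\<alpha>. (adj J \<otimes>\<^sub>o id_blinfun) ((word_op X \<alpha> \<otimes>\<^sub>o A \<alpha>) ((J \<otimes>\<^sub>o id_blinfun) v))) has_sum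
        (adj J \<otimes>\<^sub>o id_blinfun) (P k ((J \<otimes>\<^sub>o id_blinfun) v))) (words k)"
      by (rule has_sum_bounded_linear[OF blinfun.bounded_linear_right])
         (use P(1)[of k] in \<open>simp add: sot_has_sum_def\<close>)
    thus "((\<lambda>\<alpha>. (word_op Y \<alpha> \<otimes>\<^sub>o A \<alpha>) v) has_sum Q k v) (words k)"
      by (simp add: Q_def eq[symmetric])
  qed
  moreover have "Q sums ((adj J \<otimes>\<^sub>o id_blinfun) \<circ>\<^sub>L (V \<circ>\<^sub>L (J \<otimes>\<^sub>o id_blinfun)))"
    unfolding Q_def
    by (rule bounded_linear.sums[OF bounded_linear_compose[OF
          bounded_bilinear.bounded_linear_right[OF bounded_bilinear_blinfun_compose]
          bounded_bilinear.bounded_linear_left[OF bounded_bilinear_blinfun_compose]] P(2)])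
  ultimately show ?thesis by (auto simp: fh_has_value_def)
qed

lemma fh_has_value_intertwine:
  assumes "fh_has_value A X V"
    and "\<And>\<alpha>. L \<circ>\<^sub>L (word_op X \<alpha> \<otimes>\<^sub>o A \<alpha>) = (word_op X \<alpha> \<otimes>\<^sub>o A \<alpha>) \<circ>\<^sub>L L'"
  shows "L \<circ>\<^sub>L V = V \<circ>\<^sub>L L'"
proof (rule blinfun_eqI)
  fix v
  from assms(1) obtain P where P: "\<And>k. sot_has_sum (\<lambda>\<alpha>. word_op X \<alpha> \<otimes>\<^sub>o A \<alpha>) (P k) (words k)"
    "P sums V" by (auto simp: fh_has_value_def)
  have hs: "((\<lambda>\<alpha>. (word_op X \<alpha> \<otimes>\<^sub>o A \<alpha>) u) has_sum P k u) (words k)" for k u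
    using P(1)[of k] by (simp add: sot_has_sum_def)
  have eq: "L ((word_op X \<alpha> \<otimes>\<^sub>o A \<alpha>) u) = (word_op X \<alpha> \<otimes>\<^sub>o A \<alpha>) (L' u)" for \<alpha> u
    using arg_cong[OF assms(2), of "\<lambda>S. blinfun_apply S u"] by simp
  have "L (P k v) = P k (L' v)" for k
    using has_sum_bounded_linear[OF blinfun.bounded_linear_right[of L] hs[of v k]] unfolding eq
    by (rule has_sum_unique[OF _ hs])
  hence "(\<lambda>k. P k (L' v)) sums L (V v)"
    using bounded_linear.sums[OF blinfun.bounded_linear_right[of L]
        bounded_linear.sums[OF blinfun.bounded_linear_left[of v] P(2)]] by simp
  moreover have "(\<lambda>k. P k (L' v)) sums V (L' v)"
    by (rule bounded_linear.sums[OF blinfun.bounded_linear_left P(2)])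
  ultimately show "(L \<circ>\<^sub>L V) v = (V \<circ>\<^sub>L L') v" by (simp add: sums_unique2)
qed

text \<open>Left and right shifts commute, so each term of the series, and hence its value at \<open>r S\<close>, commutes with the
  right shifts.  In the image of \<open>1 \<otimes> x\<close> only the term of \<open>\<alpha>\<close> has a nonzero coordinate at \<open>e\<^sub>\<alpha>\<close>.\<close>

lemma fh_value_at_shift:
  fixes A :: "'n::countable list \<Rightarrow> 'e::chilbert_space \<Rightarrow>\<^sub>L 'g::chilbert_space"
  assumes V: "fh_has_value A (\<lambda>i. r *\<^sub>R creation i) V" and A: "\<And>\<alpha>. A \<alpha> \<in> cbop"
  shows "multi_analytic V" "fock_coeff V \<alpha> = r ^ length \<alpha> *\<^sub>R A \<alpha>"
proof -
  define Y where "Y = (\<lambda>i::'n. r *\<^sub>R creation i)"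
  have Y: "word_op Y \<alpha> \<in> cbop" for \<alpha> by (rule word_op_cbop) (simp add: Y_def)
  have W: "word_op Y \<alpha> \<otimes>\<^sub>o A \<alpha> \<in> cbop" for \<alpha> using Y A by simp
  note V' = V[folded Y_def]
  have "V \<in> cbop"
    unfolding cbop_def mem_Collect_eq
  proof (intro allI)
    fix c v
    have "scalar_op c \<circ>\<^sub>L V = V \<circ>\<^sub>L scalar_op c"
      by (rule fh_has_value_intertwine[OF V']) (auto intro!: blinfun_eqI simp: cbop_scaleC[OF W])
    from arg_cong[OF this, of "\<lambda>S. blinfun_apply S v"] show "V (c *\<^sub>C v) = c *\<^sub>C V v" by simp
  qed
  moreover have "(right_shift \<beta> \<otimes>\<^sub>o id_blinfun) \<circ>\<^sub>L V = V \<circ>\<^sub>L (right_shift \<beta> \<otimes>\<^sub>o id_blinfun)" for \<beta>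
  proof (rule fh_has_value_intertwine[OF V'])
    fix \<alpha>
    have "right_shift \<beta> \<circ>\<^sub>L word_op Y \<alpha> = word_op Y \<alpha> \<circ>\<^sub>L right_shift \<beta>"
      by (rule fock_operator_eqI) (simp_all add: Y, simp add: Y_def word_op_creation blinfun.scaleR_right)
    thus "(right_shift \<beta> \<otimes>\<^sub>o id_blinfun) \<circ>\<^sub>L (word_op Y \<alpha> \<otimes>\<^sub>o A \<alpha>)
        = (word_op Y \<alpha> \<otimes>\<^sub>o A \<alpha>) \<circ>\<^sub>L (right_shift \<beta> \<otimes>\<^sub>o id_blinfun)"
      by (simp add: op_tensor_compose Y A)
  qed
  ultimately show "multi_analytic V" by (simp add: multi_analytic_def)
  from V' obtain P where P: "\<And>k. sot_has_sum (\<lambda>\<alpha>. word_op Y \<alpha> \<otimes>\<^sub>o A \<alpha>) (P k) (words k)"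
    "P sums V" by (auto simp: fh_has_value_def)
  show "fock_coeff V \<alpha> = r ^ length \<alpha> *\<^sub>R A \<alpha>"
  proof (rule blinfun_eqI)
    fix x
    let ?y = "fock_basis [] \<otimes>\<^sub>h x :: ('n fock, 'e) htensor"
    have eq: "fock_coord \<alpha> ((word_op Y \<gamma> \<otimes>\<^sub>o A \<gamma>) ?y) = (if \<gamma> = \<alpha> then r ^ length \<alpha> *\<^sub>R A \<alpha> x else 0)" for \<gamma>
    proof -
      have "(word_op Y \<gamma> \<otimes>\<^sub>o A \<gamma>) ?y = r ^ length \<gamma> *\<^sub>R (fock_basis \<gamma> \<otimes>\<^sub>h A \<gamma> x)"
        using word_op_creation[of r \<gamma> "[]"]
        by (simp add: Y A) (simp add: Y_def scaleR_scaleC tensor_scaleC_left)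
      thus ?thesis by (simp add: blinfun.scaleR_right)
    qed
    have "fock_coord \<alpha> (P k ?y) = (if k = length \<alpha> then r ^ length \<alpha> *\<^sub>R A \<alpha> x else 0)" for k
    proof -
      have "((\<lambda>\<gamma>. if \<gamma> = \<alpha> then r ^ length \<alpha> *\<^sub>R A \<alpha> x else 0) has_sum fock_coord \<alpha> (P k ?y)) (words k)"
      proof -
        have "((\<lambda>\<gamma>. (word_op Y \<gamma> \<otimes>\<^sub>o A \<gamma>) ?y) has_sum P k ?y) (words k)"
          using P(1)[of k] by (simp add: sot_has_sum_def)
        from has_sum_bounded_linear[OF blinfun.bounded_linear_right[of "fock_coord \<alpha>"] this]
        show ?thesis unfolding eq .
      qed
      moreover have "((\<lambda>\<gamma>. if \<gamma> = \<alpha> then r ^ length \<alpha> *\<^sub>R A \<alpha> x else 0) has_sum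
          (if k = length \<alpha> then r ^ length \<alpha> *\<^sub>R A \<alpha> x else 0)) (words k)"
        by (rule has_sum_finite_neutralI[of "{\<alpha>} \<inter> words k"]) auto
      ultimately show ?thesis by (rule has_sum_unique)
    qed
    hence "(\<lambda>k. if k = length \<alpha> then r ^ length \<alpha> *\<^sub>R A \<alpha> x else 0) sums fock_coord \<alpha> (V ?y)"
      using bounded_linear.sums[OF blinfun.bounded_linear_right[of "fock_coord \<alpha>"]
          bounded_linear.sums[OF blinfun.bounded_linear_left[of ?y] P(2)]] by simp
    moreover have "(\<lambda>k. if k = length \<alpha> then r ^ length \<alpha> *\<^sub>R A \<alpha> x else 0) sums (r ^ length \<alpha> *\<^sub>R A \<alpha> x)"
      by (rule sums_single)
    ultimately show "fock_coeff V \<alpha> x = (r ^ length \<alpha> *\<^sub>R A \<alpha>) x"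
      by (simp add: fock_coeff_def sums_unique2 blinfun.scaleR_left)
  qed
qed

lemma fh_norm_le_1_iff: "fh_norm F \<le> 1 \<longleftrightarrow> (\<forall>X\<in>row_ball. norm (F X) \<le> 1)"
  by (simp add: fh_norm_def SUP_le_iff)

text \<open>An infinite dimensional \<open>H\<close> contains a copy of the Fock space; the values of \<open>F\<close> on \<open>H\<close> at the
  transported shifts compress to its values at \<open>r S\<close>.  So the norm bound on \<open>H\<close> controls the latter.\<close>

lemma value_at_shift_exists:
  fixes F :: "('n::countable, 'h::chilbert_space, 'e::chilbert_space, 'g::chilbert_space) ball_fun"
  assumes inf: "\<not> (\<exists>B. finite B \<and> span B = (UNIV :: 'h set))"
    and F: "fh_norm F \<le> 1" and r: "0 \<le> r" "r < 1"
  obtains V :: "('n fock, 'e) htensor \<Rightarrow>\<^sub>L ('n fock, 'g) htensor"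
  where "norm V \<le> 1" "\<And>A. fh_coeffs F A \<Longrightarrow> fh_has_value A (\<lambda>i. r *\<^sub>R creation i) V"
proof -
  obtain J :: "'n fock \<Rightarrow>\<^sub>L 'h" where J: "J \<in> cbop" "adj J \<circ>\<^sub>L J = id_blinfun" "norm J \<le> 1"
    by (rule fock_embedding_exists[OF inf])
  define Z where "Z = (\<lambda>i. J \<circ>\<^sub>L (r *\<^sub>R creation i) \<circ>\<^sub>L adj J)"
  have Z: "Z \<in> row_ball" unfolding Z_def by (rule compressed_shift_row_ball[OF J r])
  have Zi: "Z i \<in> cbop" for i using J by (simp add: Z_def)
  define V where "V = (adj J \<otimes>\<^sub>o id_blinfun) \<circ>\<^sub>L (F Z \<circ>\<^sub>L (J \<otimes>\<^sub>o id_blinfun))"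
  have n1: "norm (adj J \<otimes>\<^sub>o (id_blinfun :: 'g \<Rightarrow>\<^sub>L 'g)) \<le> 1"
    by (rule order_trans[OF norm_op_tensor_id_le]) (use J in simp_all)
  have n2: "norm (J \<otimes>\<^sub>o (id_blinfun :: 'e \<Rightarrow>\<^sub>L 'e)) \<le> 1"
    by (rule order_trans[OF norm_op_tensor_id_le]) (use J in simp_all)
  have n3: "norm (F Z) \<le> 1" using F Z by (simp add: fh_norm_le_1_iff)
  show ?thesis
  proof (rule that[of V])
    show "norm V \<le> 1" using norm_compose_le[OF n1 norm_compose_le[OF n3 n2]] by (simp add: V_def)
    fix A assume A: "fh_coeffs F A"
    show "fh_has_value A (\<lambda>i. r *\<^sub>R creation i) V"
      unfolding V_def
    proof (rule fh_has_value_compress[OF _ J(1) Zi])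
      show "fh_has_value A Z (F Z)" "A \<alpha> \<in> cbop" for \<alpha> using A Z by (simp_all add: fh_coeffs_def)
      show "adj J \<circ>\<^sub>L word_op Z \<alpha> \<circ>\<^sub>L J = word_op (\<lambda>i. r *\<^sub>R creation i) \<alpha>" for \<alpha>
        unfolding Z_def by (rule compressed_shift_word[OF J(1,2)])
    qed
  qed
qed

lemma eventually_left_of_1: "\<forall>\<^sub>F r in at_left (1::real). 0 \<le> r \<and> r < 1"
  unfolding eventually_at_left_field by (intro exI[of _ 0]) auto

lemma tendsto_gauge:
  fixes w :: "('n fock, 'e::chilbert_space) htensor"
  shows "((\<lambda>r. (gauge_op r \<otimes>\<^sub>o id_blinfun) w) \<longlongrightarrow> w) (at_left 1)"
proof -
  note ev = eventually_left_of_1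
  have "((\<lambda>r. (gauge_op r \<otimes>\<^sub>o id_blinfun) w) \<longlongrightarrow> id_blinfun w) (at_left 1)"
  proof (rule tendsto_total[OF fock_tensor_total trivial_limit_at_left_real, where C = 1])
    show "\<forall>\<^sub>F r in at_left 1. norm (gauge_op r \<otimes>\<^sub>o id_blinfun :: ('n fock, 'e) htensor \<Rightarrow>\<^sub>L _) \<le> 1"
      using ev
    proof eventually_elim
      case (elim r)
      show ?case
        by (rule order_trans[OF norm_op_tensor_id_le]) (use elim gauge_op[of r] in simp_all)
    qed
    fix v :: "('n fock, 'e) htensor" assume "v \<in> {fock_basis \<alpha> \<otimes>\<^sub>h x | \<alpha> x. True}"
    then obtain \<alpha> x where v: "v = fock_basis \<alpha> \<otimes>\<^sub>h x" by auto
    have "\<forall>\<^sub>F r in at_left 1. r ^ length \<alpha> *\<^sub>R v = (gauge_op r \<otimes>\<^sub>o id_blinfun) v"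
      using ev by eventually_elim (simp add: v gauge_op scaleR_scaleC tensor_scaleC_left)
    moreover have "((\<lambda>r. r ^ length \<alpha> *\<^sub>R v) \<longlongrightarrow> 1 ^ length \<alpha> *\<^sub>R v) (at_left (1::real))"
      by (intro tendsto_intros)
    ultimately show "((\<lambda>r. (gauge_op r \<otimes>\<^sub>o id_blinfun) v) \<longlongrightarrow> id_blinfun v) (at_left 1)"
      by (simp add: Lim_transform_eventually)
  qed
  thus ?thesis by simp
qed

text \<open>Let \<open>V r\<close> be contractions with coefficients \<open>r\<^bsup>|\<alpha>|\<^esup> A\<^sub>\<alpha>\<close>, as the values \<open>F(r S)\<close> are.  The column bound for these
  coefficients is uniform in \<open>r\<close>, so \<open>w = \<Sum> e\<^sub>\<alpha> \<otimes> A\<^sub>\<alpha> x\<close> converges; \<open>w\<close> will be the image of \<open>1 \<otimes> x\<close> under the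
  boundary function.\<close>

lemma dilated_vacuum_image:
  fixes V :: "real \<Rightarrow> ('n fock, 'e::chilbert_space) htensor \<Rightarrow>\<^sub>L ('n fock, 'g::chilbert_space) htensor"
  assumes V: "\<And>r. 0 \<le> r \<Longrightarrow> r < 1 \<Longrightarrow> norm (V r) \<le> 1"
    and Vc: "\<And>r \<alpha>. 0 \<le> r \<Longrightarrow> r < 1 \<Longrightarrow> fock_coeff (V r) \<alpha> = r ^ length \<alpha> *\<^sub>R A \<alpha>"
  shows "\<exists>w. \<forall>r. 0 \<le> r \<and> r < 1 \<longrightarrow> V r (fock_basis [] \<otimes>\<^sub>h x) = (gauge_op r \<otimes>\<^sub>o id_blinfun) w"
proof -
  note ev = eventually_left_of_1
  have fin: "(\<Sum>\<alpha>\<in>S. (norm (A \<alpha> x))\<^sup>2) \<le> (norm x)\<^sup>2" if "finite S" for S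
  proof (rule tendsto_upperbound)
    have "((\<lambda>r. \<Sum>\<alpha>\<in>S. (norm (r ^ length \<alpha> *\<^sub>R A \<alpha> x))\<^sup>2) \<longlongrightarrow> (\<Sum>\<alpha>\<in>S. (norm (1 ^ length \<alpha> *\<^sub>R A \<alpha> x))\<^sup>2)) (at_left (1::real))"
      by (intro tendsto_intros)
    thus "((\<lambda>r. \<Sum>\<alpha>\<in>S. (norm (r ^ length \<alpha> *\<^sub>R A \<alpha> x))\<^sup>2) \<longlongrightarrow> (\<Sum>\<alpha>\<in>S. (norm (A \<alpha> x))\<^sup>2)) (at_left (1::real))"
      by simp
    show "\<forall>\<^sub>F r in at_left (1::real). (\<Sum>\<alpha>\<in>S. (norm (r ^ length \<alpha> *\<^sub>R A \<alpha> x))\<^sup>2) \<le> (norm x)\<^sup>2"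
      using ev
    proof eventually_elim
      case (elim r)
      have "(\<Sum>\<alpha>\<in>S. (norm (r ^ length \<alpha> *\<^sub>R A \<alpha> x))\<^sup>2) \<le> (norm (V r))\<^sup>2 * (norm x)\<^sup>2"
        using fock_coeff_column[OF that, of "V r" x] Vc elim by (simp add: blinfun.scaleR_left)
      also have "\<dots> \<le> 1 * (norm x)\<^sup>2"
        using V[of r] elim by (intro mult_right_mono power_le_one) auto
      finally show ?case by simp
    qed
  qed simp
  have "(\<lambda>\<alpha>. (norm (A \<alpha> x))\<^sup>2) summable_on UNIV"
    by (rule nonneg_bdd_above_summable_on) (use fin in \<open>auto intro!: bdd_aboveI2\<close>)
  hence "(\<lambda>\<alpha>. fock_basis \<alpha> \<otimes>\<^sub>h A \<alpha> x) summable_on UNIV"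
    by (intro orthogonal_summable) (auto simp: cinner_tensor cinner_fock_basis norm_tensor)
  then obtain w where w: "((\<lambda>\<alpha>. fock_basis \<alpha> \<otimes>\<^sub>h A \<alpha> x) has_sum w) UNIV" by (auto simp: summable_on_def)
  have cw: "fock_coord \<alpha> w = A \<alpha> x" for \<alpha>
  proof -
    have "((\<lambda>\<beta>. fock_coord \<alpha> (fock_basis \<beta> \<otimes>\<^sub>h A \<beta> x)) has_sum fock_coord \<alpha> w) UNIV"
      by (rule has_sum_bounded_linear[OF blinfun.bounded_linear_right w])
    moreover have "((\<lambda>\<beta>. fock_coord \<alpha> (fock_basis \<beta> \<otimes>\<^sub>h A \<beta> x)) has_sum A \<alpha> x) UNIV"
      by (rule has_sum_finite_neutralI[of "{\<alpha>}"]) auto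
    ultimately show ?thesis by (rule has_sum_unique)
  qed
  have "V r (fock_basis [] \<otimes>\<^sub>h x) = (gauge_op r \<otimes>\<^sub>o id_blinfun) w" if "0 \<le> r" "r < 1" for r
  proof (rule fock_coord_eqI)
    fix \<alpha>
    have "fock_coord \<alpha> (V r (fock_basis [] \<otimes>\<^sub>h x)) = r ^ length \<alpha> *\<^sub>R A \<alpha> x"
      using arg_cong[OF Vc[OF that], of "\<lambda>S. blinfun_apply S x" \<alpha>] by (simp add: fock_coeff_def blinfun.scaleR_left)
    thus "fock_coord \<alpha> (V r (fock_basis [] \<otimes>\<^sub>h x)) = fock_coord \<alpha> ((gauge_op r \<otimes>\<^sub>o id_blinfun) w)"
      using that by (simp add: fock_coord_gauge cw)
  qed
  thus ?thesis by blast
qed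

text \<open>On \<open>1 \<otimes> x\<close> the operators \<open>V r\<close> converge because the gauge operators converge to the identity; right shifts
  carry this to the total set of vectors \<open>e\<^sub>\<beta> \<otimes> x\<close>, and equiboundedness to every vector.  Commutation with the right
  shifts and the coefficients pass to the limit.\<close>

lemma dilation_limit_exists:
  fixes V :: "real \<Rightarrow> ('n fock, 'e::chilbert_space) htensor \<Rightarrow>\<^sub>L ('n fock, 'g::chilbert_space) htensor"
  assumes V: "\<And>r. 0 \<le> r \<Longrightarrow> r < 1 \<Longrightarrow> norm (V r) \<le> 1"
    and Vm: "\<And>r. 0 \<le> r \<Longrightarrow> r < 1 \<Longrightarrow> multi_analytic (V r)"
    and Vc: "\<And>r \<alpha>. 0 \<le> r \<Longrightarrow> r < 1 \<Longrightarrow> fock_coeff (V r) \<alpha> = r ^ length \<alpha> *\<^sub>R A \<alpha>"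
  obtains T where "multi_analytic T" "norm T \<le> 1" "fock_coeff T = A"
    "\<And>v. ((\<lambda>r. blinfun_apply (V r) v) \<longlongrightarrow> blinfun_apply T v) (at_left 1)"
proof -
  note ev = eventually_left_of_1
  note vac = dilated_vacuum_image[OF V Vc]
  have conv: "\<exists>l. ((\<lambda>r. V r v) \<longlongrightarrow> l) (at_left 1)" if "v \<in> {fock_basis \<beta> \<otimes>\<^sub>h x | \<beta> x. True}" for v
  proof -
    from that obtain \<beta> x where v: "v = fock_basis \<beta> \<otimes>\<^sub>h x" by blast
    obtain w where w: "\<And>r. 0 \<le> r \<Longrightarrow> r < 1 \<Longrightarrow> V r (fock_basis [] \<otimes>\<^sub>h x) = (gauge_op r \<otimes>\<^sub>o id_blinfun) w"
      using vac by blast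
    have "((\<lambda>r. (right_shift \<beta> \<otimes>\<^sub>o id_blinfun) ((gauge_op r \<otimes>\<^sub>o id_blinfun) w)) \<longlongrightarrow>
        (right_shift \<beta> \<otimes>\<^sub>o id_blinfun) w) (at_left 1)"
      by (intro bounded_linear.tendsto[OF blinfun.bounded_linear_right] tendsto_gauge)
    moreover have "\<forall>\<^sub>F r in at_left (1::real). (right_shift \<beta> \<otimes>\<^sub>o id_blinfun) ((gauge_op r \<otimes>\<^sub>o id_blinfun) w) = V r v"
      using ev by eventually_elim (simp add: v w multi_analytic_apply(2)[OF Vm, of _ \<beta>])
    ultimately show ?thesis by (blast intro: Lim_transform_eventually)
  qed
  have "\<forall>\<^sub>F r in at_left 1. norm (V r) \<le> 1" using ev by eventually_elim (simp add: V)
  then obtain T where T: "\<And>v. ((\<lambda>r. V r v) \<longlongrightarrow> blinfun_apply T v) (at_left 1)" "norm T \<le> 1"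
    using strong_limit_exists[OF fock_tensor_total trivial_limit_at_left_real _ conv] by blast
  have comm: "L \<circ>\<^sub>L T = T \<circ>\<^sub>L L'" if "\<And>r. 0 \<le> r \<Longrightarrow> r < 1 \<Longrightarrow> L \<circ>\<^sub>L V r = V r \<circ>\<^sub>L L'"
    for L :: "('n fock, 'g) htensor \<Rightarrow>\<^sub>L ('n fock, 'g) htensor" and L'
  proof (rule blinfun_eqI)
    fix v
    have "\<forall>\<^sub>F r in at_left 1. L (V r v) = V r (L' v)"
      using ev
    proof eventually_elim
      case (elim r)
      show ?case using arg_cong[OF that[of r], of "\<lambda>S. blinfun_apply S v"] elim by simp
    qed
    moreover have "((\<lambda>r. L (V r v)) \<longlongrightarrow> L (T v)) (at_left 1)"
      by (intro bounded_linear.tendsto[OF blinfun.bounded_linear_right] T)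
    ultimately have "((\<lambda>r. V r (L' v)) \<longlongrightarrow> L (T v)) (at_left 1)" by (rule Lim_transform_eventually[rotated])
    thus "(L \<circ>\<^sub>L T) v = (T \<circ>\<^sub>L L') v"
      using tendsto_unique[OF trivial_limit_at_left_real _ T(1)[of "L' v"]] by simp
  qed
  have "T \<in> cbop"
    unfolding cbop_def mem_Collect_eq
  proof (intro allI)
    fix c v
    have "scalar_op c \<circ>\<^sub>L T = T \<circ>\<^sub>L scalar_op c"
      by (rule comm) (auto intro!: blinfun_eqI simp: cbop_scaleC[OF multi_analytic_cbop[OF Vm]])
    from arg_cong[OF this, of "\<lambda>S. blinfun_apply S v"] show "T (c *\<^sub>C v) = c *\<^sub>C T v" by simp
  qed
  moreover have "(right_shift \<beta> \<otimes>\<^sub>o id_blinfun) \<circ>\<^sub>L T = T \<circ>\<^sub>L (right_shift \<beta> \<otimes>\<^sub>o id_blinfun)" for \<beta>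
    using Vm by (intro comm) (simp add: multi_analytic_def)
  ultimately have Tm: "multi_analytic T" by (simp add: multi_analytic_def)
  have Tc: "fock_coeff T \<alpha> = A \<alpha>" for \<alpha>
  proof (rule blinfun_eqI)
    fix x
    have "((\<lambda>r. fock_coord \<alpha> (V r (fock_basis [] \<otimes>\<^sub>h x))) \<longlongrightarrow> fock_coeff T \<alpha> x) (at_left 1)"
      unfolding fock_coeff_def blinfun_apply_blinfun_compose tensor_left_apply
      by (intro bounded_linear.tendsto[OF blinfun.bounded_linear_right] T)
    moreover have "\<forall>\<^sub>F r in at_left 1. fock_coord \<alpha> (V r (fock_basis [] \<otimes>\<^sub>h x)) = r ^ length \<alpha> *\<^sub>R A \<alpha> x"
      using ev
    proof eventually_elim
      case (elim r)
      show ?case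
        using arg_cong[OF Vc[of r], of "\<lambda>S. blinfun_apply S x" \<alpha>] elim
        by (simp add: fock_coeff_def blinfun.scaleR_left)
    qed
    ultimately have "((\<lambda>r. r ^ length \<alpha> *\<^sub>R A \<alpha> x) \<longlongrightarrow> fock_coeff T \<alpha> x) (at_left 1)"
      by (rule Lim_transform_eventually)
    moreover have "((\<lambda>r. r ^ length \<alpha> *\<^sub>R A \<alpha> x) \<longlongrightarrow> 1 ^ length \<alpha> *\<^sub>R A \<alpha> x) (at_left (1::real))"
      by (intro tendsto_intros)
    ultimately show "fock_coeff T \<alpha> x = A \<alpha> x"
      using tendsto_unique[OF trivial_limit_at_left_real] by fastforce
  qed
  show ?thesis
    by (rule that[OF Tm T(2) _ T(1)]) (rule ext, rule Tc)
qed

text \<open>The operators \<open>F(r S)\<close> are contractions by means of the copy of the Fock space inside \<open>H\<close>, so their strong limit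
  exists; it is the boundary function by definition.\<close>

lemma boundary_function:
  fixes F :: "('n::countable, 'h::chilbert_space, 'e::chilbert_space, 'g::chilbert_space) ball_fun"
  assumes inf: "\<not> (\<exists>B. finite B \<and> span B = (UNIV :: 'h set))"
    and F: "fh_norm F \<le> 1" and A: "fh_coeffs F A"
  shows "multi_analytic (boundary_fun F)" "norm (boundary_fun F) \<le> 1" "fock_coeff (boundary_fun F) = A"
proof -
  have Ac: "A \<alpha> \<in> cbop" for \<alpha> using A by (simp add: fh_coeffs_def)
  have "\<exists>V. \<forall>r::real. 0 \<le> r \<and> r < 1 \<longrightarrow> norm (V r :: ('n fock, 'e) htensor \<Rightarrow>\<^sub>L ('n fock, 'g) htensor) \<le> 1
      \<and> (\<forall>A. fh_coeffs F A \<longrightarrow> fh_has_value A (\<lambda>i. r *\<^sub>R creation i) (V r))"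
  proof (rule choice, intro allI)
    fix r :: real
    show "\<exists>V. 0 \<le> r \<and> r < 1 \<longrightarrow> norm (V :: ('n fock, 'e) htensor \<Rightarrow>\<^sub>L ('n fock, 'g) htensor) \<le> 1
      \<and> (\<forall>A. fh_coeffs F A \<longrightarrow> fh_has_value A (\<lambda>i. r *\<^sub>R creation i) V)"
    proof (cases "0 \<le> r \<and> r < 1")
      case True
      then show ?thesis using value_at_shift_exists[OF inf F, of r] by blast
    next
      case False
      then show ?thesis by blast
    qed
  qed
  then obtain V :: "real \<Rightarrow> ('n fock, 'e) htensor \<Rightarrow>\<^sub>L ('n fock, 'g) htensor"
    where V: "\<And>r. 0 \<le> r \<Longrightarrow> r < 1 \<Longrightarrow> norm (V r) \<le> 1"
      "\<And>r A. 0 \<le> r \<Longrightarrow> r < 1 \<Longrightarrow> fh_coeffs F A \<Longrightarrow> fh_has_value A (\<lambda>i. r *\<^sub>R creation i) (V r)"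
    by blast
  have Vm: "multi_analytic (V r)" and Vc: "fock_coeff (V r) \<alpha> = r ^ length \<alpha> *\<^sub>R A \<alpha>"
    if "0 \<le> r" "r < 1" for r \<alpha>
    using fh_value_at_shift[OF V(2)[OF that A] Ac] by auto
  have eval: "fh_eval F (\<lambda>i. r *\<^sub>R creation i) = V r" if "0 \<le> r" "r < 1" for r
    unfolding fh_eval_def
  proof (rule the_equality)
    show "\<exists>A. fh_coeffs F A \<and> fh_has_value A (\<lambda>i. r *\<^sub>R creation i) (V r)" using A V(2)[OF that A] by blast
    fix V' assume "\<exists>A. fh_coeffs F A \<and> fh_has_value A (\<lambda>i. r *\<^sub>R creation i) V'"
    then obtain A' where "fh_coeffs F A'" "fh_has_value A' (\<lambda>i. r *\<^sub>R creation i) V'" by blast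
    thus "V' = V r" using V(2)[OF that] fh_has_value_unique by blast
  qed
  note ev = eventually_left_of_1
  obtain T where T: "multi_analytic T" "norm T \<le> 1" "fock_coeff T = A"
    "\<And>v. ((\<lambda>r. blinfun_apply (V r) v) \<longlongrightarrow> blinfun_apply T v) (at_left 1)"
    by (rule dilation_limit_exists[OF V(1) Vm Vc]) blast+
  have lim': "((\<lambda>r. fh_eval F (\<lambda>i. r *\<^sub>R creation i) v) \<longlongrightarrow> T v) (at_left 1)" for v
  proof (rule Lim_transform_eventually[OF T(4)])
    show "\<forall>\<^sub>F r in at_left 1. V r v = fh_eval F (\<lambda>i. r *\<^sub>R creation i) v"
      using ev by eventually_elim (simp add: eval)
  qed
  have "boundary_fun F = T"
    unfolding boundary_fun_def
  proof (rule the_equality)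
    show "\<forall>v. ((\<lambda>r. fh_eval F (\<lambda>i. r *\<^sub>R creation i) v) \<longlongrightarrow> T v) (at_left 1)" using lim' by blast
    fix T' :: "('n fock, 'e) htensor \<Rightarrow>\<^sub>L ('n fock, 'g) htensor"
    assume "\<forall>v. ((\<lambda>r. fh_eval F (\<lambda>i. r *\<^sub>R creation i) v) \<longlongrightarrow> T' v) (at_left 1)"
    thus "T' = T" using lim' by (intro blinfun_eqI) (blast intro: tendsto_unique[OF trivial_limit_at_left_real])
  qed
  thus "multi_analytic (boundary_fun F)" "norm (boundary_fun F) \<le> 1" "fock_coeff (boundary_fun F) = A"
    using T by simp_all
qed

section \<open>Spatial tensor products and the Moebius transform\<close>

lemma min_tensor_minimal:
  assumes "closed W" "subspace W" "\<And>S T. S \<in> M \<Longrightarrow> T \<in> N \<Longrightarrow> S \<otimes>\<^sub>o T \<in> W"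
  shows "min_tensor M N \<subseteq> W"
  unfolding min_tensor_def using assms
  by (intro closure_minimal span_minimal) auto

lemma min_tensor_elementary: "S \<in> M \<Longrightarrow> T \<in> N \<Longrightarrow> S \<otimes>\<^sub>o T \<in> min_tensor M N"
  unfolding min_tensor_def by (rule subsetD[OF closure_subset], rule span_base) auto

lemma closed_min_tensor: "closed (min_tensor M N)"
  by (simp add: min_tensor_def)

lemma subspace_min_tensor: "subspace (min_tensor M N)"
  by (simp add: min_tensor_def subspace_closure)

lemma min_tensor_cbop:
  assumes "M \<subseteq> cbop"
  shows "min_tensor M cbop \<subseteq> cbop"
  by (rule min_tensor_minimal[OF closed_cbop])
     (use assms in \<open>auto intro!: subspaceI op_tensor_cbop\<close>)

lemma closed_subspace_vimage:
  fixes f :: "'a::real_normed_vector \<Rightarrow> 'b::real_normed_vector"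
  assumes f: "bounded_linear f" and W: "closed W" "subspace W"
  shows "closed (f -` W)" "subspace (f -` W)"
proof -
  interpret f: bounded_linear f by fact
  show "closed (f -` W)"
    by (rule continuous_closed_vimage[OF W(1)]) (simp add: f.continuous)
  show "subspace (f -` W)"
    by (rule subspaceI)
       (auto simp: f.zero f.add f.scale subspace_0[OF W(2)] subspace_add[OF W(2)] subspace_scale[OF W(2)])
qed

context
  fixes M :: "('h::chilbert_space \<Rightarrow>\<^sub>L 'h) set"
  assumes M: "M \<subseteq> cbop" "id_blinfun \<in> M" "\<And>S T. S \<in> M \<Longrightarrow> T \<in> M \<Longrightarrow> S \<circ>\<^sub>L T \<in> M"
begin

text \<open>The products of elementary tensors are elementary; the general case follows by closed subspace arguments in
  each factor separately.\<close>

lemma min_tensor_compose: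
  fixes U :: "('h, 'b::chilbert_space) htensor \<Rightarrow>\<^sub>L ('h, 'c::chilbert_space) htensor"
    and V :: "('h, 'a::chilbert_space) htensor \<Rightarrow>\<^sub>L ('h, 'b) htensor"
  assumes "U \<in> min_tensor M cbop" "V \<in> min_tensor M cbop"
  shows "U \<circ>\<^sub>L V \<in> min_tensor M cbop"
proof -
  let ?MT = "min_tensor M cbop :: (('h, 'a) htensor \<Rightarrow>\<^sub>L ('h, 'c) htensor) set"
  have elem: "min_tensor M cbop \<subseteq> (\<lambda>V. (S \<otimes>\<^sub>o T) \<circ>\<^sub>L V) -` ?MT"
    if "S \<in> M" "T \<in> cbop" for S and T :: "'b \<Rightarrow>\<^sub>L 'c"
  proof (rule min_tensor_minimal)
    fix S' and T' :: "'a \<Rightarrow>\<^sub>L 'b" assume "S' \<in> M" "T' \<in> cbop"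
    moreover have "(S \<otimes>\<^sub>o T) \<circ>\<^sub>L (S' \<otimes>\<^sub>o T') = (S \<circ>\<^sub>L S') \<otimes>\<^sub>o (T \<circ>\<^sub>L T')"
      using that M(1) \<open>S' \<in> M\<close> \<open>T' \<in> cbop\<close> by (intro op_tensor_compose) auto
    ultimately show "S' \<otimes>\<^sub>o T' \<in> (\<lambda>V. (S \<otimes>\<^sub>o T) \<circ>\<^sub>L V) -` ?MT"
      using that M(3) by (simp add: min_tensor_elementary)
  qed (intro closed_subspace_vimage closed_min_tensor subspace_min_tensor
      bounded_bilinear.bounded_linear_right[OF bounded_bilinear_blinfun_compose])+
  have "min_tensor M cbop \<subseteq> (\<lambda>U. U \<circ>\<^sub>L V) -` ?MT"
  proof (rule min_tensor_minimal)
    fix S and T :: "'b \<Rightarrow>\<^sub>L 'c" assume "S \<in> M" "T \<in> cbop"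
    thus "S \<otimes>\<^sub>o T \<in> (\<lambda>U. U \<circ>\<^sub>L V) -` ?MT" using elem assms(2) by blast
  qed (intro closed_subspace_vimage closed_min_tensor subspace_min_tensor
      bounded_bilinear.bounded_linear_left[OF bounded_bilinear_blinfun_compose])+
  thus ?thesis using assms(1) by blast
qed

text \<open>The inverse is the fixed point of \<open>S \<mapsto> I + T S\<close>, a contraction of the closed set in question.\<close>

lemma min_tensor_inverse:
  fixes T :: "('h, 'a::chilbert_space) htensor \<Rightarrow>\<^sub>L ('h, 'a) htensor"
  assumes T: "T \<in> min_tensor M cbop" and n: "norm T < 1"
  shows "op_inv (id_blinfun - T) \<in> min_tensor M cbop"
proof -
  let ?MT = "min_tensor M cbop :: (('h, 'a) htensor \<Rightarrow>\<^sub>L ('h, 'a) htensor) set"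
  have id: "id_blinfun \<in> ?MT"
    using min_tensor_elementary[OF M(2) cbop_id] by simp
  have "\<exists>!S\<in>?MT. id_blinfun + T \<circ>\<^sub>L S = S"
  proof (rule Banach_fix)
    show "complete ?MT" by (simp add: complete_eq_closed closed_min_tensor)
    show "?MT \<noteq> {}" using id by blast
    show "0 \<le> norm T" "norm T < 1" using n by simp_all
    show "(\<lambda>S. id_blinfun + T \<circ>\<^sub>L S) ` ?MT \<subseteq> ?MT"
      using min_tensor_compose[OF T] id by (auto intro: subspace_add[OF subspace_min_tensor])
    fix S S' :: "('h, 'a) htensor \<Rightarrow>\<^sub>L ('h, 'a) htensor"
    have "norm (T \<circ>\<^sub>L (S - S')) \<le> norm T * norm (S - S')" by (rule norm_blinfun_compose)
    thus "dist (id_blinfun + T \<circ>\<^sub>L S) (id_blinfun + T \<circ>\<^sub>L S') \<le> norm T * dist S S'"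
      by (simp add: dist_norm compose_simps)
  qed
  then obtain S where S: "S \<in> ?MT" "id_blinfun + T \<circ>\<^sub>L S = S" by blast
  have "(id_blinfun - T) \<circ>\<^sub>L S = id_blinfun" using S(2) by (simp add: compose_simps algebra_simps)
  hence "op_inv (id_blinfun - T) = op_inv (id_blinfun - T) \<circ>\<^sub>L ((id_blinfun - T) \<circ>\<^sub>L S)" by simp
  also have "\<dots> = S" by (simp add: compose_assoc[symmetric] neumann_inverse[OF n])
  finally show ?thesis using S(1) by simp
qed

lemma min_tensor_mobius:
  fixes T :: "('h, 'e::chilbert_space) htensor \<Rightarrow>\<^sub>L ('h, 'g::chilbert_space) htensor"
  assumes T: "T \<in> min_tensor M cbop" "norm T \<le> 1" and A: "A \<in> cbop" "norm A < 1"
  shows "mobius (id_blinfun \<otimes>\<^sub>o A) T \<in> min_tensor M cbop"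
proof -
  have A': "adj A \<in> cbop" "norm (adj A) < 1" using A by simp_all
  let ?A = "id_blinfun \<otimes>\<^sub>o adj A :: ('h, 'g) htensor \<Rightarrow>\<^sub>L ('h, 'e) htensor"
  have "norm ?A < 1" using norm_id_op_tensor_le[OF A'(1)] A'(2) by (rule le_less_trans)
  hence "norm (T \<circ>\<^sub>L ?A) < 1" by (rule norm_compose_less_1(2)) (rule T(2))
  thus ?thesis
    unfolding mobius_def op_tensor_adj[OF cbop_id A(1)] adj_id defect_id_tensor[OF A] defect_id_tensor[OF A']
    by (intro subspace_diff[OF subspace_min_tensor] min_tensor_compose min_tensor_inverse
        min_tensor_elementary M(2) A(1) A'(1) T(1) defect_properties(1)[OF A] defect_properties(1)[OF A'])
qed

end

lemma closed_subalgebra_cbop: "closed_subalgebra cbop"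
proof -
  have "Blinfun (\<lambda>x. c *\<^sub>C blinfun_apply S x) = scalar_op c \<circ>\<^sub>L S" for c and S :: "'a::chilbert_space \<Rightarrow>\<^sub>L 'a"
  proof (rule blinfun_eqI)
    fix x
    have "bounded_linear (\<lambda>x. c *\<^sub>C blinfun_apply S x)"
      by (rule bounded_linear_compose[OF bounded_linear_scaleC blinfun.bounded_linear_right])
    thus "Blinfun (\<lambda>x. c *\<^sub>C blinfun_apply S x) x = (scalar_op c \<circ>\<^sub>L S) x"
      by (simp add: bounded_linear_Blinfun_apply)
  qed
  thus ?thesis by (simp add: closed_subalgebra_def closed_cbop)
qed

lemma disc_algebra_props:
  fixes S T :: "'n fock \<Rightarrow>\<^sub>L 'n fock"
  shows "disc_algebra \<subseteq> (cbop :: ('n fock \<Rightarrow>\<^sub>L 'n fock) set)" "(id_blinfun :: 'n fock \<Rightarrow>\<^sub>L 'n fock) \<in> disc_algebra"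
    and "S \<in> disc_algebra \<Longrightarrow> T \<in> disc_algebra \<Longrightarrow> S \<circ>\<^sub>L T \<in> disc_algebra"
proof -
  show "disc_algebra \<subseteq> (cbop :: ('n fock \<Rightarrow>\<^sub>L 'n fock) set)"
    unfolding disc_algebra_def by (rule hull_minimal) (auto simp: closed_subalgebra_cbop)
  show "(id_blinfun :: 'n fock \<Rightarrow>\<^sub>L 'n fock) \<in> disc_algebra"
    unfolding disc_algebra_def by (rule subsetD[OF hull_subset]) simp
  have "closed_subalgebra (disc_algebra :: ('n fock \<Rightarrow>\<^sub>L 'n fock) set)"
    unfolding disc_algebra_def
  proof (rule hull_in)
    fix \<T> :: "('n fock \<Rightarrow>\<^sub>L 'n fock) set set"
    assume "Ball \<T> closed_subalgebra"
    thus "closed_subalgebra (\<Inter> \<T>)" unfolding closed_subalgebra_def by (auto intro: closed_Inter)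
  qed
  thus "S \<in> disc_algebra \<Longrightarrow> T \<in> disc_algebra \<Longrightarrow> S \<circ>\<^sub>L T \<in> disc_algebra"
    by (simp add: closed_subalgebra_def)
qed

section \<open>The Moebius transform of a free holomorphic function\<close>

lemma poisson_embedding_constant:
  fixes X :: "'n::countable \<Rightarrow> 'h::chilbert_space \<Rightarrow>\<^sub>L 'h" and B :: "'e::chilbert_space \<Rightarrow>\<^sub>L 'g::chilbert_space"
  assumes "X \<in> row_ball" and B: "B \<in> cbop"
  shows "(id_blinfun \<otimes>\<^sub>o B) \<circ>\<^sub>L adj (poisson_embedding X) = adj (poisson_embedding X) \<circ>\<^sub>L (id_blinfun \<otimes>\<^sub>o (id_blinfun \<otimes>\<^sub>o B))"
proof -
  from assms obtain R where R: "\<And>i. X i \<in> cbop" "R \<in> cbop"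
    "\<And>i h. blinfun_apply R (ell2_single i h) = X i h" "norm R < 1"
    unfolding row_ball_def by blast
  show ?thesis
    by (rule fock_tensor2_operator_eqI) (simp add: adj_poisson_embedding[OF R] B)
qed

lemma compose_eq_apply:
  "R \<circ>\<^sub>L S = R' \<circ>\<^sub>L S' \<Longrightarrow> blinfun_apply R (blinfun_apply S u) = blinfun_apply R' (blinfun_apply S' u)"
  by (metis blinfun_apply_blinfun_compose)

text \<open>The adjoint \<open>K\<close> of the Poisson embedding satisfies \<open>V K = K (I \<otimes> T)\<close> and commutes in the same sense with
  constants, and an intertwining relation passes to products and inverses.  So it holds for the Moebius transforms,
  and composing with the embedding, of which \<open>K\<close> is a left inverse, gives the claim.\<close>

lemma poisson_transform_mobius:
  fixes X :: "'n::countable \<Rightarrow> 'h::chilbert_space \<Rightarrow>\<^sub>L 'h"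
    and T :: "('n fock, 'e::chilbert_space) htensor \<Rightarrow>\<^sub>L ('n fock, 'g::chilbert_space) htensor"
  assumes X: "X \<in> row_ball" and T: "T \<in> cbop" "norm T \<le> 1" and A: "A \<in> cbop" "norm A < 1"
    and V: "V \<circ>\<^sub>L adj (poisson_embedding X) = adj (poisson_embedding X) \<circ>\<^sub>L (id_blinfun \<otimes>\<^sub>o T)" "norm V \<le> 1"
  shows "poisson_transform X (mobius (id_blinfun \<otimes>\<^sub>o A) T) = mobius (id_blinfun \<otimes>\<^sub>o A) V"
proof -
  have A': "adj A \<in> cbop" "norm (adj A) < 1" using A by simp_all
  note D = defect_properties(1)[OF A] defect_properties(1)[OF A']
  define K where "K = adj (poisson_embedding X :: ('h, 'e) htensor \<Rightarrow>\<^sub>L ('h, ('n fock, 'e) htensor) htensor)"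
  define L where "L = adj (poisson_embedding X :: ('h, 'g) htensor \<Rightarrow>\<^sub>L ('h, ('n fock, 'g) htensor) htensor)"
  define a where "a = (id_blinfun :: 'n fock \<Rightarrow>\<^sub>L 'n fock) \<otimes>\<^sub>o adj A"
  define N where "N = op_inv (id_blinfun - V \<circ>\<^sub>L ((id_blinfun :: 'h \<Rightarrow>\<^sub>L 'h) \<otimes>\<^sub>o adj A))"
  define N' where "N' = op_inv (id_blinfun - T \<circ>\<^sub>L a)"
  have a: "a \<in> cbop" using A by (simp add: a_def)
  have da: "defect a = id_blinfun \<otimes>\<^sub>o defect (adj A)" unfolding a_def by (rule defect_id_tensor[OF A'])
  have "norm a < 1" unfolding a_def using norm_id_op_tensor_le[OF A'(1)] A'(2) by (rule le_less_trans)
  hence nTa: "norm (T \<circ>\<^sub>L a) < 1" by (rule norm_compose_less_1(2)) (rule T(2))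
  have "norm ((id_blinfun :: 'h \<Rightarrow>\<^sub>L 'h) \<otimes>\<^sub>o adj A) < 1"
    using norm_id_op_tensor_le[OF A'(1)] A'(2) by (rule le_less_trans)
  hence nVa: "norm (V \<circ>\<^sub>L ((id_blinfun :: 'h \<Rightarrow>\<^sub>L 'h) \<otimes>\<^sub>o adj A)) < 1"
    by (rule norm_compose_less_1(2)) (rule V(2))
  have N'c: "N' \<in> cbop" unfolding N'_def by (rule cbop_neumann_inverse[OF nTa]) (simp add: T a)
  have int: "(id_blinfun \<otimes>\<^sub>o A) (K u) = L ((id_blinfun \<otimes>\<^sub>o (id_blinfun \<otimes>\<^sub>o A)) u)"
    "(id_blinfun \<otimes>\<^sub>o adj A) (L w) = K ((id_blinfun \<otimes>\<^sub>o (id_blinfun \<otimes>\<^sub>o adj A)) w)"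
    "(id_blinfun \<otimes>\<^sub>o defect A) (K u) = K ((id_blinfun \<otimes>\<^sub>o (id_blinfun \<otimes>\<^sub>o defect A)) u)"
    "(id_blinfun \<otimes>\<^sub>o defect (adj A)) (L w) = L ((id_blinfun \<otimes>\<^sub>o (id_blinfun \<otimes>\<^sub>o defect (adj A))) w)"
    "V (K u) = L ((id_blinfun \<otimes>\<^sub>o T) u)" for u w
    unfolding K_def L_def
    by (rule compose_eq_apply, rule poisson_embedding_constant[OF X A(1)] poisson_embedding_constant[OF X A'(1)]
      poisson_embedding_constant[OF X D(1)] poisson_embedding_constant[OF X D(2)] V(1))+
  have NL: "N (L w) = L ((id_blinfun \<otimes>\<^sub>o N') w)" for w
  proof -
    define z where "z = ((id_blinfun :: 'h \<Rightarrow>\<^sub>L 'h) \<otimes>\<^sub>o N') w"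
    have "(id_blinfun - T \<circ>\<^sub>L a) \<circ>\<^sub>L N' = id_blinfun" unfolding N'_def by (rule neumann_inverse(2)[OF nTa])
    hence "((id_blinfun :: 'h \<Rightarrow>\<^sub>L 'h) \<otimes>\<^sub>o (id_blinfun - T \<circ>\<^sub>L a)) \<circ>\<^sub>L (id_blinfun \<otimes>\<^sub>o N') = id_blinfun"
      using T a N'c by (simp add: op_tensor_compose)
    hence "((id_blinfun - (id_blinfun :: 'h \<Rightarrow>\<^sub>L 'h) \<otimes>\<^sub>o (T \<circ>\<^sub>L a)) \<circ>\<^sub>L (id_blinfun \<otimes>\<^sub>o N')) = id_blinfun"
      using T a by (simp add: op_tensor_diff_right)
    from arg_cong[OF this, of "\<lambda>S. blinfun_apply S w"]
    have w: "w = z - (id_blinfun \<otimes>\<^sub>o (T \<circ>\<^sub>L a)) z" by (simp add: z_def blinfun.diff_left)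
    have "(id_blinfun :: 'h \<Rightarrow>\<^sub>L 'h) \<otimes>\<^sub>o (T \<circ>\<^sub>L a) = (id_blinfun \<otimes>\<^sub>o T) \<circ>\<^sub>L (id_blinfun \<otimes>\<^sub>o a)"
      using T a by (simp add: op_tensor_compose)
    hence "L w = L z - (V \<circ>\<^sub>L (id_blinfun \<otimes>\<^sub>o adj A)) (L z)"
      by (subst w) (simp add: blinfun.diff_right int a_def)
    thus ?thesis unfolding N_def z_def[symmetric] by (simp only: neumann_inverse_apply(1)[OF nVa])
  qed
  let ?I = "id_blinfun :: 'h \<Rightarrow>\<^sub>L 'h" and ?J = "id_blinfun :: 'n fock \<Rightarrow>\<^sub>L 'n fock"
  have "?I \<otimes>\<^sub>o mobius (?J \<otimes>\<^sub>o A) T = ?I \<otimes>\<^sub>o (?J \<otimes>\<^sub>o A) - (?I \<otimes>\<^sub>o (?J \<otimes>\<^sub>o defect (adj A)))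
      \<circ>\<^sub>L (?I \<otimes>\<^sub>o N') \<circ>\<^sub>L (?I \<otimes>\<^sub>o T) \<circ>\<^sub>L (?I \<otimes>\<^sub>o (?J \<otimes>\<^sub>o defect A))"
    unfolding mobius_def op_tensor_adj[OF cbop_id A(1)] adj_id defect_id_tensor[OF A] defect_id_tensor[OF A']
      a_def[symmetric] N'_def[symmetric]
    by (simp add: da op_tensor_compose op_tensor_diff_right A D T N'c)
  moreover have "mobius (?I \<otimes>\<^sub>o A) V = ?I \<otimes>\<^sub>o A - (?I \<otimes>\<^sub>o defect (adj A)) \<circ>\<^sub>L N \<circ>\<^sub>L V \<circ>\<^sub>L (?I \<otimes>\<^sub>o defect A)"
    unfolding mobius_def op_tensor_adj[OF cbop_id A(1)] adj_id defect_id_tensor[OF A] defect_id_tensor[OF A']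
      N_def by simp
  ultimately have "mobius (?I \<otimes>\<^sub>o A) V \<circ>\<^sub>L K = L \<circ>\<^sub>L (?I \<otimes>\<^sub>o mobius (?J \<otimes>\<^sub>o A) T)"
    by (intro blinfun_eqI) (simp add: blinfun.diff_left blinfun.diff_right int NL)
  hence "poisson_transform X (mobius (?J \<otimes>\<^sub>o A) T) = mobius (?I \<otimes>\<^sub>o A) V \<circ>\<^sub>L (K \<circ>\<^sub>L poisson_embedding X)"
    unfolding poisson_transform_def poisson_embedding_def[symmetric] L_def[symmetric]
    by (simp add: compose_assoc[symmetric])
  thus ?thesis by (simp add: K_def poisson_embedding_left_inverse[OF X])
qed

subsection \<open>The Schur ball\<close>

definition schur_dist ::
  "('n::countable, 'h::chilbert_space, 'e::chilbert_space, 'g::chilbert_space) ball_fun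
    \<Rightarrow> ('n, 'h, 'e, 'g) ball_fun \<Rightarrow> real" where
  "schur_dist F G = enn2real (fh_norm (\<lambda>X. F X - G X))"

lemma fh_norm_le_iff: "c \<ge> 0 \<Longrightarrow> fh_norm F \<le> ennreal c \<longleftrightarrow> (\<forall>X\<in>row_ball. norm (F X) \<le> c)"
  by (simp add: fh_norm_def SUP_le_iff)

lemma schur_ball_norm: "F \<in> schur_ball \<Longrightarrow> X \<in> row_ball \<Longrightarrow> norm (F X) \<le> 1"
  by (simp add: schur_ball_def fh_norm_le_1_iff)

lemma schur_dist_le_iff:
  assumes "F \<in> schur_ball" "G \<in> schur_ball" "c \<ge> 0"
  shows "schur_dist F G \<le> c \<longleftrightarrow> (\<forall>X\<in>row_ball. norm (F X - G X) \<le> c)"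
proof -
  have "norm (F X - G X) \<le> 2" if "X \<in> row_ball" for X
    using norm_triangle_ineq4[of "F X" "G X"] schur_ball_norm[OF assms(1) that] schur_ball_norm[OF assms(2) that]
    by linarith
  hence "fh_norm (\<lambda>X. F X - G X) \<le> ennreal 2" by (subst fh_norm_le_iff) auto
  hence "fh_norm (\<lambda>X. F X - G X) < top" by (rule le_less_trans) simp
  hence "fh_norm (\<lambda>X. F X - G X) = ennreal (schur_dist F G)" by (simp add: schur_dist_def)
  hence "schur_dist F G \<le> c \<longleftrightarrow> fh_norm (\<lambda>X. F X - G X) \<le> ennreal c"
    using assms(3) by simp
  thus ?thesis using assms(3) by (simp add: fh_norm_le_iff)
qed

lemma schur_dist_bound:
  assumes "F \<in> schur_ball" "G \<in> schur_ball" "X \<in> row_ball"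
  shows "norm (F X - G X) \<le> schur_dist F G"
  using schur_dist_le_iff[OF assms(1,2), of "schur_dist F G"] assms(3) by (simp add: schur_dist_def)

lemma schur_metric_space: "Metric_space schur_ball schur_dist"
proof
  fix F G H :: "('n::countable, 'h::chilbert_space, 'e::chilbert_space, 'g::chilbert_space) ball_fun"
  show "0 \<le> schur_dist F G" by (simp add: schur_dist_def)
  show "schur_dist F G = schur_dist G F" by (simp add: schur_dist_def fh_norm_def norm_minus_commute)
  assume F: "F \<in> schur_ball" and G: "G \<in> schur_ball"
  show "schur_dist F G = 0 \<longleftrightarrow> F = G"
  proof
    assume "schur_dist F G = 0"
    hence "F X = G X" if "X \<in> row_ball" for X using schur_dist_bound[OF F G that] by simp
    moreover have "F \<in> extensional row_ball" "G \<in> extensional row_ball"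
      using F G by (auto simp: schur_ball_def free_holomorphic_def PiE_def)
    ultimately show "F = G" by (intro extensionalityI)
  next
    assume "F = G"
    hence "schur_dist F G \<le> 0" using schur_dist_le_iff[OF F G, of 0] by simp
    moreover have "0 \<le> schur_dist F G" by (simp add: schur_dist_def)
    ultimately show "schur_dist F G = 0" by (rule order_antisym)
  qed
  assume H: "H \<in> schur_ball"
  have "0 \<le> schur_dist F G + schur_dist G H" by (simp add: schur_dist_def)
  moreover have "norm (F X - H X) \<le> schur_dist F G + schur_dist G H" if "X \<in> row_ball" for X
    using norm_triangle_ineq[of "F X - G X" "G X - H X"] schur_dist_bound[OF F G that]
      schur_dist_bound[OF G H that] by simp
  ultimately show "schur_dist F H \<le> schur_dist F G + schur_dist G H"
    using schur_dist_le_iff[OF F H] by blast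
qed

lemma schur_topology_eq: "schur_topology = Metric_space.mtopology schur_ball schur_dist"
  by (simp add: schur_topology_def schur_dist_def[abs_def])

text \<open>The candidate for the coefficients of \<open>\<Psi>\<^sub>A[F]\<close> is read off from the multi-analytic operator \<open>U = \<Psi>\<^sub>A(F')\<close>; the Poisson
  calculus shows that the series it defines has the values \<open>\<Psi>\<^sub>A(F(X))\<close>.  The boundary function of \<open>\<Psi>\<^sub>A[F]\<close> then
  is a multi-analytic operator with the same coefficients as \<open>U\<close>, so it is \<open>U\<close>.\<close>

lemma fh_mobius_schur:
  fixes F :: "('n::countable, 'h::chilbert_space, 'e::chilbert_space, 'g::chilbert_space) ball_fun"
  assumes inf: "\<not> (\<exists>B. finite B \<and> span B = (UNIV :: 'h set))"
    and F: "F \<in> schur_ball" and A: "A \<in> cbop" "norm A < 1"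
  shows "fh_mobius A F \<in> schur_ball"
    and "boundary_fun (fh_mobius A F) = mobius (id_blinfun \<otimes>\<^sub>o A) (boundary_fun F)"
    and "X \<in> row_ball \<Longrightarrow> fh_mobius A F X = poisson_transform X (mobius (id_blinfun \<otimes>\<^sub>o A) (boundary_fun F))"
    and "fh_mobius A (fh_mobius A F) = F"
proof -
  from F obtain C where FH: "free_holomorphic F" "fh_norm F \<le> 1" and C: "fh_coeffs F C"
    by (auto simp: schur_ball_def free_holomorphic_def)
  let ?A = "(id_blinfun :: 'h \<Rightarrow>\<^sub>L 'h) \<otimes>\<^sub>o A" and ?A' = "(id_blinfun :: 'n fock \<Rightarrow>\<^sub>L 'n fock) \<otimes>\<^sub>o A"
  define T where "T = boundary_fun F"
  define U where "U = mobius ?A' T"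
  have T: "multi_analytic T" "norm T \<le> 1" "fock_coeff T = C"
    unfolding T_def by (rule boundary_function[OF inf FH(2) C])+
  have cA: "?A \<in> cbop" "norm ?A < 1" "?A' \<in> cbop" "norm ?A' < 1"
    using A le_less_trans[OF norm_id_op_tensor_le[OF A(1)] A(2)] by simp_all
  have U: "multi_analytic U" unfolding U_def by (rule multi_analytic_mobius[OF T(1,2) A])
  have mt: "F X \<in> min_tensor cbop cbop" and nF: "norm (F X) \<le> 1" if "X \<in> row_ball" for X
    using FH that by (auto simp: free_holomorphic_def fh_norm_le_1_iff)
  have Fc: "F X \<in> cbop" if "X \<in> row_ball" for X
    using mt[OF that] min_tensor_cbop[OF order_refl] by blast
  have val: "poisson_transform X U = mobius ?A (F X)" if X: "X \<in> row_ball" for X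
  proof -
    have "fh_has_value C X (F X)" using C X by (simp add: fh_coeffs_def)
    hence "poisson_transform X T = F X"
      using poisson_calculus(1)[OF X T(1)] unfolding T(3) by (rule fh_has_value_unique[rotated])
    hence "F X \<circ>\<^sub>L adj (poisson_embedding X) = adj (poisson_embedding X) \<circ>\<^sub>L (id_blinfun \<otimes>\<^sub>o T)"
      using poisson_calculus(2)[OF X T(1)] by simp
    thus ?thesis
      unfolding U_def using poisson_transform_mobius[OF X multi_analytic_cbop[OF T(1)] T(2) A _ nF[OF X]] by blast
  qed
  have Psi: "fh_mobius A F X = mobius ?A (F X)" if "X \<in> row_ball" for X
    using that by (simp add: fh_mobius_def)
  have "fh_mobius A F \<in> row_ball \<rightarrow>\<^sub>E min_tensor cbop cbop"
    unfolding fh_mobius_def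
    by (intro restrict_PiE_iff[THEN iffD2] ballI min_tensor_mobius order_refl cbop_id cbop_compose mt nF A)
  moreover have coeffs: "fh_coeffs (fh_mobius A F) (fock_coeff U)"
    unfolding fh_coeffs_def
  proof (intro conjI allI ballI)
    show "fock_coeff U \<alpha> \<in> cbop" for \<alpha> by (rule fock_coeff_cbop[OF multi_analytic_cbop[OF U]])
    fix X :: "'n \<Rightarrow> 'h \<Rightarrow>\<^sub>L 'h" assume X: "X \<in> row_ball"
    show "fh_has_value (fock_coeff U) X (fh_mobius A F X)"
      using poisson_calculus(1)[OF X U] by (simp add: Psi[OF X] val[OF X])
  qed
  moreover have n: "fh_norm (fh_mobius A F) \<le> 1"
    unfolding fh_norm_le_1_iff
    by (intro ballI) (simp add: Psi norm_mobius_le[OF cA(1,2) Fc nF])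
  ultimately show "fh_mobius A F \<in> schur_ball" by (auto simp: schur_ball_def free_holomorphic_def)
  note B = boundary_function[OF inf n coeffs]
  have "boundary_fun (fh_mobius A F) = U"
    by (rule multi_analytic_eqI[OF B(1) U]) (simp add: B(3))
  thus "boundary_fun (fh_mobius A F) = mobius ?A' (boundary_fun F)" by (simp add: U_def T_def)
  show "X \<in> row_ball \<Longrightarrow> fh_mobius A F X = poisson_transform X (mobius ?A' (boundary_fun F))"
    using val[of X] by (simp add: Psi U_def T_def)
  show "fh_mobius A (fh_mobius A F) = F"
  proof (rule extensionalityI)
    show "fh_mobius A (fh_mobius A F) \<in> extensional row_ball" by (simp add: fh_mobius_def)
    show "F \<in> extensional row_ball" using FH by (auto simp: free_holomorphic_def PiE_def)
    fix X :: "'n \<Rightarrow> 'h \<Rightarrow>\<^sub>L 'h" assume X: "X \<in> row_ball"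
    show "fh_mobius A (fh_mobius A F) X = F X"
      using X by (simp add: fh_mobius_def mobius_involution[OF cA(1,2) Fc nF])
  qed
qed

lemma fh_mobius_continuous:
  fixes A :: "'e::chilbert_space \<Rightarrow>\<^sub>L 'g::chilbert_space"
  assumes inf: "\<not> (\<exists>B. finite B \<and> span B = (UNIV :: 'h::chilbert_space set))"
    and A: "A \<in> cbop" "norm A < 1"
  shows "continuous_map (schur_topology :: ('n::countable, 'h, 'e, 'g) ball_fun topology) schur_topology (fh_mobius A)"
proof -
  interpret Metric_space "schur_ball :: ('n, 'h, 'e, 'g) ball_fun set" schur_dist
    by (rule schur_metric_space)
  let ?A = "(id_blinfun :: 'h \<Rightarrow>\<^sub>L 'h) \<otimes>\<^sub>o A"
  have cA: "?A \<in> cbop" "norm ?A < 1"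
    using A le_less_trans[OF norm_id_op_tensor_le[OF A(1)] A(2)] by simp_all
  define L where "L = (2 / (1 - norm ?A))\<^sup>2"
  have L: "L > 0" using cA by (simp add: L_def)
  have lip: "schur_dist (fh_mobius A F) (fh_mobius A G) \<le> L * schur_dist F G"
    if F: "F \<in> schur_ball" and G: "G \<in> schur_ball" for F G :: "('n, 'h, 'e, 'g) ball_fun"
  proof -
    have "norm (fh_mobius A F X - fh_mobius A G X) \<le> L * schur_dist F G" if X: "X \<in> row_ball" for X
    proof -
      have "norm (mobius ?A (F X) - mobius ?A (G X)) \<le> L * norm (F X - G X)"
        unfolding L_def by (rule mobius_lipschitz[OF cA schur_ball_norm[OF F X] schur_ball_norm[OF G X]])
      also have "\<dots> \<le> L * schur_dist F G"
        using L by (intro mult_left_mono schur_dist_bound[OF F G X]) simp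
      finally show ?thesis using X by (simp add: fh_mobius_def)
    qed
    moreover have "0 \<le> L * schur_dist F G" using L nonneg by simp
    ultimately show ?thesis
      using schur_dist_le_iff[OF fh_mobius_schur(1)[OF inf F A] fh_mobius_schur(1)[OF inf G A]] by blast
  qed
  show ?thesis
    unfolding schur_topology_eq metric_continuous_map[OF Metric_space_axioms]
  proof (intro conjI ballI allI impI)
    show "fh_mobius A ` schur_ball \<subseteq> (schur_ball :: ('n, 'h, 'e, 'g) ball_fun set)"
      using fh_mobius_schur(1)[OF inf _ A] by blast
    fix F :: "('n, 'h, 'e, 'g) ball_fun" and e :: real
    assume F: "F \<in> schur_ball" and e: "e > 0"
    have "schur_dist (fh_mobius A F) (fh_mobius A G) < e" if "G \<in> schur_ball \<and> schur_dist F G < e / L" for G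
    proof -
      have "L * schur_dist F G < e" using that L by (simp add: field_simps)
      thus ?thesis using lip[OF F, of G] that by linarith
    qed
    thus "\<exists>\<delta>>0. \<forall>G. G \<in> schur_ball \<and> schur_dist F G < \<delta> \<longrightarrow> schur_dist (fh_mobius A F) (fh_mobius A G) < e"
      using e L by (intro exI[of _ "e / L"]) auto
  qed
qed

theorem theorem1p3:
  fixes F \<Psi>F :: "('n::countable, 'h::chilbert_space, 'e::chilbert_space, 'g::chilbert_space) ball_fun"
    and A\<^sub>0 :: "'e \<Rightarrow>\<^sub>L 'g"
    and A :: "('h, 'e) htensor \<Rightarrow>\<^sub>L ('h, 'g) htensor"
    and A' F' \<Psi>F' :: "('n fock, 'e) htensor \<Rightarrow>\<^sub>L ('n fock, 'g) htensor"
  assumes "separable_space (euclidean :: 'h topology)"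
    and "\<not> (\<exists>B. finite B \<and> span B = (UNIV :: 'h set))"
    and "free_holomorphic F" and "fh_norm F \<le> 1"
    and "A\<^sub>0 \<in> cbop" and "norm A\<^sub>0 < 1"
    and "A = id_blinfun \<otimes>\<^sub>o A\<^sub>0" and "A' = id_blinfun \<otimes>\<^sub>o A\<^sub>0"
    and "F' = boundary_fun F"
    and "\<Psi>F = fh_mobius A\<^sub>0 F" and "\<Psi>F' = boundary_fun \<Psi>F"
  shows
    "(free_holomorphic \<Psi>F \<and> fh_norm \<Psi>F \<le> 1 \<and>
      \<Psi>F' = mobius A' F' \<and>
      id_blinfun - \<Psi>F' \<circ>\<^sub>L adj \<Psi>F' =
        defect (adj A') \<circ>\<^sub>L op_inv (id_blinfun - F' \<circ>\<^sub>L adj A') \<circ>\<^sub>L (id_blinfun - F' \<circ>\<^sub>L adj F')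
          \<circ>\<^sub>L op_inv (id_blinfun - A' \<circ>\<^sub>L adj F') \<circ>\<^sub>L defect (adj A') \<and>
      id_blinfun - adj \<Psi>F' \<circ>\<^sub>L \<Psi>F' =
        defect A' \<circ>\<^sub>L op_inv (id_blinfun - adj F' \<circ>\<^sub>L A') \<circ>\<^sub>L (id_blinfun - adj F' \<circ>\<^sub>L F')
          \<circ>\<^sub>L op_inv (id_blinfun - adj A' \<circ>\<^sub>L F') \<circ>\<^sub>L defect A')
     \<and>
     (\<forall>X\<in>row_ball.
        \<Psi>F X = poisson_transform X (mobius A' F') \<and>
        \<Psi>F X = A - defect (adj A) \<circ>\<^sub>L op_inv (id_blinfun - F X \<circ>\<^sub>L adj A) \<circ>\<^sub>L F X \<circ>\<^sub>L defect A \<and>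
        \<Psi>F X = mobius A (F X))
     \<and>
     (fh_mobius A\<^sub>0 (fh_const 0 :: ('n, 'h, 'e, 'g) ball_fun) = fh_const A\<^sub>0 \<and>
      fh_mobius A\<^sub>0 (fh_const A\<^sub>0 :: ('n, 'h, 'e, 'g) ball_fun) = fh_const 0 \<and>
      fh_mobius A\<^sub>0 (fh_mobius A\<^sub>0 F) = F)
     \<and>
     homeomorphic_map (schur_topology :: ('n, 'h, 'e, 'g) ball_fun topology) schur_topology
       (fh_mobius A\<^sub>0)
     \<and>
     (isometry_op F' \<longleftrightarrow> isometry_op \<Psi>F')
     \<and>
     (F' \<in> min_tensor disc_algebra cbop \<longleftrightarrow> \<Psi>F' \<in> min_tensor disc_algebra cbop)"
proof -
  note inf = assms(2) and A0 = assms(5,6)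
  have FS: "F \<in> schur_ball" using assms(3,4) by (simp add: schur_ball_def)
  note M = fh_mobius_schur[OF inf FS A0]
  have A: "A \<in> cbop" "norm A < 1" and A': "A' \<in> cbop" "norm A' < 1"
    using A0 le_less_trans[OF norm_id_op_tensor_le[OF A0(1)] A0(2)] by (simp_all add: assms(7,8))
  obtain C where C: "fh_coeffs F C" using assms(3) by (auto simp: free_holomorphic_def)
  note B = boundary_function[OF inf assms(4) C]
  have F': "F' \<in> cbop" "norm F' \<le> 1" using B multi_analytic_cbop by (auto simp: assms(9))
  have P': "\<Psi>F' = mobius A' F'" by (simp add: assms(8-11) M(2))
  have c1: "free_holomorphic \<Psi>F" "fh_norm \<Psi>F \<le> 1" using M(1) by (simp_all add: assms(10) schur_ball_def)
  note c2 = mobius_defect_left[OF A' F', folded P'] mobius_defect_right[OF A' F', folded P']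
  have c3: "\<forall>X\<in>row_ball. \<Psi>F X = poisson_transform X (mobius A' F') \<and>
        \<Psi>F X = A - defect (adj A) \<circ>\<^sub>L op_inv (id_blinfun - F X \<circ>\<^sub>L adj A) \<circ>\<^sub>L F X \<circ>\<^sub>L defect A \<and>
        \<Psi>F X = mobius A (F X)"
  proof (intro ballI conjI)
    fix X :: "'n \<Rightarrow> 'h \<Rightarrow>\<^sub>L 'h" assume X: "X \<in> row_ball"
    show "\<Psi>F X = poisson_transform X (mobius A' F')"
      unfolding assms(8-10) by (rule M(3)[OF X])
    show *: "\<Psi>F X = mobius A (F X)" using X by (simp add: assms(7,10) fh_mobius_def)
    show "\<Psi>F X = A - defect (adj A) \<circ>\<^sub>L op_inv (id_blinfun - F X \<circ>\<^sub>L adj A) \<circ>\<^sub>L F X \<circ>\<^sub>L defect A"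
      using * unfolding mobius_def .
  qed
  have c4: "fh_mobius A\<^sub>0 (fh_const 0 :: ('n, 'h, 'e, 'g) ball_fun) = fh_const A\<^sub>0"
    by (auto simp: fh_mobius_def fh_const_def mobius_zero)
  have c5: "fh_mobius A\<^sub>0 (fh_const A\<^sub>0 :: ('n, 'h, 'e, 'g) ball_fun) = fh_const 0"
    using mobius_self[OF A] by (auto simp: fh_mobius_def fh_const_def assms(7))
  have c6: "homeomorphic_map (schur_topology :: ('n, 'h, 'e, 'g) ball_fun topology) schur_topology (fh_mobius A\<^sub>0)"
  proof (rule homeomorphic_maps_imp_map)
    show "homeomorphic_maps schur_topology (schur_topology :: ('n, 'h, 'e, 'g) ball_fun topology)
        (fh_mobius A\<^sub>0) (fh_mobius A\<^sub>0)"
      unfolding homeomorphic_maps_def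
      by (intro conjI fh_mobius_continuous[OF inf A0])
         (simp_all add: fh_mobius_schur(4)[OF inf _ A0] schur_topology_eq
          Metric_space.topspace_mtopology[OF schur_metric_space])
  qed
  have c7: "isometry_op F' \<longleftrightarrow> isometry_op \<Psi>F'"
    unfolding P' by (rule mobius_isometry_iff[OF A' F', symmetric])
  have mt: "mobius A' T \<in> min_tensor disc_algebra cbop" if "T \<in> min_tensor disc_algebra cbop" "norm T \<le> 1" for T
    unfolding assms(8) by (rule min_tensor_mobius[OF disc_algebra_props that A0])
  have c8: "F' \<in> min_tensor disc_algebra cbop \<longleftrightarrow> \<Psi>F' \<in> min_tensor disc_algebra cbop"
  proof
    show "\<Psi>F' \<in> min_tensor disc_algebra cbop" if "F' \<in> min_tensor disc_algebra cbop"
      unfolding P' by (rule mt[OF that F'(2)])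
    show "F' \<in> min_tensor disc_algebra cbop" if "\<Psi>F' \<in> min_tensor disc_algebra cbop"
      using mt[OF that[unfolded P'] norm_mobius_le[OF A' F']] unfolding mobius_involution[OF A' F'] .
  qed
  show ?thesis
    by (intro conjI; (rule c1 P' c2 c3 c4 c5 M(4) c6 c7 c8))
qed

end
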